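(* For all integers $m \geq 93$ and $n \geq 31m$, \[\mu(n,n-m) = 2n - \left\lfloor \frac{n}{m} \right\rfloor.\]
   Context: All digraphs are finite, without loops and without multiple arcs (both arcs $uv$ and $vu$ may be present). For digraphs $D=(V,A)$ and $D'=(V',A')$ with $|V| \leq |V'|$, a packing of $D$ and $D'$ is an injection $f: V \to V'$ such that there is no arc $uv \in A$ with $f(u)f(v) \in A'$; if such an injection exists we say $D$ and $D'$ pack. For integers $n$ and $k$ with $1 \leq k \leq n(n-1)$, $\mu(n,k)$ denotes the smallest number such that there exist digraphs $D$ and $D'$, both on $n$ vertices, with $|A(D)| = k$ and $|A(D')| = \mu(n,k)$ which do not pack. *)

theory Defs
  imports Complex_Main "Graph_Theory.Pair_Digraph"
begin

definition is_packing ::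
  "('a \<Rightarrow> 'b) \<Rightarrow> 'a pair_pre_digraph \<Rightarrow> 'b pair_pre_digraph \<Rightarrow> bool" where
  "is_packing f D D' \<longleftrightarrow>
     inj_on f (pverts D) \<and> f ` pverts D \<subseteq> pverts D' \<and>
     (\<forall>u v. (u, v) \<in> parcs D \<longrightarrow> (f u, f v) \<notin> parcs D')"

definition pack :: "'a pair_pre_digraph \<Rightarrow> 'b pair_pre_digraph \<Rightarrow> bool" where
  "pack D D' \<longleftrightarrow> (\<exists>f. is_packing f D D')"

text \<open>
  Vertices are taken from the type of natural numbers; since packing is invariant under
  isomorphism and every finite digraph is isomorphic to one of this kind, this is no restriction.
  For \<open>1 \<le> k \<le> n * (n - 1)\<close> the minimum is over a nonempty set (take the complete digraph for
  \<open>D'\<close>); outside this range the value is meaningless.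
\<close>

definition mu :: "nat \<Rightarrow> nat \<Rightarrow> nat" where
  "mu n k = (LEAST l. \<exists>(D :: nat pair_pre_digraph) (D' :: nat pair_pre_digraph).
     pair_digraph D \<and> pair_digraph D' \<and>
     card (pverts D) = n \<and> card (pverts D') = n \<and>
     card (parcs D) = k \<and> card (parcs D') = l \<and>
     \<not> pack D D')"

end

theory Submission
  imports Defs "HOL-Combinatorics.Permutations"
begin

text \<open>
  For the lower bound let \<open>D\<close> have \<open>n - m\<close> arcs and \<open>D'\<close> at most \<open>2 * n - q - 1\<close> arcs, where
  \<open>q = n div m\<close>. A uniformly random bijection has slightly fewer than two conflicts on average, so some
  bijection has at most one; if the degrees are small compared with the slack \<open>2 * m + q\<close>, a Markov
  type argument finds one whose single conflict \<open>u v\<close> is removed by exchanging the images of \<open>v\<close> and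
  a suitable other vertex. Vertices of high degree are placed beforehand. A high-degree vertex \<open>x\<close>
  of \<open>D'\<close> hosts a vertex of degree at most one of a small tree component of \<open>D\<close> (there are at least \<open>m\<close> tree
  components), and the neighbour of that vertex is put on a non-neighbour of \<open>x\<close> chosen by averaging.
  A high-degree vertex \<open>u\<close> of \<open>D\<close> is put on a vertex of degree at most three, whose neighbours host
  leaves of tree components as before. Each such placement increases the slack by about the degree
  involved, so a bounded number of them suffices. Only a vertex \<open>x\<close> of \<open>D'\<close> of degree above
  \<open>51 * n / 100\<close> needs another treatment: a smallest tree component, which has at most \<open>q\<close> vertices,
  is placed completely, with a leaf, a sink or a source on \<open>x\<close>; this is the step in which the bound is tight.
\<close>

text \<open>Since \<open>(n - m) * (2 * n - q)\<close> is about
  \<open>2 * n * n - n * (2 * m + q)\<close>, the expected number of conflicts is about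
  \<open>2 - (2 * m + q) / n\<close>. This excludes two conflicts but not a single one, which is
  what forces the exchange and makes large degrees the obstacle. Vertices placed beforehand restrict
  the images of the others, so the random argument has to be about packings with a set
  \<open>F\<close> of forbidden pairs. Up to 4 vertices of \<open>D\<close> and 6 of
  \<open>D'\<close> are placed for their degree. The hosts of the former have at most 3 neighbours
  each, so up to \<open>6 + 3 * 4 = 18\<close> vertices of \<open>D'\<close> receive a vertex of a
  tree component, each from a component of its own that is small and misses the 4 chosen vertices. A
  margin of 92 tree components guarantees these 18. Deleting a smallest tree component together with
  its images lowers the margin by exactly one, and one such deletion may come before the preplacing,
  whence \<open>m >= 93\<close>. After two deletions \<open>D'\<close> has lost more than half of
  its arcs, and the expected number of conflicts is below one.\<close>

definition inc :: "('a \<times> 'a) set \<Rightarrow> 'a \<Rightarrow> ('a \<times> 'a) set" where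
  "inc A v = {a \<in> A. fst a = v \<or> snd a = v}"

definition deg :: "('a \<times> 'a) set \<Rightarrow> 'a \<Rightarrow> nat" where
  "deg A v = card (inc A v)"

text \<open>Bare vertex and arc sets turn induced subdigraphs into intersections, the form in which
  the remainders after preplacing arise.\<close>

definition digr :: "'a set \<Rightarrow> ('a \<times> 'a) set \<Rightarrow> bool" where
  "digr V A \<longleftrightarrow> finite V \<and> A \<subseteq> V \<times> V \<and> (\<forall>a\<in>A. fst a \<noteq> snd a)"

lemma digr_finite: "digr V A \<Longrightarrow> finite V" "digr V A \<Longrightarrow> finite A"
  unfolding digr_def using finite_subset by blast+

lemma deg_eq_out_in:
  assumes "digr V A"
  shows "deg A v = card {a \<in> A. fst a = v} + card {a \<in> A. snd a = v}"
proof -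
  have "inc A v = {a \<in> A. fst a = v} \<union> {a \<in> A. snd a = v}"
    by (auto simp: inc_def)
  moreover have "{a \<in> A. fst a = v} \<inter> {a \<in> A. snd a = v} = {}"
    using assms by (auto simp: digr_def)
  ultimately show ?thesis
    using digr_finite(2)[OF assms] by (simp add: deg_def card_Un_disjoint)
qed

section \<open>Random bijections and one swap\<close>

text \<open>Composition with the inverse of one fixed member sends all members to permutations
  fixing \<open>S\<close> pointwise, that is, to permutations of \<open>V - S\<close>. Equality
  cannot be claimed: for an unsuitable \<open>h\<close> there is no member at all.\<close>

lemma card_permutes_extending:
  assumes "finite V" "S \<subseteq> V"
  shows "card {p. p permutes V \<and> (\<forall>s\<in>S. p s = h s)} \<le> fact (card V - card S)"
proof (cases "{p. p permutes V \<and> (\<forall>s\<in>S. p s = h s)} = {}")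
  case False
  then obtain p0 where p0: "p0 permutes V" "\<forall>s\<in>S. p0 s = h s" by auto
  let ?P = "{p. p permutes V \<and> (\<forall>s\<in>S. p s = h s)}"
  have inj: "inj_on (\<lambda>p. inv p0 \<circ> p) ?P"
  proof (rule inj_onI)
    fix p q assume "inv p0 \<circ> p = inv p0 \<circ> q"
    then have "p0 \<circ> (inv p0 \<circ> p) = p0 \<circ> (inv p0 \<circ> q)" by simp
    then show "p = q"
      using permutes_inv_o(1)[OF p0(1)] by (simp add: o_assoc)
  qed
  have sub: "(\<lambda>p. inv p0 \<circ> p) ` ?P \<subseteq> {q. q permutes (V - S)}"
  proof clarify
    fix p assume p: "p permutes V" "\<forall>s\<in>S. p s = h s"
    have "inv p0 \<circ> p permutes V"
      using p(1) p0(1) by (simp add: permutes_compose permutes_inv)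
    moreover have "\<forall>x\<in>S. (inv p0 \<circ> p) x = x"
      using p p0 permutes_inverses(2)[OF p0(1)] by (metis comp_apply)
    ultimately show "inv p0 \<circ> p permutes (V - S)"
      by (smt (verit) permutes_superset DiffI Diff_iff)
  qed
  have fin: "finite {q. q permutes (V - S)}"
    using assms by (simp add: finite_permutations)
  have "card ?P \<le> card {q. q permutes (V - S)}"
    using card_inj_on_le[OF inj sub fin] .
  also have "\<dots> = fact (card V - card S)"
    using assms by (subst card_permutations) (auto simp: card_Diff_subset finite_subset)
  finally show ?thesis .
qed (simp only: card.empty zero_le)

lemma card_permutes_1:
  assumes "finite V" "u \<in> V"
  shows "card {p. p permutes V \<and> p u = x} \<le> fact (card V - 1)"
  using card_permutes_extending[OF assms(1), of "{u}" "\<lambda>_. x"] assms(2) by simp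

lemma card_permutes_2:
  assumes "finite V" "u \<in> V" "v \<in> V" "u \<noteq> v"
  shows "card {p. p permutes V \<and> p u = x \<and> p v = z} \<le> fact (card V - 2)"
  using card_permutes_extending[OF assms(1), of "{u, v}" "\<lambda>w. if w = u then x else z"] assms
  by (simp add: conj_ac eval_nat_numeral)

lemma card_permutes_3:
  assumes "finite V" "u \<in> V" "v \<in> V" "w \<in> V" "u \<noteq> v" "u \<noteq> w" "v \<noteq> w"
  shows "card {p. p permutes V \<and> p u = x \<and> p v = z \<and> p w = t} \<le> fact (card V - 3)"
  using card_permutes_extending[OF assms(1), of "{u, v, w}"
      "\<lambda>y. if y = u then x else if y = v then z else t"] assms
  by (simp add: conj_ac eval_nat_numeral)

section \<open>Obstructions to an exchange, averaged over bijections\<close>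

lemma sum_card_swap:
  assumes "finite I" "finite J"
  shows "(\<Sum>i\<in>I. card {j\<in>J. R i j}) = (\<Sum>j\<in>J. card {i\<in>I. R i j})"
proof -
  have "(\<Sum>i\<in>I. card {j\<in>J. R i j}) = (\<Sum>i\<in>I. \<Sum>j\<in>J. if R i j then 1 else 0)"
    using assms by (simp add: sum.If_cases Int_def)
  also have "\<dots> = (\<Sum>j\<in>J. \<Sum>i\<in>I. if R i j then 1 else 0)"
    by (rule sum.swap)
  also have "\<dots> = (\<Sum>j\<in>J. card {i\<in>I. R i j})"
    using assms by (simp add: sum.If_cases Int_def)
  finally show ?thesis .
qed

text \<open>Each pair counted by \<open>near A B f v u\<close> rules out at most one partner \<open>w\<close> for exchanging
  the images of \<open>v\<close> and \<open>w\<close> under \<open>f\<close>; the other end \<open>u\<close> of the conflicting arc, whose image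
  is not random, is accounted for separately.\<close>

definition near1 where
  "near1 A B f v u = {(a, b) \<in> A \<times> B. fst a = v \<and> snd a \<noteq> u \<and> f (snd a) = snd b}"
definition near2 where
  "near2 A B f v u = {(a, b) \<in> A \<times> B. snd a = v \<and> fst a \<noteq> u \<and> f (fst a) = fst b}"
definition near3 where
  "near3 A B f v u = {(a, b) \<in> A \<times> B. fst b = f v \<and> snd a \<noteq> u \<and> f (snd a) = snd b}"
definition near4 where
  "near4 A B f v u = {(a, b) \<in> A \<times> B. snd b = f v \<and> fst a \<noteq> u \<and> f (fst a) = fst b}"

definition near where
  "near A B f v u = card (near1 A B f v u) + card (near2 A B f v u)
     + card (near3 A B f v u) + card (near4 A B f v u)"

lemma sum_card_pairs_le:
  assumes fin: "finite K" "finite A" "finite B"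
    and c: "\<And>a b. a \<in> A \<Longrightarrow> b \<in> B \<Longrightarrow> card {f \<in> K. R f a b} \<le> (if Q a b then c else 0)"
  shows "(\<Sum>f\<in>K. card {(a, b) \<in> A \<times> B. R f a b}) \<le> c * card {(a, b) \<in> A \<times> B. Q a b}"
proof -
  have "(\<Sum>f\<in>K. card {(a, b) \<in> A \<times> B. R f a b})
      = (\<Sum>f\<in>K. card {j \<in> A \<times> B. R f (fst j) (snd j)})"
    by (intro sum.cong arg_cong[where f = card]) auto
  also have "\<dots> = (\<Sum>j\<in>A \<times> B. card {f\<in>K. R f (fst j) (snd j)})"
    using fin by (intro sum_card_swap) auto
  also have "\<dots> \<le> (\<Sum>j\<in>A \<times> B. if Q (fst j) (snd j) then c else 0)"
  proof (rule sum_mono)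
    fix j assume "j \<in> A \<times> B"
    then show "card {f\<in>K. R f (fst j) (snd j)} \<le> (if Q (fst j) (snd j) then c else 0)"
      by (intro c) auto
  qed
  also have "\<dots> = c * card {j \<in> A \<times> B. Q (fst j) (snd j)}"
    using fin by (simp add: sum.If_cases Int_def)
  also have "{j \<in> A \<times> B. Q (fst j) (snd j)} = {(a, b) \<in> A \<times> B. Q a b}" by auto
  finally show ?thesis .
qed

text \<open>With the image of \<open>v\<close> (and possibly of \<open>u\<close>) prescribed in
  \<open>K\<close>, a pair of arcs is counted by \<open>near\<close> only if one further vertex has
  a prescribed image, which happens for at most \<open>c\<close> members. \<open>near1\<close> and
  \<open>near2\<close> involve the arcs at \<open>v\<close> against all of \<open>B\<close>,
  \<open>near3\<close> and \<open>near4\<close> all of \<open>A\<close> against the arcs at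
  \<open>z\<close>.\<close>

lemma sum_near_le:
  assumes A: "digr V A" and B: "digr V B" and K: "finite K"
    and v: "\<And>f. f \<in> K \<Longrightarrow> f v = z"
    and c: "\<And>y t. y \<in> V \<Longrightarrow> y \<noteq> u \<Longrightarrow> y \<noteq> v \<Longrightarrow> card {f \<in> K. f y = t} \<le> c"
  shows "(\<Sum>f\<in>K. near A B f v u) \<le> c * (deg A v * card B + deg B z * card A)"
proof -
  note fin = K digr_finite(2)[OF A] digr_finite(2)[OF B]
  have AV: "fst a \<in> V" "snd a \<in> V" "fst a \<noteq> snd a" if "a \<in> A" for a
    using A that by (auto simp: digr_def)
  have BV: "fst b \<noteq> snd b" if "b \<in> B" for b
    using B that by (auto simp: digr_def)
  have n1: "(\<Sum>f\<in>K. card (near1 A B f v u)) \<le> c * card {(a, b) \<in> A \<times> B. fst a = v}"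
    unfolding near1_def
  proof (rule sum_card_pairs_le[OF fin])
    fix a b assume ab: "a \<in> A" "b \<in> B"
    show "card {f \<in> K. fst a = v \<and> snd a \<noteq> u \<and> f (snd a) = snd b} \<le> (if fst a = v then c else 0)"
    proof (cases "fst a = v \<and> snd a \<noteq> u")
      case True
      then show ?thesis using c[of "snd a" "snd b"] AV[OF ab(1)] by auto
    next
      case False
      then have "{f \<in> K. fst a = v \<and> snd a \<noteq> u \<and> f (snd a) = snd b} = {}" by auto
      then show ?thesis by (metis card.empty zero_le)
    qed
  qed
  have n2: "(\<Sum>f\<in>K. card (near2 A B f v u)) \<le> c * card {(a, b) \<in> A \<times> B. snd a = v}"
    unfolding near2_def
  proof (rule sum_card_pairs_le[OF fin])
    fix a b assume ab: "a \<in> A" "b \<in> B"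
    show "card {f \<in> K. snd a = v \<and> fst a \<noteq> u \<and> f (fst a) = fst b} \<le> (if snd a = v then c else 0)"
    proof (cases "snd a = v \<and> fst a \<noteq> u")
      case True
      then show ?thesis using c[of "fst a" "fst b"] AV[OF ab(1)] by auto
    next
      case False
      then have "{f \<in> K. snd a = v \<and> fst a \<noteq> u \<and> f (fst a) = fst b} = {}" by auto
      then show ?thesis by (metis card.empty zero_le)
    qed
  qed
  have n3: "(\<Sum>f\<in>K. card (near3 A B f v u)) \<le> c * card {(a, b) \<in> A \<times> B. fst b = z}"
    unfolding near3_def
  proof (rule sum_card_pairs_le[OF fin])
    fix a b assume ab: "a \<in> A" "b \<in> B"
    show "card {f \<in> K. fst b = f v \<and> snd a \<noteq> u \<and> f (snd a) = snd b} \<le> (if fst b = z then c else 0)"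
    \<comment> \<open>The case \<open>snd a = v\<close> is vacuous: \<open>fst b = f v\<close> and
      \<open>f (snd a) = snd b\<close> would make \<open>b\<close> a loop. So \<open>c\<close> is
      only needed for vertices other than \<open>u\<close> and \<open>v\<close>.\<close>
    proof (cases "fst b = z \<and> snd a \<noteq> u \<and> snd a \<noteq> v")
      case True
      then have "{f \<in> K. fst b = f v \<and> snd a \<noteq> u \<and> f (snd a) = snd b} = {f \<in> K. f (snd a) = snd b}"
        using v by auto
      then show ?thesis using c[of "snd a" "snd b"] AV ab True by auto
    next
      case False
      then have "{f \<in> K. fst b = f v \<and> snd a \<noteq> u \<and> f (snd a) = snd b} = {}"
        using v BV[OF ab(2)] by auto
      then show ?thesis by (metis card.empty zero_le)
    qed
  qed
  have n4: "(\<Sum>f\<in>K. card (near4 A B f v u)) \<le> c * card {(a, b) \<in> A \<times> B. snd b = z}"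
    unfolding near4_def
  proof (rule sum_card_pairs_le[OF fin])
    fix a b assume ab: "a \<in> A" "b \<in> B"
    show "card {f \<in> K. snd b = f v \<and> fst a \<noteq> u \<and> f (fst a) = fst b} \<le> (if snd b = z then c else 0)"
    proof (cases "snd b = z \<and> fst a \<noteq> u \<and> fst a \<noteq> v")
      case True
      then have "{f \<in> K. snd b = f v \<and> fst a \<noteq> u \<and> f (fst a) = fst b} = {f \<in> K. f (fst a) = fst b}"
        using v by auto
      then show ?thesis using c[of "fst a" "fst b"] AV ab True by auto
    next
      case False
      then have "{f \<in> K. snd b = f v \<and> fst a \<noteq> u \<and> f (fst a) = fst b} = {}"
        using v BV[OF ab(2)] by auto
      then show ?thesis by (metis card.empty zero_le)
    qed
  qed
  have pA: "card {(a, b) \<in> A \<times> B. P a} = card {a\<in>A. P a} * card B" for P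
    by (subst card_cartesian_product[symmetric], rule arg_cong[where f = card]) auto
  have pB: "card {(a, b) \<in> A \<times> B. P b} = card A * card {b\<in>B. P b}" for P
    by (subst card_cartesian_product[symmetric], rule arg_cong[where f = card]) auto
  have "(\<Sum>f\<in>K. near A B f v u) \<le> c * (card {a\<in>A. fst a = v} * card B)
     + c * (card {a\<in>A. snd a = v} * card B) + c * (card A * card {b\<in>B. fst b = z})
     + c * (card A * card {b\<in>B. snd b = z})"
    unfolding near_def sum.distrib
    using n1 n2 n3 n4 unfolding pA pB by (intro add_mono) auto
  then show ?thesis
    unfolding deg_eq_out_in[OF A] deg_eq_out_in[OF B] by (simp add: algebra_simps)
qed

section \<open>Neighbourhoods and the exchange that removes a conflict\<close>

definition nbr :: "('a \<times> 'a) set \<Rightarrow> 'a \<Rightarrow> 'a set" where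
  "nbr A u = {w. (u, w) \<in> A \<or> (w, u) \<in> A}"

lemma finite_inc: "finite A \<Longrightarrow> finite (inc A v)"
  by (simp add: inc_def)

lemma card_le_image:
  assumes "finite T" "S \<subseteq> h ` T"
  shows "card S \<le> card T"
  using assms by (meson card_image_le card_mono finite_imageI le_trans)

lemma obtain_outside:
  assumes "finite S" "card S < card V"
  obtains w where "w \<in> V" "w \<notin> S"
  using assms by (meson card_mono not_le subsetI)

lemma nbr_subset_image: "nbr A u \<subseteq> (\<lambda>a. if fst a = u then snd a else fst a) ` inc A u"
proof
  fix w assume "w \<in> nbr A u"
  then consider "(u, w) \<in> A" | "(w, u) \<in> A" by (auto simp: nbr_def)
  then show "w \<in> (\<lambda>a. if fst a = u then snd a else fst a) ` inc A u"
  proof cases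
    case 1
    then show ?thesis by (intro image_eqI[of _ _ "(u, w)"]) (auto simp: inc_def)
  next
    case 2
    then show ?thesis by (intro image_eqI[of _ _ "(w, u)"]) (auto simp: inc_def)
  qed
qed

lemma finite_nbr: "finite A \<Longrightarrow> finite (nbr A u)"
  by (rule finite_subset[OF nbr_subset_image]) (simp add: finite_inc)

lemma card_nbr_le_deg: "finite A \<Longrightarrow> card (nbr A u) \<le> deg A u"
  unfolding deg_def by (rule card_le_image[OF finite_inc nbr_subset_image])

text \<open>Exchanging the images of \<open>v\<close> and \<open>w\<close> affects only forbidden
  pairs and arcs at \<open>v\<close> or \<open>w\<close>. Each way of creating a new conflict rules
  out few partners \<open>w\<close>, and \<open>small\<close> leaves at least one. If the conflict
  is a forbidden pair instead of an arc, the lemma is used with \<open>u = v\<close>.\<close>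

lemma swap_repairs:
  assumes A: "digr V A" and B: "digr V B" and F: "F \<subseteq> V \<times> V"
    and f: "f permutes V" and v: "v \<in> V" and u: "u \<in> V"
    and dA: "\<And>w. w \<in> V \<Longrightarrow> deg A w \<le> \<delta>\<^sub>1" and dB: "\<And>w. w \<in> V \<Longrightarrow> deg B w \<le> \<delta>\<^sub>2"
    and F1: "card (F `` {v}) \<le> \<phi>\<^sub>1" and F2: "card {w. (w, f v) \<in> F} \<le> \<phi>\<^sub>2"
    and confA: "\<And>p q. (p, q) \<in> A \<Longrightarrow> (f p, f q) \<in> B \<Longrightarrow> p = v \<or> q = v"
    and confF: "\<And>p. (p, f p) \<in> F \<Longrightarrow> p = v"
    and small: "near A B f v u + 2 * \<delta>\<^sub>1 + \<delta>\<^sub>2 + \<phi>\<^sub>1 + \<phi>\<^sub>2 + 1 < card V"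
  shows "\<exists>g. g permutes V \<and> (\<forall>(p, q)\<in>A. (g p, g q) \<notin> B) \<and> (\<forall>p\<in>V. (p, g p) \<notin> F)"
proof -
  note finV = digr_finite(1)[OF A]
  note finA = digr_finite(2)[OF A] and finB = digr_finite(2)[OF B]
  have finF: "finite F" using F finV by (meson finite_SigmaI finite_subset)
  have injf: "inj f" and fV: "\<And>w. w \<in> V \<Longrightarrow> f w \<in> V"
    using permutes_inj[OF f] permutes_in_image[OF f] by auto
  have invf: "inv f (f w) = w" for w
    using injf by simp
  have AV: "p \<in> V" "q \<in> V" "p \<noteq> q" if "(p, q) \<in> A" for p q
    using A that by (auto simp: digr_def)
  \<comment> \<open>The sets collect the unsuitable partners \<open>w\<close>: \<open>?S1\<close>,
    \<open>?S2\<close> would hit a forbidden pair, \<open>?S3\<close>, \<open>?S4\<close> concern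
    arcs at \<open>v\<close> with new image \<open>f w\<close>, and \<open>?S5\<close>,
    \<open>?S6\<close> arcs at \<open>w\<close> with new image \<open>f v\<close>. Arcs to
    \<open>u\<close> are covered by \<open>?S7\<close> for \<open>v\<close> and by
    \<open>?S8\<close> for \<open>w\<close>; \<open>?S9\<close> ensures that no arc joins
    \<open>v\<close> and \<open>w\<close>.\<close>
  let ?S1 = "{w\<in>V. (v, f w) \<in> F}"
  let ?S2 = "{w. (w, f v) \<in> F}"
  let ?S3 = "{w\<in>V. \<exists>y. y \<noteq> u \<and> (v, y) \<in> A \<and> (f w, f y) \<in> B}"
  let ?S4 = "{w\<in>V. \<exists>y. y \<noteq> u \<and> (y, v) \<in> A \<and> (f y, f w) \<in> B}"
  let ?S5 = "{w. \<exists>y. y \<noteq> u \<and> (w, y) \<in> A \<and> (f v, f y) \<in> B}"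
  let ?S6 = "{w. \<exists>y. y \<noteq> u \<and> (y, w) \<in> A \<and> (f y, f v) \<in> B}"
  let ?S7 = "{w\<in>V. f w \<in> nbr B (f u)}"
  let ?S8 = "nbr A u"
  let ?S9 = "nbr A v"
  have c1: "card ?S1 \<le> \<phi>\<^sub>1"
  proof -
    have "card ?S1 \<le> card (F `` {v})"
        proof (rule card_le_image[where h = "inv f"])
      show "?S1 \<subseteq> inv f ` (F `` {v})"
      proof
        fix w assume "w \<in> ?S1"
        then have "f w \<in> F `` {v}" by simp
        then show "w \<in> inv f ` (F `` {v})" by (rule image_eqI[rotated]) (simp add: invf)
      qed
    qed (use finF in \<open>simp add: finite_Image\<close>)
    with F1 show ?thesis by simp
  qed
  have finN: "finite (near1 A B f v u)" "finite (near2 A B f v u)"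
    "finite (near3 A B f v u)" "finite (near4 A B f v u)"
    using finA finB unfolding near1_def near2_def near3_def near4_def
    by (auto intro!: finite_subset[OF _ finite_cartesian_product[of A B]])
  have c3: "card ?S3 \<le> card (near1 A B f v u)"
  proof (rule card_le_image[where h = "\<lambda>j. inv f (fst (snd j))"])
    show "?S3 \<subseteq> (\<lambda>j. inv f (fst (snd j))) ` near1 A B f v u"
    proof
      fix w assume "w \<in> ?S3"
      then obtain y where "y \<noteq> u" "(v, y) \<in> A" "(f w, f y) \<in> B" by auto
      then have "((v, y), (f w, f y)) \<in> near1 A B f v u" by (auto simp: near1_def)
      then show "w \<in> (\<lambda>j. inv f (fst (snd j))) ` near1 A B f v u"
        by (rule image_eqI[rotated]) (simp add: invf)
    qed
  qed (rule finN)
  have c4: "card ?S4 \<le> card (near2 A B f v u)"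
  proof (rule card_le_image[where h = "\<lambda>j. inv f (snd (snd j))"])
    show "?S4 \<subseteq> (\<lambda>j. inv f (snd (snd j))) ` near2 A B f v u"
    proof
      fix w assume "w \<in> ?S4"
      then obtain y where "y \<noteq> u" "(y, v) \<in> A" "(f y, f w) \<in> B" by auto
      then have "((y, v), (f y, f w)) \<in> near2 A B f v u" by (auto simp: near2_def)
      then show "w \<in> (\<lambda>j. inv f (snd (snd j))) ` near2 A B f v u"
        by (rule image_eqI[rotated]) (simp add: invf)
    qed
  qed (rule finN)
  have c5: "card ?S5 \<le> card (near3 A B f v u)"
  proof (rule card_le_image[where h = "\<lambda>j. fst (fst j)"])
    show "?S5 \<subseteq> (\<lambda>j. fst (fst j)) ` near3 A B f v u"
    proof
      fix w assume "w \<in> ?S5"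
      then obtain y where "y \<noteq> u" "(w, y) \<in> A" "(f v, f y) \<in> B" by auto
      then have "((w, y), (f v, f y)) \<in> near3 A B f v u" by (auto simp: near3_def)
      then show "w \<in> (\<lambda>j. fst (fst j)) ` near3 A B f v u"
        by (rule image_eqI[rotated]) simp
    qed
  qed (rule finN)
  have c6: "card ?S6 \<le> card (near4 A B f v u)"
  proof (rule card_le_image[where h = "\<lambda>j. snd (fst j)"])
    show "?S6 \<subseteq> (\<lambda>j. snd (fst j)) ` near4 A B f v u"
    proof
      fix w assume "w \<in> ?S6"
      then obtain y where "y \<noteq> u" "(y, w) \<in> A" "(f y, f v) \<in> B" by auto
      then have "((y, w), (f y, f v)) \<in> near4 A B f v u" by (auto simp: near4_def)
      then show "w \<in> (\<lambda>j. snd (fst j)) ` near4 A B f v u"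
        by (rule image_eqI[rotated]) simp
    qed
  qed (rule finN)
  have c7: "card ?S7 \<le> \<delta>\<^sub>2"
  proof -
    have "card ?S7 \<le> card (nbr B (f u))"
          proof (rule card_le_image[where h = "inv f"])
      show "?S7 \<subseteq> inv f ` nbr B (f u)"
      proof
        fix w assume "w \<in> ?S7"
        then have "f w \<in> nbr B (f u)" by simp
        then show "w \<in> inv f ` nbr B (f u)" by (rule image_eqI[rotated]) (simp add: invf)
      qed
    qed (rule finite_nbr[OF finB])
    with card_nbr_le_deg[OF finB, of "f u"] dB[OF fV[OF u]] show ?thesis by linarith
  qed
  have c8: "card ?S8 \<le> \<delta>\<^sub>1" "card ?S9 \<le> \<delta>\<^sub>1"
    using card_nbr_le_deg[OF finA, of u] card_nbr_le_deg[OF finA, of v] dA[OF u] dA[OF v] by linarith+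
  let ?Bad = "{v} \<union> ?S1 \<union> ?S2 \<union> ?S3 \<union> ?S4 \<union> ?S5 \<union> ?S6 \<union> ?S7 \<union> ?S8 \<union> ?S9"
  have un: "card (S \<union> T) \<le> x + y" if "card S \<le> x" "card T \<le> y" for S T :: "'a set" and x y
    using card_Un_le[of S T] that by linarith
  have "card ?Bad \<le> 1 + \<phi>\<^sub>1 + \<phi>\<^sub>2 + card (near1 A B f v u) + card (near2 A B f v u)
      + card (near3 A B f v u) + card (near4 A B f v u) + \<delta>\<^sub>2 + \<delta>\<^sub>1 + \<delta>\<^sub>1"
    by (intro un c1 F2 c3 c4 c5 c6 c7 c8) simp
  also have "\<dots> < card V"
    using small by (simp add: near_def)
  finally have lt: "card ?Bad < card V" .
  have nV: "nbr A x \<subseteq> V" for x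
    using A by (auto simp: nbr_def digr_def)
  have "?S5 \<subseteq> V" "?S6 \<subseteq> V" "?S2 \<subseteq> V"
    using AV(1,2) F by auto
  then have "?Bad \<subseteq> V"
    by (intro Un_least Collect_restrict nV) (simp_all only: v insert_subset empty_subsetI simp_thms)
  then have "finite ?Bad" using finV by (rule finite_subset)
  then obtain w where w: "w \<in> V" "w \<notin> ?Bad" using lt by (rule obtain_outside)
  have nb: "w \<notin> nbr A v" "w \<notin> nbr A u" "f w \<notin> nbr B (f u)" and wv: "w \<noteq> v"
    and w1: "(v, f w) \<notin> F" and w2: "(w, f v) \<notin> F"
    and w3: "\<And>y. y \<noteq> u \<Longrightarrow> (v, y) \<in> A \<Longrightarrow> (f w, f y) \<notin> B"
    and w4: "\<And>y. y \<noteq> u \<Longrightarrow> (y, v) \<in> A \<Longrightarrow> (f y, f w) \<notin> B"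
    and w5: "\<And>y. y \<noteq> u \<Longrightarrow> (w, y) \<in> A \<Longrightarrow> (f v, f y) \<notin> B"
    and w6: "\<And>y. y \<noteq> u \<Longrightarrow> (y, w) \<in> A \<Longrightarrow> (f y, f v) \<notin> B"
    using w unfolding Un_iff de_Morgan_disj mem_Collect_eq by blast+
  define g where "g = f \<circ> transpose v w"
  have gv: "g v = f w" and gw: "g w = f v"
    by (auto simp: g_def)
  have go: "g p = f p" if "p \<noteq> v" "p \<noteq> w" for p
    using that by (simp add: g_def transpose_def)
  have "g permutes V"
    unfolding g_def using f v w(1) by (intro permutes_compose permutes_swap_id)
  moreover have "(p, g p) \<notin> F" for p
  proof (cases "p = v \<or> p = w")
    case True
    then show ?thesis using w1 w2 gv gw by auto
  next
    case False
    then show ?thesis using go[of p] confF[of p] by auto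
  qed
  moreover have "(g p, g q) \<notin> B" if pq: "(p, q) \<in> A" for p q
  proof
    assume b: "(g p, g q) \<in> B"
    have pqne: "p \<noteq> q" using AV[OF pq] by simp
    consider "p = v" | "q = v" | "p = w" | "q = w" | "p \<noteq> v" "q \<noteq> v" "p \<noteq> w" "q \<noteq> w" by blast
    then show False
    proof cases
      case 1
      then have "q \<noteq> v" "q \<noteq> w" using nb(1) pq pqne by (auto simp: nbr_def)
      then have "(f w, f q) \<in> B" using b 1 gv go by auto
      then show False using w3[of q] nb 1 pq by (cases "q = u") (simp_all add: nbr_def)
    next
      case 2
      then have "p \<noteq> v" "p \<noteq> w" using nb(1) pq pqne by (auto simp: nbr_def)
      then have "(f p, f w) \<in> B" using b 2 gv go by auto
      then show False using w4[of p] nb 2 pq by (cases "p = u") (simp_all add: nbr_def)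
    next
      case 3
      then have "q \<noteq> v" "q \<noteq> w" using nb(1) pq pqne by (auto simp: nbr_def)
      then have "(f v, f q) \<in> B" using b 3 gw go by auto
      then show False using w5[of q] nb 3 pq by (cases "q = u") (simp_all add: nbr_def)
    next
      case 4
      then have "p \<noteq> v" "p \<noteq> w" using nb(1) pq pqne by (auto simp: nbr_def)
      then have "(f p, f v) \<in> B" using b 4 gw go by auto
      then show False using w6[of p] nb 4 pq by (cases "p = u") (simp_all add: nbr_def)
    next
      case 5
      then show False using b go confA[OF pq] by auto
    qed
  qed
  ultimately show ?thesis by (intro exI[of _ g]) auto
qed

text \<open>The last hypothesis says that the expected number of conflicts, each counted with weight
  \<open>1 + near / M\<close>, is less than two. So some bijection has at most one conflict, and if it has one
  then \<open>near < M\<close> and an exchange removes it.\<close>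

lemma list_packing_permutation_swap:
  assumes A: "digr V A" and B: "digr V B" and F: "F \<subseteq> V \<times> V"
    and N: "card V = N" "N \<ge> 3"
    and dA: "\<And>w. w \<in> V \<Longrightarrow> deg A w \<le> \<delta>\<^sub>1" and dB: "\<And>w. w \<in> V \<Longrightarrow> deg B w \<le> \<delta>\<^sub>2"
    and F1: "\<And>v. v \<in> V \<Longrightarrow> card (F `` {v}) \<le> \<phi>\<^sub>1"
    and F2: "\<And>z. z \<in> V \<Longrightarrow> card {w. (w, z) \<in> F} \<le> \<phi>\<^sub>2"
    and M: "M + 2 * \<delta>\<^sub>1 + \<delta>\<^sub>2 + \<phi>\<^sub>1 + \<phi>\<^sub>2 + 1 \<le> N"
    and E: "((N - 1) * card F + card A * card B) * (M * (N - 2) + \<delta>\<^sub>1 * card B + \<delta>\<^sub>2 * card A)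
            < 2 * M * N * (N - 1) * (N - 2)"
  shows "\<exists>g. g permutes V \<and> (\<forall>(p, q)\<in>A. (g p, g q) \<notin> B) \<and> (\<forall>p\<in>V. (p, g p) \<notin> F)"
proof -
  note finV = digr_finite(1)[OF A]
  note finA = digr_finite(2)[OF A] and finB = digr_finite(2)[OF B]
  have finF: "finite F" using F finV by (meson finite_SigmaI finite_subset)
  have AV: "p \<in> V" "q \<in> V" "p \<noteq> q" if "(p, q) \<in> A" for p q
    using A that by (auto simp: digr_def)
  have BV: "p \<in> V" "q \<in> V" "p \<noteq> q" if "(p, q) \<in> B" for p q
    using B that by (auto simp: digr_def)
  define P where "P = {f. f permutes V}"
  have finP: "finite P" and cardP: "card P = fact N"
    using finV N by (auto simp: P_def finite_permutations card_permutations)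
  define Q where "Q = \<delta>\<^sub>1 * card B + \<delta>\<^sub>2 * card A"
  define AB where "AB = A \<times> B"
  have finAB: "finite AB" using finA finB by (simp add: AB_def)
  define cF where "cF f = {j \<in> F. f (fst j) = snd j}" for f
  define cA where "cA f = {j \<in> AB. f (fst (fst j)) = fst (snd j) \<and> f (snd (fst j)) = snd (snd j)}" for f
  \<comment> \<open>A violated pair has no second end, so \<open>v\<close> takes the role of
    \<open>u\<close>; this excludes nothing from \<open>near\<close> because there are no
    loops.\<close>
  define kF where "kF f j = M + near A B f (fst j) (fst j)" for f and j :: "'a \<times> 'a"
  define kA where "kA f j = M + near A B f (snd (fst j)) (fst (fst j))" for f and j :: "('a \<times> 'a) \<times> ('a \<times> 'a)"
  define cost where "cost f = (\<Sum>j\<in>cF f. kF f j) + (\<Sum>j\<in>cA f. kA f j)" for f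
  have sF: "(\<Sum>f\<in>P. \<Sum>j\<in>cF f. kF f j) \<le> card F * (fact (N - 1) * M + fact (N - 2) * Q)"
  proof -
    have "(\<Sum>f\<in>P. \<Sum>j\<in>cF f. kF f j) = (\<Sum>j\<in>F. \<Sum>f\<in>{f\<in>P. f (fst j) = snd j}. kF f j)"
      unfolding cF_def by (rule sum.swap_restrict[OF finP finF])
    also have "\<dots> \<le> (\<Sum>j\<in>F. fact (N - 1) * M + fact (N - 2) * Q)"
    proof (rule sum_mono)
      fix j assume "j \<in> F"
      then obtain v z where j: "j = (v, z)" "v \<in> V" "z \<in> V" using F by auto
      let ?K = "{f\<in>P. f v = z}"
      have K: "card ?K \<le> fact (N - 1)"
        using card_permutes_1[OF finV j(2), of z] N by (simp add: P_def)
      have near: "(\<Sum>f\<in>?K. near A B f v v) \<le> fact (N - 2) * (deg A v * card B + deg B z * card A)"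
      proof (rule sum_near_le[OF A B])
        fix y t assume "y \<in> V" "y \<noteq> v"
        then show "card {f \<in> ?K. f y = t} \<le> fact (N - 2)"
          using card_permutes_2[OF finV j(2), of y z t] N by (simp add: P_def conj_ac)
      qed (use finP in auto)
      also have "\<dots> \<le> fact (N - 2) * Q"
        unfolding Q_def using dA[OF j(2)] dB[OF j(3)] by (intro mult_left_mono add_mono mult_right_mono) auto
      finally have "(\<Sum>f\<in>?K. near A B f v v) \<le> fact (N - 2) * Q" .
      moreover have "(\<Sum>f\<in>?K. M) \<le> fact (N - 1) * M"
        using mult_right_mono[OF K, of M] by simp
      ultimately show "(\<Sum>f\<in>{f\<in>P. f (fst j) = snd j}. kF f j) \<le> fact (N - 1) * M + fact (N - 2) * Q"
        unfolding j kF_def sum.distrib fst_conv snd_conv by linarith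
    qed
    also have "\<dots> = card F * (fact (N - 1) * M + fact (N - 2) * Q)" by simp
    finally show ?thesis .
  qed
  have sA: "(\<Sum>f\<in>P. \<Sum>j\<in>cA f. kA f j) \<le> card A * card B * (fact (N - 2) * M + fact (N - 3) * Q)"
  proof -
    have "(\<Sum>f\<in>P. \<Sum>j\<in>cA f. kA f j) = (\<Sum>j\<in>AB. \<Sum>f\<in>{f\<in>P. f (fst (fst j)) = fst (snd j)
          \<and> f (snd (fst j)) = snd (snd j)}. kA f j)"
      unfolding cA_def by (rule sum.swap_restrict[OF finP finAB])
    also have "\<dots> \<le> (\<Sum>j\<in>AB. fact (N - 2) * M + fact (N - 3) * Q)"
    proof (rule sum_mono)
      fix j assume "j \<in> AB"
      then obtain u v x z where j: "j = ((u, v), (x, z))" "(u, v) \<in> A" "(x, z) \<in> B"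
        by (auto simp: AB_def)
      note uv = AV[OF j(2)] and xz = BV[OF j(3)]
      let ?K = "{f\<in>P. f u = x \<and> f v = z}"
      have K: "card ?K \<le> fact (N - 2)"
        using card_permutes_2[OF finV uv, of x z] N by (simp add: P_def)
      have near: "(\<Sum>f\<in>?K. near A B f v u) \<le> fact (N - 3) * (deg A v * card B + deg B z * card A)"
      proof (rule sum_near_le[OF A B])
        fix y t assume "y \<in> V" "y \<noteq> u" "y \<noteq> v"
        then show "card {f \<in> ?K. f y = t} \<le> fact (N - 3)"
          using card_permutes_3[OF finV uv(1,2) _ uv(3), of y x z t] N by (simp add: P_def conj_ac)
      qed (use finP in auto)
      also have "\<dots> \<le> fact (N - 3) * Q"
        unfolding Q_def using dA[OF uv(2)] dB[OF xz(2)] by (intro mult_left_mono add_mono mult_right_mono) auto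
      finally have "(\<Sum>f\<in>?K. near A B f v u) \<le> fact (N - 3) * Q" .
      moreover have "(\<Sum>f\<in>?K. M) \<le> fact (N - 2) * M"
        using mult_right_mono[OF K, of M] by simp
      ultimately show "(\<Sum>f\<in>{f\<in>P. f (fst (fst j)) = fst (snd j) \<and> f (snd (fst j)) = snd (snd j)}. kA f j)
          \<le> fact (N - 2) * M + fact (N - 3) * Q"
        unfolding j kA_def sum.distrib fst_conv snd_conv by linarith
    qed
    also have "\<dots> = card A * card B * (fact (N - 2) * M + fact (N - 3) * Q)"
      by (simp add: AB_def card_cartesian_product)
    finally show ?thesis .
  qed
  define n1 n2 where "n1 = N - 1" and "n2 = N - 2"
  define K :: nat where "K = fact (N - 3)"
  have f2: "fact (N - 2) = n2 * K"
    using N(2) fact_reduce[of "N - 2", where 'a = nat] by (simp add: n2_def K_def)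
  have f1: "fact (N - 1) = n1 * (n2 * K)"
    using N(2) fact_reduce[of "N - 1", where 'a = nat] f2 by (simp add: n1_def numeral_2_eq_2)
  have f0: "fact N = N * (n1 * (n2 * K))"
    using N(2) fact_reduce[of N, where 'a = nat] f1 by simp
  have "K > 0" "n2 \<le> n1" by (simp_all add: K_def n1_def n2_def)
  have "(\<Sum>f\<in>P. cost f) \<le> card F * (fact (N - 1) * M + fact (N - 2) * Q)
      + card A * card B * (fact (N - 2) * M + fact (N - 3) * Q)"
    unfolding cost_def sum.distrib using sF sA by (rule add_mono)
  also have "\<dots> = K * (card F * (n1 * n2 * M + n2 * Q) + card A * card B * (n2 * M + Q))"
    unfolding f1 f2 K_def[symmetric] by (simp add: algebra_simps)
  \<comment> \<open>Raising \<open>n2 * Q\<close> to \<open>n1 * Q\<close> lets the contributions of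
    \<open>F\<close> and of the arc pairs share the factor \<open>M * n2 + Q\<close>, as in
    \<open>E\<close>.\<close>
  also have "\<dots> \<le> K * (card F * (n1 * n2 * M + n1 * Q) + card A * card B * (n2 * M + Q))"
    using \<open>n2 \<le> n1\<close> by (intro mult_left_mono add_mono mult_right_mono) auto
  also have "\<dots> = K * ((n1 * card F + card A * card B) * (M * n2 + Q))"
    by (simp add: algebra_simps)
  also have "\<dots> < K * (2 * M * N * n1 * n2)"
    using E \<open>K > 0\<close> by (simp add: Q_def add.assoc n1_def n2_def)
  also have "\<dots> = (\<Sum>f\<in>P. 2 * M)"
    unfolding sum_constant cardP f0 by (simp add: algebra_simps)
  finally obtain f where f: "f \<in> P" "cost f < 2 * M"
    by (meson not_le sum_mono)
  have fp: "f permutes V" using f by (simp add: P_def)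
  have finc: "finite (cF f)" "finite (cA f)"
    using finF finAB by (auto simp: cF_def cA_def)
  have cFI: "(p, f p) \<in> cF f" if "(p, f p) \<in> F" for p
    using that by (simp add: cF_def)
  have cAI: "((p, q), (f p, f q)) \<in> cA f" if "(p, q) \<in> A" "(f p, f q) \<in> B" for p q
    using that by (simp add: cA_def AB_def)
  have "card (cF f) * M \<le> (\<Sum>j\<in>cF f. kF f j)"
    using sum_mono[of "cF f" "\<lambda>_. M" "kF f"] by (simp add: kF_def)
  moreover have "card (cA f) * M \<le> (\<Sum>j\<in>cA f. kA f j)"
    using sum_mono[of "cA f" "\<lambda>_. M" "kA f"] by (simp add: kA_def)
  ultimately have "(card (cF f) + card (cA f)) * M < 2 * M"
    using f(2) unfolding cost_def by (simp add: algebra_simps)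
  then have le1: "card (cF f) + card (cA f) \<le> 1" and Mpos: "M > 0" by auto
  show ?thesis
  proof (cases "cF f = {} \<and> cA f = {}")
    case True
    then have "(\<forall>(p, q)\<in>A. (f p, f q) \<notin> B) \<and> (\<forall>p\<in>V. (p, f p) \<notin> F)"
      using cFI cAI by blast
    with fp show ?thesis by blast
  next
    case False
    then have "card (cF f) = 1 \<and> card (cA f) = 0 \<or> card (cF f) = 0 \<and> card (cA f) = 1"
      using le1 finc by (cases "card (cF f)"; cases "card (cA f)") auto
    then consider j where "cF f = {j}" "cA f = {}" | j where "cF f = {}" "cA f = {j}"
      using finc by (auto simp: card_1_singleton_iff)
    then show ?thesis
    proof cases
      case 1
      then have "j \<in> cF f" by simp
      then obtain v where j: "j = (v, f v)" "v \<in> V" using F by (force simp: cF_def)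
      have "near A B f v v < M"
        using f(2) 1 j by (simp add: cost_def kF_def)
      then show ?thesis
      proof (intro swap_repairs[OF A B F fp j(2) j(2) dA dB F1[OF j(2)] F2])
        show "f v \<in> V" using permutes_in_image[OF fp] j(2) by simp
        show "p = v \<or> q = v" if "(p, q) \<in> A" "(f p, f q) \<in> B" for p q
          using cAI[OF that] 1 by simp
        show "p = v" if "(p, f p) \<in> F" for p
          using cFI[OF that] 1 j by simp
      qed (use M N in auto)
    next
      case 2
      then have "j \<in> cA f" by simp
      then obtain u v where j: "j = ((u, v), (f u, f v))" "(u, v) \<in> A" "(f u, f v) \<in> B"
        by (force simp: cA_def AB_def)
      note uv = AV[OF j(2)]
      have "near A B f v u < M"
        using f(2) 2 j by (simp add: cost_def kA_def)
      then show ?thesis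
      proof (intro swap_repairs[OF A B F fp uv(2) uv(1) dA dB F1[OF uv(2)] F2])
        show "f v \<in> V" using permutes_in_image[OF fp] uv(2) by simp
        show "p = v \<or> q = v" if "(p, q) \<in> A" "(f p, f q) \<in> B" for p q
          using cAI[OF that] 2 j by simp
        show "p = v" if "(p, f p) \<in> F" for p
          using cFI[OF that] 2 by simp
      qed (use M N in auto)
    qed
  qed
qed

text \<open>First moment method: \<open>E\<close> says that the expected number of violated pairs
  and conflicting arcs is below one, so some bijection has none. It closes the cases in which one of
  the digraphs has become sparse.\<close>

lemma list_packing_permutation_few:
  assumes A: "digr V A" and B: "digr V B" and F: "F \<subseteq> V \<times> V"
    and N: "card V = N" "N \<ge> 2"
    and E: "(N - 1) * card F + card A * card B < N * (N - 1)"
  shows "\<exists>g. g permutes V \<and> (\<forall>(p, q)\<in>A. (g p, g q) \<notin> B) \<and> (\<forall>p\<in>V. (p, g p) \<notin> F)"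
proof -
  note finV = digr_finite(1)[OF A]
  note finA = digr_finite(2)[OF A] and finB = digr_finite(2)[OF B]
  have finF: "finite F" using F finV by (meson finite_SigmaI finite_subset)
  define P where "P = {f. f permutes V}"
  have finP: "finite P" and cardP: "card P = fact N"
    using finV N by (auto simp: P_def finite_permutations card_permutations)
  define cF where "cF f = {j \<in> F. f (fst j) = snd j}" for f
  define cA where "cA f = {j \<in> A \<times> B. f (fst (fst j)) = fst (snd j) \<and> f (snd (fst j)) = snd (snd j)}" for f
  have "(\<Sum>f\<in>P. card (cF f)) = (\<Sum>j\<in>F. card {f\<in>P. f (fst j) = snd j})"
    unfolding cF_def by (rule sum_card_swap[OF finP finF])
  also have "\<dots> \<le> (\<Sum>j\<in>F. fact (N - 1))"
  proof (rule sum_mono)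
    fix j assume "j \<in> F"
    then have "fst j \<in> V" using F by auto
    from card_permutes_1[OF finV this, of "snd j"] show "card {f\<in>P. f (fst j) = snd j} \<le> fact (N - 1)"
      by (simp add: P_def N)
  qed
  finally have sF: "(\<Sum>f\<in>P. card (cF f)) \<le> card F * fact (N - 1)" by simp
  have "(\<Sum>f\<in>P. card (cA f)) = (\<Sum>j\<in>A \<times> B. card {f\<in>P. f (fst (fst j)) = fst (snd j) \<and> f (snd (fst j)) = snd (snd j)})"
    unfolding cA_def using finA finB by (intro sum_card_swap finP) auto
  also have "\<dots> \<le> (\<Sum>j\<in>A \<times> B. fact (N - 2))"
  proof (rule sum_mono)
    fix j assume "j \<in> A \<times> B"
    then have "fst (fst j) \<in> V" "snd (fst j) \<in> V" "fst (fst j) \<noteq> snd (fst j)" using A by (auto simp: digr_def)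
    from card_permutes_2[OF finV this, of "fst (snd j)" "snd (snd j)"]
    show "card {f\<in>P. f (fst (fst j)) = fst (snd j) \<and> f (snd (fst j)) = snd (snd j)} \<le> fact (N - 2)"
      by (simp add: P_def N)
  qed
  finally have sA: "(\<Sum>f\<in>P. card (cA f)) \<le> card A * card B * fact (N - 2)"
    by (simp add: card_cartesian_product)
  have f1: "fact (N - 1) = (N - 1) * (fact (N - 2) :: nat)"
    using N(2) fact_reduce[of "N - 1", where 'a = nat] by (simp add: numeral_2_eq_2)
  have f0: "fact N = N * (N - 1) * (fact (N - 2) :: nat)"
    using N(2) fact_reduce[of N, where 'a = nat] f1 by simp
  have "(\<Sum>f\<in>P. card (cF f) + card (cA f)) \<le> card F * fact (N - 1) + card A * card B * fact (N - 2)"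
    unfolding sum.distrib using sF sA by (rule add_mono)
  also have "\<dots> = fact (N - 2) * ((N - 1) * card F + card A * card B)"
    unfolding f1 by (simp add: algebra_simps)
  also have "\<dots> < fact (N - 2) * (N * (N - 1))"
    using E by simp
  also have "\<dots> = (\<Sum>f\<in>P. 1)"
    unfolding sum_constant cardP f0 by (simp add: algebra_simps)
  finally obtain f where f: "f \<in> P" "card (cF f) + card (cA f) < 1"
    by (meson not_le sum_mono)
  have fin: "finite (cF f)" "finite (cA f)"
    using finF finA finB by (auto simp: cF_def cA_def)
  have e: "cF f = {}" "cA f = {}" using f(2) fin by auto
  have "(p, f p) \<notin> F" for p
    using e(1) by (auto simp: cF_def)
  moreover have "(f p, f q) \<notin> B" if "(p, q) \<in> A" for p q
    using e(2) that by (auto simp: cA_def)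
  ultimately show ?thesis using f(1) unfolding P_def by blast
qed

text \<open>List packing: \<open>F\<close> holds the pairs forbidden by vertices that are already
  placed. The vertex sets are distinct because the two remainders after preplacing are unrelated
  sets of equal size.\<close>

definition lpack ::
  "'a set \<Rightarrow> ('a \<times> 'a) set \<Rightarrow> 'b set \<Rightarrow> ('b \<times> 'b) set \<Rightarrow> ('a \<times> 'b) set \<Rightarrow> bool" where
  "lpack V A W B F \<longleftrightarrow> (\<exists>f. bij_betw f V W \<and> (\<forall>(p, q)\<in>A. (f p, f q) \<notin> B) \<and> (\<forall>p\<in>V. (p, f p) \<notin> F))"

section \<open>Transport from permutations of one set to bijections between two sets\<close>

context
  fixes V :: "'a set" and W :: "'b set" and A B F h
  assumes A: "digr V A" and B: "digr W B" and F: "F \<subseteq> V \<times> W" and h: "bij_betw h W V"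
begin

private lemma inj_h: "inj_on h W" and h_onto: "h ` W = V"
  using h by (auto simp: bij_betw_def)

private lemma inj_hh: "inj_on (map_prod h h) (W \<times> W)"
  using inj_h by (auto simp: inj_on_def)

private lemma mapped_digr: "digr V (map_prod h h ` B)"
proof -
  have "h (fst b) \<noteq> h (snd b)" if "b \<in> B" for b
    using B that inj_onD[OF inj_h, of "fst b" "snd b"] by (force simp: digr_def)
  then show ?thesis
    using A B h_onto by (auto simp: digr_def)
qed

private lemma mapped_card: "card (map_prod h h ` B) = card B"
  using inj_hh B by (intro card_image) (auto simp: digr_def intro: inj_on_subset)

private lemma mapped_deg: "w \<in> W \<Longrightarrow> deg (map_prod h h ` B) (h w) = deg B w"
proof -
  assume w: "w \<in> W"
  have BW: "fst b \<in> W" "snd b \<in> W" if "b \<in> B" for b using B that by (auto simp: digr_def)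
  have "inc (map_prod h h ` B) (h w) = map_prod h h ` inc B w"
    using w BW inj_onD[OF inj_h _ _ w] by (force simp: inc_def)
  then show ?thesis
    unfolding deg_def using B inj_hh by (auto intro!: card_image intro: inj_on_subset simp: inc_def digr_def)
qed

private lemma inj_F: "inj_on (map_prod id h) F"
  by (rule inj_on_subset[OF _ F]) (use inj_h in \<open>auto simp: inj_on_def\<close>)

private lemma mapped_F: "map_prod id h ` F \<subseteq> V \<times> V" "card (map_prod id h ` F) = card F"
  using F h_onto by (auto simp: card_image[OF inj_F])

private lemma mapped_F1: "card ((map_prod id h ` F) `` {v}) = card (F `` {v})"
proof -
  have "(map_prod id h ` F) `` {v} = h ` (F `` {v})" by force
  moreover have "inj_on h (F `` {v})" using F by (auto intro: inj_on_subset[OF inj_h])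
  ultimately show ?thesis by (simp add: card_image)
qed

private lemma mapped_F2: "z \<in> W \<Longrightarrow> {w. (w, h z) \<in> map_prod id h ` F} = {w. (w, z) \<in> F}"
  using F inj_onD[OF inj_h] by (force simp: image_iff)

private lemma lpackI:
  assumes "\<exists>g. g permutes V \<and> (\<forall>(p, q)\<in>A. (g p, g q) \<notin> map_prod h h ` B)
     \<and> (\<forall>p\<in>V. (p, g p) \<notin> map_prod id h ` F)"
  shows "lpack V A W B F"
proof -
  from assms obtain g where g: "g permutes V" and g': "\<forall>(p, q)\<in>A. (g p, g q) \<notin> map_prod h h ` B"
     "\<forall>p\<in>V. (p, g p) \<notin> map_prod id h ` F" by blast
  define f where "f = (\<lambda>v. inv_into W h (g v))"
  have bij: "bij_betw f V W"
    using bij_betw_trans[OF permutes_imp_bij[OF g] bij_betw_inv_into[OF h]]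
    by (simp add: f_def comp_def)
  have hf: "h (f v) = g v" if "v \<in> V" for v
    using that h_onto permutes_in_image[OF g] by (simp add: f_def f_inv_into_f)
  have "(f p, f q) \<notin> B" if pq: "(p, q) \<in> A" for p q
  proof
    assume "(f p, f q) \<in> B"
    then have "(h (f p), h (f q)) \<in> map_prod h h ` B" by force
    moreover have "p \<in> V" "q \<in> V" using A pq by (auto simp: digr_def)
    ultimately show False using bspec[OF g'(1) pq] hf by simp
  qed
  moreover have "(p, f p) \<notin> F" if p: "p \<in> V" for p
  proof
    assume "(p, f p) \<in> F"
    then have "(p, h (f p)) \<in> map_prod id h ` F" by force
    then show False using g'(2) p hf[OF p] by auto
  qed
  ultimately show ?thesis unfolding lpack_def using bij by blast
qed

lemma lpack_swap_aux:
  assumes N: "card V = N" "N \<ge> 3"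
    and dA: "\<And>w. w \<in> V \<Longrightarrow> deg A w \<le> \<delta>\<^sub>1" and dB: "\<And>w. w \<in> W \<Longrightarrow> deg B w \<le> \<delta>\<^sub>2"
    and F1: "\<And>v. v \<in> V \<Longrightarrow> card (F `` {v}) \<le> \<phi>\<^sub>1"
    and F2: "\<And>z. z \<in> W \<Longrightarrow> card {w. (w, z) \<in> F} \<le> \<phi>\<^sub>2"
    and M: "M + 2 * \<delta>\<^sub>1 + \<delta>\<^sub>2 + \<phi>\<^sub>1 + \<phi>\<^sub>2 + 1 \<le> N"
    and E: "((N - 1) * card F + card A * card B) * (M * (N - 2) + \<delta>\<^sub>1 * card B + \<delta>\<^sub>2 * card A)
            < 2 * M * N * (N - 1) * (N - 2)"
  shows "lpack V A W B F"
proof (rule lpackI, rule list_packing_permutation_swap[OF A mapped_digr mapped_F(1) N dA _ _ _ M])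
  show "deg (map_prod h h ` B) w \<le> \<delta>\<^sub>2" if "w \<in> V" for w
    using that h_onto dB mapped_deg by auto
  show "card ((map_prod id h ` F) `` {v}) \<le> \<phi>\<^sub>1" if "v \<in> V" for v
    using F1[OF that] by (simp add: mapped_F1)
  show "card {w. (w, z) \<in> map_prod id h ` F} \<le> \<phi>\<^sub>2" if "z \<in> V" for z
  proof -
    obtain t where "t \<in> W" "z = h t" using \<open>z \<in> V\<close> h_onto by auto
    then show ?thesis using F2 mapped_F2 by auto
  qed
  show "((N - 1) * card (map_prod id h ` F) + card A * card (map_prod h h ` B)) *
      (M * (N - 2) + \<delta>\<^sub>1 * card (map_prod h h ` B) + \<delta>\<^sub>2 * card A) < 2 * M * N * (N - 1) * (N - 2)"
    using E by (simp only: mapped_card mapped_F)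
qed

lemma lpack_few_aux:
  assumes N: "card V = N" "N \<ge> 2"
    and E: "(N - 1) * card F + card A * card B < N * (N - 1)"
  shows "lpack V A W B F"
  using E by (intro lpackI list_packing_permutation_few[OF A mapped_digr mapped_F(1) N])
    (simp only: mapped_card mapped_F)

end

lemma lpack_swap:
  assumes A: "digr V A" and B: "digr W B" and F: "F \<subseteq> V \<times> W"
    and N: "card V = N" "card W = N" "N \<ge> 3"
    and dA: "\<And>w. w \<in> V \<Longrightarrow> deg A w \<le> \<delta>\<^sub>1" and dB: "\<And>w. w \<in> W \<Longrightarrow> deg B w \<le> \<delta>\<^sub>2"
    and F1: "\<And>v. v \<in> V \<Longrightarrow> card (F `` {v}) \<le> \<phi>\<^sub>1"
    and F2: "\<And>z. z \<in> W \<Longrightarrow> card {w. (w, z) \<in> F} \<le> \<phi>\<^sub>2"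
    and M: "M + 2 * \<delta>\<^sub>1 + \<delta>\<^sub>2 + \<phi>\<^sub>1 + \<phi>\<^sub>2 + 1 \<le> N"
    and E: "((N - 1) * card F + card A * card B) * (M * (N - 2) + \<delta>\<^sub>1 * card B + \<delta>\<^sub>2 * card A)
            < 2 * M * N * (N - 1) * (N - 2)"
  shows "lpack V A W B F"
proof -
  obtain h where h: "bij_betw h W V"
    using N(1,2) digr_finite(1)[OF A] digr_finite(1)[OF B] finite_same_card_bij by metis
  show ?thesis by (rule lpack_swap_aux[OF A B F h N(1,3) dA dB F1 F2 M E])
qed

lemma lpack_few:
  assumes A: "digr V A" and B: "digr W B" and F: "F \<subseteq> V \<times> W"
    and N: "card V = N" "card W = N" "N \<ge> 2"
    and E: "(N - 1) * card F + card A * card B < N * (N - 1)"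
  shows "lpack V A W B F"
proof -
  obtain h where h: "bij_betw h W V"
    using N(1,2) digr_finite(1)[OF A] digr_finite(1)[OF B] finite_same_card_bij by metis
  show ?thesis by (rule lpack_few_aux[OF A B F h N(1,3) E])
qed

section \<open>Tree components\<close>

lemma sum_deg:
  assumes A: "digr V A"
  shows "(\<Sum>v\<in>V. deg A v) = 2 * card A"
proof -
  note fin = digr_finite[OF A]
  have AV: "fst a \<in> V" "snd a \<in> V" if "a \<in> A" for a using A that by (auto simp: digr_def)
  have "(\<Sum>v\<in>V. card {a \<in> A. fst a = v}) = (\<Sum>a\<in>A. card {v\<in>V. fst a = v})"
    by (rule sum_card_swap[OF fin])
  also have "\<dots> = (\<Sum>a\<in>A. 1)"
  proof (rule sum.cong[OF refl])
    fix a assume "a \<in> A"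
    then have "{v\<in>V. fst a = v} = {fst a}" using AV(1) by blast
    then show "card {v\<in>V. fst a = v} = 1" by simp
  qed
  finally have 1: "(\<Sum>v\<in>V. card {a \<in> A. fst a = v}) = card A" by simp
  have "(\<Sum>v\<in>V. card {a \<in> A. snd a = v}) = (\<Sum>a\<in>A. card {v\<in>V. snd a = v})"
    by (rule sum_card_swap[OF fin])
  also have "\<dots> = (\<Sum>a\<in>A. 1)"
  proof (rule sum.cong[OF refl])
    fix a assume "a \<in> A"
    then have "{v\<in>V. snd a = v} = {snd a}" using AV(2) by blast
    then show "card {v\<in>V. snd a = v} = 1" by simp
  qed
  finally have 2: "(\<Sum>v\<in>V. card {a \<in> A. snd a = v}) = card A" by simp
  show ?thesis
    unfolding deg_eq_out_in[OF A] sum.distrib 1 2 by simp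
qed

text \<open>Weak components are built arc by arc, as in union-find. An arc between two classes
  merges them: the two summands 1 become one summand 1 and the new arc. No notion of path or
  connectivity is involved.\<close>

lemma component_labelling:
  assumes "finite V" "finite A" "A \<subseteq> V \<times> V"
  shows "\<exists>\<kappa> :: 'a \<Rightarrow> 'a. (\<forall>a\<in>A. \<kappa> (fst a) = \<kappa> (snd a)) \<and>
    (\<forall>l. card {v\<in>V. \<kappa> v = l} \<le> card {a\<in>A. \<kappa> (fst a) = l} + 1)"
  using assms(2,3)
proof (induction A rule: finite_induct)
  case empty
  have "card {v\<in>V. v = l} \<le> 1" for l
    by (rule order_trans[OF card_mono[of "{l}"]]) auto
  then show ?case by (intro exI[of _ id]) auto
next
  case (insert a A)
  have "A \<subseteq> V \<times> V" using insert.prems by simp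
  from insert.IH[OF this] obtain \<kappa> :: "'a \<Rightarrow> 'a" where \<kappa>: "\<forall>a\<in>A. \<kappa> (fst a) = \<kappa> (snd a)"
    and c: "\<And>l. card {v\<in>V. \<kappa> v = l} \<le> card {a\<in>A. \<kappa> (fst a) = l} + 1" by blast
  obtain u v where a: "a = (u, v)" by (cases a)
  have ins: "card {b\<in>insert a A. P b} = (if P a then 1 else 0) + card {b\<in>A. P b}" for P
  proof -
    have "{b\<in>insert a A. P b} = (if P a then insert a {b\<in>A. P b} else {b\<in>A. P b})" by auto
    then show ?thesis using insert.hyps by simp
  qed
  show ?case
  proof (cases "\<kappa> u = \<kappa> v")
    case True
    have "card {w\<in>V. \<kappa> w = l} \<le> card {b\<in>insert a A. \<kappa> (fst b) = l} + 1" for l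
      unfolding ins using c[of l] by linarith
    moreover have "\<forall>b\<in>insert a A. \<kappa> (fst b) = \<kappa> (snd b)"
      using \<kappa> True by (simp add: a)
    ultimately show ?thesis by blast
  next
    case False
    define \<kappa>' where "\<kappa>' w = (if \<kappa> w = \<kappa> v then \<kappa> u else \<kappa> w)" for w
    have "card {w\<in>V. \<kappa>' w = l} \<le> card {b\<in>insert a A. \<kappa>' (fst b) = l} + 1" for l
    proof -
      consider "l = \<kappa> u" | "l = \<kappa> v" | "l \<noteq> \<kappa> u" "l \<noteq> \<kappa> v" by blast
      then show ?thesis
      proof cases
        case 1
        have "{w\<in>V. \<kappa>' w = l} = {w\<in>V. \<kappa> w = \<kappa> u} \<union> {w\<in>V. \<kappa> w = \<kappa> v}"
          using 1 by (auto simp: \<kappa>'_def)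
        then have "card {w\<in>V. \<kappa>' w = l} \<le> card {w\<in>V. \<kappa> w = \<kappa> u} + card {w\<in>V. \<kappa> w = \<kappa> v}"
          by (simp add: card_Un_le)
        moreover have "card {b\<in>A. \<kappa>' (fst b) = l} = card {b\<in>A. \<kappa> (fst b) = \<kappa> u} + card {b\<in>A. \<kappa> (fst b) = \<kappa> v}"
        proof -
          have "{b\<in>A. \<kappa>' (fst b) = l} = {b\<in>A. \<kappa> (fst b) = \<kappa> u} \<union> {b\<in>A. \<kappa> (fst b) = \<kappa> v}"
            using 1 by (auto simp: \<kappa>'_def)
          then show ?thesis using insert.hyps False by (simp add: card_Un_disjoint disjoint_iff)
        qed
        moreover have "\<kappa>' (fst a) = l" using 1 by (simp add: a \<kappa>'_def)
        ultimately show ?thesis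
          unfolding ins using c[of "\<kappa> u"] c[of "\<kappa> v"] by simp
      next
        case 2
        then have "{w\<in>V. \<kappa>' w = l} = {}" using False by (auto simp: \<kappa>'_def)
        then show ?thesis by (metis card.empty zero_le)
      next
        case 3
        then have "{w\<in>V. \<kappa>' w = l} = {w\<in>V. \<kappa> w = l}"
          and "{b\<in>A. \<kappa>' (fst b) = l} = {b\<in>A. \<kappa> (fst b) = l}"
          by (auto simp: \<kappa>'_def)
        then show ?thesis unfolding ins using c[of l] by simp
      qed
    qed
    moreover have "\<forall>b\<in>insert a A. \<kappa>' (fst b) = \<kappa>' (snd b)"
      using \<kappa> by (auto simp: a \<kappa>'_def)
    ultimately show ?thesis by blast
  qed
qed

definition closed_in :: "('a \<times> 'a) set \<Rightarrow> 'a set \<Rightarrow> bool" where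
  "closed_in A C \<longleftrightarrow> (\<forall>a\<in>A. fst a \<in> C \<longleftrightarrow> snd a \<in> C)"

definition arcs_at :: "('a \<times> 'a) set \<Rightarrow> 'a set \<Rightarrow> ('a \<times> 'a) set" where
  "arcs_at A C = {a\<in>A. fst a \<in> C}"

text \<open>A union of weak components with fewer arcs than vertices. Connectedness is not demanded;
  sets of minimum size behave like tree components. For closed \<open>C\<close> every arc meeting
  \<open>C\<close> has its tail there, so \<open>arcs_at\<close> misses none.\<close>

definition treelike :: "'a set \<Rightarrow> ('a \<times> 'a) set \<Rightarrow> 'a set \<Rightarrow> bool" where
  "treelike V A C \<longleftrightarrow> C \<subseteq> V \<and> C \<noteq> {} \<and> closed_in A C \<and> card (arcs_at A C) < card C"

text \<open>In every class the number of vertices exceeds the number of arcs by at most one, and it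
  does so only in the treelike classes. Summing over all classes shows that there are at least
  \<open>card V - card A\<close> of these.\<close>

lemma many_treelike:
  assumes "finite V" "A \<subseteq> V \<times> V"
  obtains \<C> where "finite \<C>" "\<And>C. C \<in> \<C> \<Longrightarrow> treelike V A C \<and> card C = card (arcs_at A C) + 1"
    "pairwise disjnt \<C>" "card V \<le> card A + card \<C>"
proof -
  have finA: "finite A" using assms by (meson finite_SigmaI finite_subset)
  obtain \<kappa> :: "'a \<Rightarrow> 'a" where \<kappa>: "\<forall>a\<in>A. \<kappa> (fst a) = \<kappa> (snd a)"
    and c: "\<And>l. card {v\<in>V. \<kappa> v = l} \<le> card {a\<in>A. \<kappa> (fst a) = l} + 1"
    using component_labelling[OF assms(1) finA assms(2)] by blast
  define cl where "cl l = {v\<in>V. \<kappa> v = l}" for l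
  define T where "T = {l \<in> \<kappa> ` V. card {a\<in>A. \<kappa> (fst a) = l} < card (cl l)}"
  have finT: "finite T" using assms(1) by (simp add: T_def)
  have at: "arcs_at A (cl l) = {a\<in>A. \<kappa> (fst a) = l}" for l
    using assms(2) by (auto simp: arcs_at_def cl_def)
  have tl: "treelike V A (cl l) \<and> card (cl l) = card (arcs_at A (cl l)) + 1" if "l \<in> T" for l
    unfolding treelike_def at
  proof (intro conjI)
    show "cl l \<subseteq> V" by (auto simp: cl_def)
    show "cl l \<noteq> {}" using that by (auto simp: cl_def T_def)
    show "closed_in A (cl l)" using \<kappa> assms(2) by (auto simp: closed_in_def cl_def)
    show "card {a\<in>A. \<kappa> (fst a) = l} < card (cl l)" using that by (simp add: T_def)
    then show "card (cl l) = card {a\<in>A. \<kappa> (fst a) = l} + 1"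
      using c[of l] by (simp add: cl_def)
  qed
  have inj: "inj_on cl T"
  proof (rule inj_onI)
    fix l l' assume "l \<in> T" "l' \<in> T" "cl l = cl l'"
    moreover obtain v where "v \<in> V" "\<kappa> v = l" using \<open>l \<in> T\<close> by (auto simp: T_def)
    ultimately show "l = l'" by (auto simp: cl_def)
  qed
  have "card V = (\<Sum>l\<in>\<kappa> ` V. card (cl l))"
    using assms(1) sum.image_gen[OF assms(1), of "\<lambda>_. 1 :: nat" \<kappa>] by (simp add: cl_def)
  also have "\<dots> \<le> (\<Sum>l\<in>\<kappa> ` V. card {a\<in>A. \<kappa> (fst a) = l} + (if l \<in> T then 1 else 0))"
    using c by (intro sum_mono) (force simp: T_def cl_def)
  also have "\<dots> = (\<Sum>l\<in>\<kappa> ` V. card {a\<in>A. \<kappa> (fst a) = l}) + card T"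
    using assms(1) by (simp add: sum.distrib sum.If_cases T_def Int_def conj_ac)
  also have "(\<Sum>l\<in>\<kappa> ` V. card {a\<in>A. \<kappa> (fst a) = l}) = (\<Sum>a\<in>A. card {l\<in>\<kappa> ` V. \<kappa> (fst a) = l})"
    using assms(1) finA by (intro sum_card_swap) auto
  also have "\<dots> = (\<Sum>a\<in>A. 1)"
  proof (rule sum.cong[OF refl])
    fix a assume "a \<in> A"
    then have "{l\<in>\<kappa> ` V. \<kappa> (fst a) = l} = {\<kappa> (fst a)}" using assms(2) by auto
    then show "card {l\<in>\<kappa> ` V. \<kappa> (fst a) = l} = 1" by simp
  qed
  finally have "card V \<le> card A + card (cl ` T)"
    by (simp add: card_image[OF inj])
  moreover have "pairwise disjnt (cl ` T)"
    by (auto simp: pairwise_def disjnt_def cl_def)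
  ultimately show thesis using that[of "cl ` T"] finT tl by auto
qed

text \<open>The size bound holds because at least \<open>card V - card A\<close> disjoint treelike
  sets, none smaller than \<open>C\<close>, fit into \<open>V\<close>.\<close>

lemma minimal_treelike:
  assumes A: "digr V A" and "card A < card V"
  obtains C where "treelike V A C" "card C * (card V - card A) \<le> card V"
    "card C = card (arcs_at A C) + 1"
    "\<And>D. treelike V A D \<Longrightarrow> card C \<le> card D"
proof -
  note finV = digr_finite(1)[OF A] and finA = digr_finite(2)[OF A]
  have AV: "A \<subseteq> V \<times> V" using A by (simp add: digr_def)
  obtain \<C> where \<C>: "finite \<C>" "\<And>C. C \<in> \<C> \<Longrightarrow> treelike V A C \<and> card C = card (arcs_at A C) + 1"
    "pairwise disjnt \<C>" "card V \<le> card A + card \<C>"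
    using many_treelike[OF finV AV] by blast
  have sub: "\<And>D. treelike V A D \<Longrightarrow> D \<subseteq> V" by (simp add: treelike_def)
  have ne: "\<C> \<noteq> {}" using \<C>(4) assms(2) by auto
  then obtain C0 where C0: "treelike V A C0" using \<C>(2) by blast
  obtain C where C: "treelike V A C" "\<And>D. treelike V A D \<Longrightarrow> card C \<le> card D"
    using ex_has_least_nat[of "treelike V A" C0 card] C0 by blast
  have CV: "C \<subseteq> V" and cl: "closed_in A C" using C(1) by (auto simp: treelike_def)
  have finC: "finite C" using CV finV finite_subset by blast
  have "card C * card \<C> = (\<Sum>D\<in>\<C>. card C)" by simp
  also have "\<dots> \<le> (\<Sum>D\<in>\<C>. card D)"
    using C(2) \<C>(2) by (intro sum_mono) blast
  also have "\<dots> = card (\<Union>\<C>)"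
    using \<C>(3) finite_subset[OF sub finV] \<C>(2) by (intro card_Union_disjoint[symmetric]) blast+
  also have "\<dots> \<le> card V"
    using \<C>(2) sub by (intro card_mono[OF finV]) blast
  finally have "card C * card \<C> \<le> card V" .
  moreover have "card V - card A \<le> card \<C>" using \<C>(4) by linarith
  ultimately have sz: "card C * (card V - card A) \<le> card V"
    by (meson le_trans mult_le_mono2)
  have sub': "arcs_at A C \<subseteq> C \<times> C"
    using cl by (auto simp: arcs_at_def closed_in_def)
  \<comment> \<open>The definition only gives fewer arcs than vertices. Splitting \<open>C\<close>
    itself yields a part with exactly one arc less than vertices, and by minimality this part is all
    of \<open>C\<close>.\<close>
  obtain \<D> where \<D>: "finite \<D>" "\<And>D. D \<in> \<D> \<Longrightarrow> treelike C (arcs_at A C) D \<and> card D = card (arcs_at (arcs_at A C) D) + 1"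
    "pairwise disjnt \<D>" "card C \<le> card (arcs_at A C) + card \<D>"
    using many_treelike[OF finC sub'] by blast
  have "\<D> \<noteq> {}" using \<D>(4) C(1) by (auto simp: treelike_def)
  then obtain D where D: "D \<in> \<D>" by blast
  have DC: "D \<subseteq> C" using \<D>(2)[OF D] by (simp add: treelike_def)
  have e: "arcs_at (arcs_at A C) D = arcs_at A D"
    using DC by (auto simp: arcs_at_def)
  have "closed_in A D"
    using \<D>(2)[OF D] DC cl unfolding treelike_def closed_in_def arcs_at_def by blast
  then have "treelike V A D"
    using \<D>(2)[OF D] DC CV e by (auto simp: treelike_def)
  then have "card C \<le> card D" by (rule C(2))
  then have "D = C" using DC finC by (simp add: card_seteq)
  then have "card C = card (arcs_at A C) + 1"
    using \<D>(2)[OF D] e by simp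
  with C sz show thesis using that by blast
qed

text \<open>If \<open>(r, s)\<close> were an arc, deleting it would leave \<open>C\<close> with at
  least two disjoint treelike parts. One of them avoids \<open>v\<close>, hence also
  \<open>r\<close> and \<open>s\<close>, which are still joined to \<open>v\<close>. The deletion
  does not affect that part, so it is a smaller treelike set of the original digraph.\<close>

lemma minimal_treelike_no_triangle:
  assumes A: "digr V A" and C: "treelike V A C" "\<And>D. treelike V A D \<Longrightarrow> card C \<le> card D"
    and v: "v \<in> C" and r: "r \<in> nbr A v" "s \<in> nbr A v"
  shows "(r, s) \<notin> A"
proof
  assume rs: "(r, s) \<in> A"
  note finV = digr_finite(1)[OF A] and finA = digr_finite(2)[OF A]
  have CV: "C \<subseteq> V" and cl: "closed_in A C" using C(1) by (auto simp: treelike_def)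
  have finC: "finite C" using CV finV finite_subset by blast
  have nol: "p \<noteq> q" if "(p, q) \<in> A" for p q using A that by (auto simp: digr_def)
  have vr: "v \<noteq> r" "v \<noteq> s" using r nol by (auto simp: nbr_def)
  have "r \<in> C" using r(1) v cl by (force simp: nbr_def closed_in_def)
  define A' where "A' = arcs_at A C - {(r, s)}"
  have A': "A' \<subseteq> C \<times> C"
    using cl by (auto simp: A'_def arcs_at_def closed_in_def)
  have "(r, s) \<in> arcs_at A C" using rs \<open>r \<in> C\<close> by (simp add: arcs_at_def)
  moreover have "finite (arcs_at A C)" using finA by (simp add: arcs_at_def)
  ultimately have cA': "card A' + 1 = card (arcs_at A C)"
    unfolding A'_def by (metis Suc_eq_plus1 card_Suc_Diff1)
  obtain \<D> where \<D>: "finite \<D>" "\<And>D. D \<in> \<D> \<Longrightarrow> treelike C A' D \<and> card D = card (arcs_at A' D) + 1"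
    "pairwise disjnt \<D>" "card C \<le> card A' + card \<D>"
    using many_treelike[OF finC A'] by blast
  have "card \<D> \<ge> 2" using \<D>(4) cA' C(1) by (simp add: treelike_def)
  then obtain D1 D2 where D12: "D1 \<in> \<D>" "D2 \<in> \<D>" "D1 \<noteq> D2"
    by (metis card_le_Suc0_iff_eq \<D>(1) not_less_eq_eq numeral_2_eq_2)
  then have "disjnt D1 D2" using \<D>(3) by (auto simp: pairwise_def)
  then obtain D where D: "D \<in> \<D>" "v \<notin> D" using D12 by (auto simp: disjnt_def)
  have tD: "treelike C A' D" using \<D>(2)[OF D(1)] by simp
  have DC: "D \<subseteq> C" and clD: "closed_in A' D" using tD by (auto simp: treelike_def)
  have in': "a \<in> A'" if "a \<in> A" "fst a \<in> C" "a \<noteq> (r, s)" for a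
    using that by (simp add: A'_def arcs_at_def)
  have rD: "r \<notin> D" and sD: "s \<notin> D"
  proof -
    have *: "w \<notin> D" if w: "w \<in> nbr A v" and "w = r \<or> w = s" for w
    proof -
      have wC: "w \<in> C" using w v cl by (force simp: nbr_def closed_in_def)
      from w consider "(v, w) \<in> A" | "(w, v) \<in> A" by (auto simp: nbr_def)
      then show ?thesis
      proof cases
        case 1
        then have "(v, w) \<in> A'" using v vr by (intro in') auto
        then show ?thesis using clD D(2) by (force simp: closed_in_def)
      next
        case 2
        then have "(w, v) \<in> A'" using wC vr by (intro in') auto
        then show ?thesis using clD D(2) by (force simp: closed_in_def)
      qed
    qed
    show "r \<notin> D" "s \<notin> D" using * r by auto
  qed
  have "closed_in A D"
    unfolding closed_in_def
  proof
    fix a assume a: "a \<in> A"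
    show "fst a \<in> D \<longleftrightarrow> snd a \<in> D"
    proof (cases "a = (r, s)")
      case True
      then show ?thesis using rD sD by simp
    next
      case False
      show ?thesis
      proof (cases "fst a \<in> C")
        case True
        then have "a \<in> A'" using in'[OF a] False by simp
        then show ?thesis using clD by (simp add: closed_in_def)
      next
        case False
        then show ?thesis using cl a DC by (auto simp: closed_in_def)
      qed
    qed
  qed
  moreover have "arcs_at A D = arcs_at A' D"
    using DC rD by (auto simp: arcs_at_def A'_def)
  ultimately have "treelike V A D"
    using tD DC CV by (auto simp: treelike_def)
  then have "card C \<le> card D" by (rule C(2))
  moreover have "card D < card C"
    using DC D(2) v finC by (intro psubset_card_mono) auto
  ultimately show False by simp
qed

text \<open>The average degree in a treelike set is below two.\<close>

lemma treelike_leaf: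
  assumes A: "digr V A" and C: "treelike V A C"
  shows "\<exists>v\<in>C. deg A v \<le> 1"
proof (rule ccontr)
  assume "\<not> ?thesis"
  have CV: "C \<subseteq> V" and cl: "closed_in A C" and lt: "card (arcs_at A C) < card C"
    using C by (auto simp: treelike_def)
  have dC: "digr C (arcs_at A C)"
    using A CV cl finite_subset[of C V] by (auto simp: arcs_at_def closed_in_def digr_def)
  have "inc (arcs_at A C) v = inc A v" if "v \<in> C" for v
    using that cl by (auto simp: inc_def arcs_at_def closed_in_def)
  then have "deg (arcs_at A C) v = deg A v" if "v \<in> C" for v using that by (simp add: deg_def)
  with \<open>\<not> ?thesis\<close> have "(\<Sum>v\<in>C. 2) \<le> (\<Sum>v\<in>C. deg (arcs_at A C) v)"
    by (intro sum_mono) (auto simp: not_le)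
  then show False using sum_deg[OF dC] lt by simp
qed

section \<open>Removing a vertex of very high degree\<close>

text \<open>The host \<open>x\<close> of \<open>v\<close> may have huge degree, but the vertices of
  \<open>R\<close> are not adjacent to \<open>v\<close>, so neighbours of \<open>x\<close> are
  harmless for them. Every other used host excludes itself and at most \<open>k\<close>
  vertices.\<close>

lemma greedy_extension:
  assumes A: "digr V A" and B: "digr W B" and R: "finite R"
    and "finite S" "R \<inter> S = {}" "v \<in> S" "R \<inter> nbr A v = {}"
    and g0: "inj_on g0 S" "g0 v = x" "\<And>w. w \<in> S - {v} \<Longrightarrow> g0 w \<in> L"
      "\<And>p q. p \<in> S \<Longrightarrow> q \<in> S \<Longrightarrow> (p, q) \<in> A \<Longrightarrow> (g0 p, g0 q) \<notin> B"
    and L: "finite L" "x \<notin> L" "\<And>y. y \<in> L \<Longrightarrow> card (nbr B y - {x}) \<le> k"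
    and big: "(k + 1) * (card S + card R) < card L"
  shows "\<exists>g. inj_on g (S \<union> R) \<and> g v = x \<and> (\<forall>w\<in>(S \<union> R) - {v}. g w \<in> L) \<and>
    (\<forall>p\<in>S \<union> R. \<forall>q\<in>S \<union> R. (p, q) \<in> A \<longrightarrow> (g p, g q) \<notin> B)"
  using R assms(5,7) big
proof (induction R rule: finite_induct)
  case empty
  then show ?case using g0 by (intro exI[of _ g0]) auto
next
  case (insert r R)
  have "(k + 1) * (card S + card R) \<le> (k + 1) * (card S + card (insert r R))"
    using insert.hyps by (intro mult_le_mono2) simp
  with insert obtain g where g: "inj_on g (S \<union> R)" "g v = x" "\<forall>w\<in>(S \<union> R) - {v}. g w \<in> L"
    "\<forall>p\<in>S \<union> R. \<forall>q\<in>S \<union> R. (p, q) \<in> A \<longrightarrow> (g p, g q) \<notin> B" by fastforce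
  let ?T = "S \<union> R"
  have finT: "finite ?T" using assms(4) insert.hyps by simp
  have rT: "r \<notin> ?T" using insert by auto
  have rv: "(r, v) \<notin> A" "(v, r) \<notin> A" using insert.prems by (auto simp: nbr_def)
  have finB: "finite (nbr B y)" for y using digr_finite(2)[OF B] by (rule finite_nbr)
  let ?U = "g ` ?T \<union> (\<Union>w\<in>?T - {v}. nbr B (g w) - {x})"
  have "card (\<Union>w\<in>?T - {v}. nbr B (g w) - {x}) \<le> (\<Sum>w\<in>?T - {v}. card (nbr B (g w) - {x}))"
    using finT by (intro card_UN_le) auto
  also have "\<dots> \<le> (\<Sum>w\<in>?T - {v}. k)"
    using g(3) L(3) by (intro sum_mono) blast
  also have "\<dots> \<le> k * card ?T"
    using finT by (simp add: card_mono mult.commute)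
  finally have "card ?U \<le> card ?T + k * card ?T"
    using card_image_le[OF finT, of g] card_Un_le[of "g ` ?T" "\<Union>w\<in>?T - {v}. nbr B (g w) - {x}"] by linarith
  also have "\<dots> \<le> (k + 1) * (card S + card R)"
    using mult_le_mono2[OF card_Un_le[of S R], of "k + 1"] by simp
  also have "\<dots> < card L"
    using insert.prems(3) \<open>(k + 1) * (card S + card R) \<le> _\<close> by linarith
  finally have lt: "card ?U < card L" .
  have "finite ?U" using finT finB by auto
  then obtain y where y: "y \<in> L" "y \<notin> ?U" using lt by (rule obtain_outside)
  have yx: "y \<noteq> x" using y L(2) by auto
  have yB: "(g w, y) \<notin> B" "(y, g w) \<notin> B" if "w \<in> ?T" "w \<noteq> v" for w
    using y(2) that yx by (auto simp: nbr_def)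
  define h where "h = g(r := y)"
  have hr: "h r = y" and hT: "\<And>w. w \<in> ?T \<Longrightarrow> h w = g w"
    using rT by (auto simp: h_def)
  have "inj_on h (insert r ?T)"
    unfolding h_def using g(1) rT y(2) by (auto simp: inj_on_def)
  moreover have "h v = x" using hT assms(6) g(2) by auto
  moreover have "\<forall>w\<in>insert r ?T - {v}. h w \<in> L"
    using hr hT y(1) g(3) by auto
  moreover have "(h p, h q) \<notin> B" if pq: "p \<in> insert r ?T" "q \<in> insert r ?T" "(p, q) \<in> A" for p q
  proof -
    have "p \<noteq> q" using A pq(3) by (auto simp: digr_def)
    then consider "p = r" "q \<in> ?T" | "q = r" "p \<in> ?T" | "p \<in> ?T" "q \<in> ?T" using pq by auto
    then show ?thesis
    proof cases
      case 1
      then have "q \<noteq> v" using rv pq(3) by auto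
      then show ?thesis using yB(2)[of q] 1 hr hT by simp
    next
      case 2
      then have "p \<noteq> v" using rv pq(3) by auto
      then show ?thesis using yB(1)[of p] 2 hr hT by simp
    next
      case 3
      then show ?thesis using g(4) pq(3) hT by auto
    qed
  qed
  ultimately show ?case by (intro exI[of _ h]) auto
qed

section \<open>Partial placements and the forbidden pairs they leave\<close>

definition blocked ::
  "'a set \<Rightarrow> ('a \<times> 'a) set \<Rightarrow> 'b set \<Rightarrow> ('b \<times> 'b) set \<Rightarrow> 'a set \<Rightarrow> ('a \<Rightarrow> 'b) \<Rightarrow> ('a \<times> 'b) set" where
  "blocked V A W B S g = {(s, t). s \<in> V - S \<and> t \<in> W - g ` S \<and>
     (\<exists>p\<in>S. (p, s) \<in> A \<and> (g p, t) \<in> B \<or> (s, p) \<in> A \<and> (t, g p) \<in> B)}"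

text \<open>A conflict along an arc between a placed and an unplaced vertex means that a pair of
  \<open>blocked\<close> is used. Forbidding these pairs decouples the remainder from the placed
  part.\<close>

lemma lpack_extend:
  assumes A: "digr V A" and S: "S \<subseteq> V" "inj_on g S" "g ` S \<subseteq> W"
    and ok: "\<And>p q. p \<in> S \<Longrightarrow> q \<in> S \<Longrightarrow> (p, q) \<in> A \<Longrightarrow> (g p, g q) \<notin> B"
    and rest: "lpack (V - S) (A \<inter> (V - S) \<times> (V - S)) (W - g ` S)
      (B \<inter> (W - g ` S) \<times> (W - g ` S)) (blocked V A W B S g)"
  shows "lpack V A W B {}"
proof -
  from rest obtain f where f: "bij_betw f (V - S) (W - g ` S)"
    and fA: "\<forall>(p, q)\<in>A \<inter> (V - S) \<times> (V - S). (f p, f q) \<notin> B \<inter> (W - g ` S) \<times> (W - g ` S)"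
    and fF: "\<forall>p\<in>V - S. (p, f p) \<notin> blocked V A W B S g"
    unfolding lpack_def by blast
  define h where "h w = (if w \<in> S then g w else f w)" for w
  have hS: "h w = g w" if "w \<in> S" for w using that by (simp add: h_def)
  have hN: "h w = f w" if "w \<in> V - S" for w using that by (simp add: h_def)
  have fW: "f w \<in> W - g ` S" if "w \<in> V - S" for w using f that by (auto simp: bij_betw_def)
  have "bij_betw h S (g ` S)"
    using S(2) hS by (simp add: bij_betw_def inj_on_def)
  moreover have "bij_betw h (V - S) (W - g ` S)"
    using f bij_betw_cong[of "V - S" h f] hN by blast
  ultimately have "bij_betw h (S \<union> (V - S)) (g ` S \<union> (W - g ` S))"
    by (rule bij_betw_combine) auto
  moreover have "S \<union> (V - S) = V" "g ` S \<union> (W - g ` S) = W" using S by auto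
  ultimately have "bij_betw h V W" by simp
  moreover have "(h p, h q) \<notin> B" if pq: "(p, q) \<in> A" for p q
  proof -
    have V: "p \<in> V" "q \<in> V" using A pq by (auto simp: digr_def)
    consider "p \<in> S" "q \<in> S" | "p \<in> S" "q \<in> V - S" | "p \<in> V - S" "q \<in> S" | "p \<in> V - S" "q \<in> V - S"
      using V by blast
    then show ?thesis
    proof cases
      case 1
      then show ?thesis using ok pq hS by simp
    next
      case 2
      then show ?thesis using fF fW[of q] pq hS hN by (auto simp: blocked_def)
    next
      case 3
      then show ?thesis using fF fW[of p] pq hS hN by (auto simp: blocked_def)
    next
      case 4
      then have "(f p, f q) \<notin> B \<inter> (W - g ` S) \<times> (W - g ` S)" using fA pq by blast
      then show ?thesis using fW[of p] fW[of q] 4 hN by auto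
    qed
  qed
  ultimately show ?thesis unfolding lpack_def by blast
qed

lemma obtain_injection:
  assumes "finite N" "finite I" "card N \<le> card I"
  obtains k where "inj_on k N" "k ` N \<subseteq> I"
  using assms card_le_inj by (metis)

text \<open>A vertex \<open>v\<close> of \<open>C\<close> goes to \<open>x\<close>, its neighbours
  to non-neighbours of \<open>x\<close> in the matching direction, the rest greedily. Whether
  \<open>v\<close> is a leaf, a sink or a source depends on the directions in which \<open>x\<close>
  has free low-degree non-neighbours.\<close>

lemma place_treelike:
  assumes A: "digr V A" and B: "digr W B" and N: "card V = n" "card W = n"
    and C: "treelike V A C" "\<And>D. treelike V A D \<Longrightarrow> card C \<le> card D" "card C = card (arcs_at A C) + 1"
    and q: "card C \<le> q" "q \<ge> 2" "card B + q + 1 \<le> 2 * n"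
    and x: "x \<in> W" and big: "8 * q + card B \<le> 2 * n + deg B x - 4"
  shows "\<exists>g. inj_on g C \<and> g ` C \<subseteq> W \<and> x \<in> g ` C \<and> (\<forall>(p, r)\<in>A. p \<in> C \<longrightarrow> (g p, g r) \<notin> B)"
proof -
  note finV = digr_finite(1)[OF A] and finA = digr_finite(2)[OF A]
  note finW = digr_finite(1)[OF B] and finB = digr_finite(2)[OF B]
  have CV: "C \<subseteq> V" and cl: "closed_in A C" and Cne: "C \<noteq> {}" using C(1) by (auto simp: treelike_def)
  have finC: "finite C" using CV finV finite_subset by blast
  have BW: "fst b \<in> W" "snd b \<in> W" "fst b \<noteq> snd b" if "b \<in> B" for b using B that by (auto simp: digr_def)
  define B' where "B' = {b\<in>B. fst b \<noteq> x \<and> snd b \<noteq> x}"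
  have B': "digr (W - {x}) B'" using B by (auto simp: digr_def B'_def)
  have cB': "card B' + deg B x = card B"
  proof -
    have "B = B' \<union> inc B x" "B' \<inter> inc B x = {}" by (auto simp: B'_def inc_def)
    then show ?thesis using finB unfolding deg_def
      by (metis card_Un_disjoint finite_Un)
  qed
  define L where "L = {y\<in>W - {x}. deg B' y \<le> 3}"
  \<comment> \<open>The threshold 4 gives \<open>2 * card Bad <= card B'\<close>: losing the
    vertices of \<open>Bad\<close> in both directions costs no more than the arcs away from
    \<open>x\<close>.\<close>
  define Bad where "Bad = {y\<in>W - {x}. deg B' y \<ge> 4}"
  have finL: "finite L" "finite Bad" using finW by (auto simp: L_def Bad_def)
  have bad: "4 * card Bad \<le> 2 * card B'"
  proof -
    have "4 * card Bad = (\<Sum>y\<in>Bad. 4)" by simp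
    also have "\<dots> \<le> (\<Sum>y\<in>Bad. deg B' y)" by (intro sum_mono) (simp add: Bad_def)
    also have "\<dots> \<le> (\<Sum>y\<in>W - {x}. deg B' y)"
      using finW by (intro sum_mono2) (auto simp: Bad_def)
    also have "\<dots> = 2 * card B'" by (rule sum_deg[OF B'])
    finally show ?thesis .
  qed
  have "card W > 0" using x finW by (auto simp: card_gt_0_iff)
  then have cW: "card (W - {x}) = n - 1" "n \<ge> 1"
    using x N(2) finW by simp_all
  have cL: "card L + card Bad = n - 1"
  proof -
    have "W - {x} = L \<union> Bad" "L \<inter> Bad = {}" by (auto simp: L_def Bad_def)
    then show ?thesis using finL cW by (metis card_Un_disjoint)
  qed
  define Out where "Out = {y\<in>L. (x, y) \<notin> B}"
  define In where "In = {y\<in>L. (y, x) \<notin> B}"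
  have finOI: "finite Out" "finite In" using finL by (auto simp: Out_def In_def)
  have cOut: "n - 1 \<le> card Out + card {b\<in>B. fst b = x} + card Bad"
  proof -
    have "W - {x} \<subseteq> Out \<union> snd ` {b\<in>B. fst b = x} \<union> Bad"
      by (force simp: Out_def L_def Bad_def)
    then have "n - 1 \<le> card (Out \<union> snd ` {b\<in>B. fst b = x} \<union> Bad)"
      unfolding cW(1)[symmetric] using finOI finL finB by (intro card_mono) auto
    also have "\<dots> \<le> card Out + card (snd ` {b\<in>B. fst b = x}) + card Bad"
      by (meson add_le_mono1 card_Un_le le_trans)
    also have "\<dots> \<le> card Out + card {b\<in>B. fst b = x} + card Bad"
      using finB by (simp add: card_image_le)
    finally show ?thesis .
  qed
  have cIn: "n - 1 \<le> card In + card {b\<in>B. snd b = x} + card Bad"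
  proof -
    have "W - {x} \<subseteq> In \<union> fst ` {b\<in>B. snd b = x} \<union> Bad"
      by (force simp: In_def L_def Bad_def)
    then have "n - 1 \<le> card (In \<union> fst ` {b\<in>B. snd b = x} \<union> Bad)"
      unfolding cW(1)[symmetric] using finOI finL finB by (intro card_mono) auto
    also have "\<dots> \<le> card In + card (fst ` {b\<in>B. snd b = x}) + card Bad"
      by (meson add_le_mono1 card_Un_le le_trans)
    also have "\<dots> \<le> card In + card {b\<in>B. snd b = x} + card Bad"
      using finB by (simp add: card_image_le)
    finally show ?thesis .
  qed
  \<comment> \<open>The tight count: the two sets together miss at most
    \<open>deg B x + 2 * card Bad <= card B\<close> of the \<open>2 * (n - 1)\<close> directed
    positions at \<open>x\<close>, and \<open>card B <= 2 * n - q - 1\<close> leaves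
    \<open>q - 1\<close>, enough for all neighbours of one vertex of \<open>C\<close>.\<close>
  have OI: "card Out + card In \<ge> q - 1"
    using cOut cIn bad cB' q(3) cW(2) deg_eq_out_in[OF B, of x] by linarith
  have aC: "arcs_at A C = {a\<in>A. fst a \<in> C \<and> snd a \<in> C}"
    using cl by (auto simp: arcs_at_def closed_in_def)
  have nC: "nbr A w \<subseteq> C" if "w \<in> C" for w
    using cl that by (force simp: nbr_def closed_in_def)
  have nself: "w \<notin> nbr A w" for w using A by (auto simp: nbr_def digr_def)
  have nle: "card (nbr A w) \<le> q - 1" if "w \<in> C" for w
  proof -
    have "nbr A w \<subseteq> C - {w}" using nC[OF that] nself by auto
    then have "card (nbr A w) \<le> card (C - {w})" using finC by (intro card_mono) auto
    then show ?thesis using that finC q(1) by simp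
  qed
  have finN: "finite (nbr A w)" for w using finA by (rule finite_nbr)
  have finAt: "finite (arcs_at A C)" using finA by (simp add: arcs_at_def)
  have "\<exists>v k. v \<in> C \<and> inj_on k (nbr A v) \<and> (\<forall>y. (v, y) \<in> A \<longrightarrow> k y \<in> Out) \<and> (\<forall>y. (y, v) \<in> A \<longrightarrow> k y \<in> In)"
  proof (cases "Out = {} \<or> In = {}")
    case False
    \<comment> \<open>A leaf has at most one arc, so one free position in each direction
      suffices.\<close>
    then obtain o' i' where oi: "o' \<in> Out" "i' \<in> In" by auto
    obtain v where v: "v \<in> C" and dv: "deg A v \<le> 1"
      using treelike_leaf[OF A C(1)] by blast
    have one: "a = b" if "a \<in> inc A v" "b \<in> inc A v" for a b
      using dv that finite_inc[OF finA, of v] unfolding deg_def by (metis One_nat_def card_le_Suc0_iff_eq)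
    define k where "k y = (if (v, y) \<in> A then o' else i')" for y
    have "inj_on k (nbr A v)"
    proof (rule inj_onI)
      fix y z assume "y \<in> nbr A v" "z \<in> nbr A v"
      then show "y = z"
        using one[of "(v, y)" "(v, z)"] one[of "(v, y)" "(z, v)"] one[of "(y, v)" "(v, z)"] one[of "(y, v)" "(z, v)"]
        by (auto simp: nbr_def inc_def)
    qed
    moreover have "k y \<in> In" if "(y, v) \<in> A" for y
      using one[of "(v, y)" "(y, v)"] that oi nself[of v] by (auto simp: k_def inc_def nbr_def)
    ultimately show ?thesis using v oi by (intro exI[of _ v] exI[of _ k]) (auto simp: k_def)
  next
    case True
    then show ?thesis
    proof
      assume "Out = {}"
      then have I: "card In \<ge> q - 1" using OI by simp
      \<comment> \<open>Only arcs into \<open>x\<close> can be avoided, so \<open>v\<close> must be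
        a sink. One exists because \<open>C\<close> has fewer arcs than vertices, so not every
        vertex is a tail. The other case is dual.\<close>
      have "\<exists>v\<in>C. v \<notin> fst ` arcs_at A C"
      proof (rule ccontr)
        assume "\<not> ?thesis"
        then have "card C \<le> card (fst ` arcs_at A C)" using finAt by (intro card_mono) auto
        also have "\<dots> \<le> card (arcs_at A C)" using finAt by (rule card_image_le)
        finally show False using C(3) by simp
      qed
      then obtain v where v: "v \<in> C" "v \<notin> fst ` arcs_at A C" by blast
      then have no: "(v, y) \<notin> A" for y by (force simp: arcs_at_def)
      obtain k where k: "inj_on k (nbr A v)" "k ` nbr A v \<subseteq> In"
        using obtain_injection[OF finN finOI(2)] nle[OF v(1)] I by (metis le_trans)
      have "k y \<in> In" if "(y, v) \<in> A" for y using k(2) that by (auto simp: nbr_def)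
      then show ?thesis using v(1) no k(1) by blast
    next
      assume "In = {}"
      then have I: "card Out \<ge> q - 1" using OI by simp
      have "\<exists>v\<in>C. v \<notin> snd ` arcs_at A C"
      proof (rule ccontr)
        assume "\<not> ?thesis"
        then have "card C \<le> card (snd ` arcs_at A C)" using finAt by (intro card_mono) auto
        also have "\<dots> \<le> card (arcs_at A C)" using finAt by (rule card_image_le)
        finally show False using C(3) by simp
      qed
      then obtain v where v: "v \<in> C" "v \<notin> snd ` arcs_at A C" by blast
      then have no: "(y, v) \<notin> A" for y by (force simp: aC closed_in_def arcs_at_def dest: bspec[OF cl[unfolded closed_in_def]])
      obtain k where k: "inj_on k (nbr A v)" "k ` nbr A v \<subseteq> Out"
        using obtain_injection[OF finN finOI(1)] nle[OF v(1)] I by (metis le_trans)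
      have "k y \<in> Out" if "(v, y) \<in> A" for y using k(2) that by (auto simp: nbr_def)
      then show ?thesis using v(1) no k(1) by blast
    qed
  qed
  then obtain v k where v: "v \<in> C" and k: "inj_on k (nbr A v)"
    "\<And>y. (v, y) \<in> A \<Longrightarrow> k y \<in> Out" "\<And>y. (y, v) \<in> A \<Longrightarrow> k y \<in> In" by blast
  have kL: "k y \<in> L" if "y \<in> nbr A v" for y
    using that k(2,3) by (auto simp: nbr_def Out_def In_def)
  have xL: "x \<notin> L" by (auto simp: L_def)
  define S where "S = insert v (nbr A v)"
  define g0 where "g0 w = (if w = v then x else k w)" for w
  have SC: "S \<subseteq> C" using v nC by (auto simp: S_def)
  have "\<exists>g. inj_on g (S \<union> (C - S)) \<and> g v = x \<and> (\<forall>w\<in>(S \<union> (C - S)) - {v}. g w \<in> L) \<and>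
    (\<forall>p\<in>S \<union> (C - S). \<forall>r\<in>S \<union> (C - S). (p, r) \<in> A \<longrightarrow> (g p, g r) \<notin> B)"
  proof (rule greedy_extension[OF A B _ _ _ _ _ _ _ _ _ finL(1) xL, where k = 3 and ?g0.0 = g0])
    show "finite (C - S)" "finite S" "(C - S) \<inter> S = {}" "v \<in> S" "(C - S) \<inter> nbr A v = {}"
      using finC finN by (auto simp: S_def)
    show "inj_on g0 S"
      unfolding S_def using k(1) kL xL nself[of v] by (auto simp: inj_on_def g0_def)
    show "g0 v = x" by (simp add: g0_def)
    show "g0 w \<in> L" if "w \<in> S - {v}" for w using that kL by (auto simp: g0_def S_def)
    show "(g0 p, g0 r) \<notin> B" if pr: "p \<in> S" "r \<in> S" "(p, r) \<in> A" for p r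
    proof -
      \<comment> \<open>The images of the neighbours of \<open>v\<close> were chosen only with
        respect to \<open>x\<close>; this is safe because no arc joins two of these
        neighbours.\<close>
      have "\<not> (p \<in> nbr A v \<and> r \<in> nbr A v)"
        using minimal_treelike_no_triangle[OF A C(1,2) v] pr(3) by blast
      then consider "p = v" "r \<noteq> v" | "r = v" "p \<noteq> v" | "p = v" "r = v" using pr(1,2) unfolding S_def by blast
      then show ?thesis
      proof cases
        case 1
        then show ?thesis using k(2)[of r] pr(3) by (simp add: g0_def Out_def)
      next
        case 2
        then show ?thesis using k(3)[of p] pr(3) by (simp add: g0_def In_def)
      next
        case 3
        then show ?thesis using pr(3) A by (auto simp: digr_def)
      qed
    qed
    show "card (nbr B y - {x}) \<le> 3" if "y \<in> L" for y
    proof -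
      have "nbr B y - {x} \<subseteq> nbr B' y"
        using that by (auto simp: nbr_def B'_def L_def)
      then have "card (nbr B y - {x}) \<le> card (nbr B' y)"
        using finite_nbr[OF digr_finite(2)[OF B']] by (rule card_mono[rotated])
      also have "\<dots> \<le> deg B' y" by (rule card_nbr_le_deg[OF digr_finite(2)[OF B']])
      finally show ?thesis using that by (simp add: L_def)
    qed
    have "card S + card (C - S) = card C"
      using SC finC by (metis card_Diff_subset card_mono finite_subset le_add_diff_inverse)
    then show "(3 + 1) * (card S + card (C - S)) < card L"
      using q(1,2) cL bad cB' big cW(2) by simp
  qed
  then obtain g where g: "inj_on g C" "g v = x" "\<forall>w\<in>C - {v}. g w \<in> L"
    "\<forall>p\<in>C. \<forall>r\<in>C. (p, r) \<in> A \<longrightarrow> (g p, g r) \<notin> B"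
    using SC by (auto simp: Un_absorb1)
  have "g ` C \<subseteq> W" using g(2,3) x by (auto simp: L_def)
  moreover have "(g p, g r) \<notin> B" if "(p, r) \<in> A" "p \<in> C" for p r
  proof -
    have "r \<in> C" using cl that by (force simp: closed_in_def)
    then show ?thesis using g(4) that by blast
  qed
  ultimately show ?thesis using g(1,2) v by (intro exI[of _ g]) auto
qed

text \<open>The set placed is closed, so it leaves no forbidden pairs. It has one vertex more than
  arcs, so the margin \<open>\<mu>\<close> of vertices over arcs in the first digraph drops by just
  one, while the second digraph loses all arcs at \<open>x\<close>.\<close>

lemma peel_high_degree:
  fixes V :: "'a set" and W :: "'b set"
  assumes A: "digr V A" and B: "digr W B" and N: "card V = n" "card W = n"
    and \<mu>: "\<mu> \<ge> 91" "n \<ge> 31 * \<mu>" "card A + \<mu> \<le> n" and b: "card B + n div \<mu> + 1 \<le> 2 * n"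
    and x: "x \<in> W" "51 * n \<le> 100 * deg B x"
  obtains V' :: "'a set" and A' and W' :: "'b set" and B' c where "digr V' A'" "digr W' B'" "card V' = n - c" "card W' = n - c"
    "c \<ge> 1" "c \<le> n div \<mu>" "card A' + (\<mu> - 1) \<le> n - c" "card B' + deg B x \<le> card B"
    "lpack V' A' W' B' {} \<Longrightarrow> lpack V A W B {}"
proof -
  note finV = digr_finite(1)[OF A] and finA = digr_finite(2)[OF A]
  note finW = digr_finite(1)[OF B] and finB = digr_finite(2)[OF B]
  define q where "q = n div \<mu>"
  have q31: "q \<ge> 31" using \<mu> div_le_mono[of "31 * \<mu>" n \<mu>] by (simp add: q_def)
  have q\<mu>: "q * \<mu> \<le> n" by (simp add: q_def)
  then have q91: "q * 91 \<le> n" using \<mu>(1) by (meson le_trans mult_le_mono2)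
  have lt: "card A < card V" using \<mu> N by linarith
  obtain C where C: "treelike V A C" "card C * (card V - card A) \<le> card V"
    "card C = card (arcs_at A C) + 1" "\<And>D. treelike V A D \<Longrightarrow> card C \<le> card D"
    using minimal_treelike[OF A lt] by blast
  have "card C * \<mu> \<le> card C * (card V - card A)"
    using \<mu>(3) N by (intro mult_le_mono2) linarith
  with C(2) have "card C * \<mu> \<le> n" using N by linarith
  then have Cq: "card C \<le> q" using \<mu>(1) by (simp add: q_def less_eq_div_iff_mult_less_eq)
  have big: "8 * q + card B \<le> 2 * n + deg B x - 4"
    using b x(2) q91 q31 unfolding q_def[symmetric] by linarith
  obtain g where g: "inj_on g C" "g ` C \<subseteq> W" "x \<in> g ` C" "\<forall>(p, r)\<in>A. p \<in> C \<longrightarrow> (g p, g r) \<notin> B"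
    using place_treelike[OF A B N C(1,4,3) Cq _ _ x(1) big] q31 b unfolding q_def[symmetric] by auto
  have CV: "C \<subseteq> V" and cl: "closed_in A C" using C(1) by (auto simp: treelike_def)
  have finC: "finite C" using CV finV finite_subset by blast
  define A' where "A' = A \<inter> (V - C) \<times> (V - C)"
  define B' where "B' = B \<inter> (W - g ` C) \<times> (W - g ` C)"
  have dA': "digr (V - C) A'" and dB': "digr (W - g ` C) B'"
    using A B by (auto simp: digr_def A'_def B'_def)
  have cV: "card (V - C) = n - card C" using CV finC N by (simp add: card_Diff_subset)
  have cW: "card (W - g ` C) = n - card C"
    using g(1,2) finC N by (simp add: card_Diff_subset card_image)
  have "A = A' \<union> arcs_at A C"
    using cl A by (auto simp: A'_def arcs_at_def closed_in_def digr_def)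
  moreover have "A' \<inter> arcs_at A C = {}" by (auto simp: A'_def arcs_at_def)
  ultimately have "card A = card A' + card (arcs_at A C)"
    using finA by (metis card_Un_disjoint finite_Un)
  then have cA': "card A' + (\<mu> - 1) \<le> n - card C"
    using C(3) \<mu> by linarith
  have "B' \<inter> inc B x = {}" "B' \<union> inc B x \<subseteq> B" using g(3) by (auto simp: B'_def inc_def)
  then have cB': "card B' + deg B x \<le> card B"
    unfolding deg_def using finB by (metis card_Un_disjoint card_mono finite_Un finite_subset)
  have "blocked V A W B C g = {}"
    using cl by (force simp: blocked_def closed_in_def)
  moreover have "(g p, g r) \<notin> B" if "p \<in> C" "(p, r) \<in> A" for p r using g(4) that by blast
  ultimately have "lpack V A W B {}" if "lpack (V - C) A' (W - g ` C) B' {}"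
    using lpack_extend[OF A CV g(1,2), of B] that by (simp add: A'_def B'_def)
  moreover have "card C \<ge> 1" using C(3) by simp
  ultimately show thesis
    using that[OF dA' dB' cV cW _ _ cA' cB'] Cq by (simp add: q_def)
qed

section \<open>Numerical estimates\<close>

text \<open>\<open>N - A\<close> and \<open>(2 - b) * N\<close> stand for bounds on the arc numbers
  of the remainders; \<open>Y = A * (2 - b) + b * N\<close> is the slack in
  \<open>(N - A) * (2 - b) * N = N * (2 * N - Y)\<close>. The four cases tell whether each budget of
  preplaced vertices was exhausted. If not, the remaining maximum degree is the threshold 19 or 23;
  if so, it may be large, but then \<open>A\<close> or \<open>b * N\<close> is large in
  proportion.\<close>

lemma swap_balance:
  fixes N A b \<delta>\<^sub>1 \<delta>\<^sub>2 :: real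
  assumes N: "N \<ge> 2800" and A: "0 \<le> A" "A \<le> (503/1000) * N" and b: "b \<le> (1001/1000)"
    and Ab: "A * (2 - b) \<le> N * (1 - b) + 1" and \<delta>: "\<delta>\<^sub>2 \<ge> 23"
    and cases: "\<delta>\<^sub>1 = 19 \<and> \<delta>\<^sub>2 = 23 \<and> A \<ge> 80 \<and> 2 * A + b * N \<ge> 215
      \<or> 4 * \<delta>\<^sub>1 \<le> A - 40 \<and> \<delta>\<^sub>2 = 23 \<and> A \<ge> 120 \<and> b * N \<ge> -25
      \<or> \<delta>\<^sub>1 = 19 \<and> A \<ge> 80 \<and> b * N \<ge> (45/10) * \<delta>\<^sub>2 - (575/10)
      \<or> 4 * \<delta>\<^sub>1 \<le> A - 40 \<and> A \<ge> 120 \<and> b * N \<ge> (45/10) * \<delta>\<^sub>2 - (715/10)"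
  shows "(A * (2 - b) + b * N) * ((742/1000) * N - (99/100) * \<delta>\<^sub>2) > N * ((404/100) * \<delta>\<^sub>1 + (202/100) * \<delta>\<^sub>2 + (1484/1000))"
proof -
  define d where "d = \<delta>\<^sub>2 / N"
  have dN: "\<delta>\<^sub>2 = d * N" using N by (simp add: d_def)
  define Z where "Z = A * (2 - b)"
  define t where "t = b * N"
  define Y where "Y = Z + t"
  have Z: "0 \<le> Z" "Z \<le> N * (1 - b) + 1" using A b Ab by (auto simp: Z_def)
  have "Y * ((742/1000) - (99/100) * d) > (404/100) * \<delta>\<^sub>1 + (202/100) * \<delta>\<^sub>2 + (1484/1000)"
    using cases unfolding t_def[symmetric]
  proof (elim disjE conjE)
    assume h: "\<delta>\<^sub>1 = 19" "\<delta>\<^sub>2 = 23" "A \<ge> 80" "2 * A + t \<ge> 215"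
    have d: "(742/1000) - (99/100) * d \<ge> (7338/10000)" using N h by (simp add: d_def field_simps)
    have "Y \<ge> 170"
    proof (cases "b \<le> (2/10)")
      case True
      show ?thesis
      proof (cases "b \<le> 0")
        case True
        then have "A * b \<le> 0" using A by (simp add: mult_nonneg_nonpos)
        then show ?thesis using h by (simp add: Y_def Z_def algebra_simps)
      next
        case False
        have "Z \<ge> A * (18/10)" using True A unfolding Z_def by (intro mult_left_mono) auto
        moreover have "t \<ge> 0" using False N by (simp add: t_def)
        ultimately show ?thesis using h unfolding Y_def by linarith
      qed
    next
      case False
      have "t \<ge> (2/10) * N" using False N unfolding t_def by (intro mult_right_mono) auto
      moreover have "Z \<ge> 0" by (rule Z)
      ultimately show ?thesis using N unfolding Y_def by linarith
    qed
    then have "Y * ((742/1000) - (99/100) * d) \<ge> 170 * (7338/10000)" using d by (intro mult_mono) auto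
    then show ?thesis using h by linarith
  next
    assume h: "4 * \<delta>\<^sub>1 \<le> A - 40" "\<delta>\<^sub>2 = 23" "A \<ge> 120" "t \<ge> -25"
    have d: "(742/1000) - (99/100) * d \<ge> (7338/10000)" using N h by (simp add: d_def field_simps)
    have "Y * (7338/10000) > (101/100) * A + (76/10) \<and> Y \<ge> 0"
    proof (cases "b \<le> (2/10)")
      case True
      have "Z \<ge> A * (18/10)" using True A unfolding Z_def by (intro mult_left_mono) auto
      then show ?thesis using h unfolding Y_def by (simp add: algebra_simps)
    next
      case False
      have "t \<ge> (2/10) * N" using False N unfolding t_def by (intro mult_right_mono) auto
      moreover have "Z \<ge> A * (999/1000)" using A b unfolding Z_def by (intro mult_left_mono) auto
      ultimately show ?thesis using N A unfolding Y_def by (simp add: algebra_simps)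
    qed
    moreover have "Y * ((742/1000) - (99/100) * d) \<ge> Y * (7338/10000)" using d calculation by (intro mult_left_mono) auto
    ultimately show ?thesis using h by linarith
  next
    assume h: "\<delta>\<^sub>1 = 19" "A \<ge> 80" "t \<ge> (45/10) * \<delta>\<^sub>2 - (575/10)"
    have bN: "t \<ge> 46" using h \<delta> by simp
    have b0: "b > 0" using bN N unfolding t_def by (smt (verit) mult_nonpos_nonneg)
    have "d \<le> (10/45) * b + (575/45) / N" using h N by (simp add: d_def t_def field_simps)
    moreover have "(575/45) / N \<le> (46/10000)" using N by (simp add: field_simps)
    ultimately have d: "(742/1000) - (99/100) * d \<ge> (737/1000) - (22/100) * b" by linarith
    have Y: "Y \<ge> 0" using Z(1) bN by (simp add: Y_def)
    have "Y * ((737/1000) - (22/100) * b) > (449/1000) * (t) + (1041/10)"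
    proof (cases "b \<le> (1/10)")
      case True
      have "Z \<ge> 80 * (19/10)" using True h unfolding Z_def by (intro mult_mono) auto
      then have "Y * ((737/1000) - (22/100) * b) \<ge> (152 + t) * (715/1000)"
        using True b0 bN by (intro mult_mono) (auto simp: Y_def)
      moreover have "(152 + t) * (715/1000) = (715/1000) * t + (10868/100)" by (simp add: field_simps)
      ultimately show ?thesis using bN by linarith
    next
      case False
      have "Z \<ge> 80 * (999/1000)" using b h unfolding Z_def by (intro mult_mono) auto
      then have "Y * ((737/1000) - (22/100) * b) \<ge> ((7992/100) + t) * ((737/1000) - (22/100) * b)"
        using b by (intro mult_right_mono) (auto simp: Y_def)
      moreover have "(7992/100) * ((737/1000) - (22/100) * b) \<ge> 41" using b by simp
      moreover have "b * ((288/1000) - (22/100) * b) \<ge> (263/10000)"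
      proof -
        \<comment> \<open>The quadratic in \<open>b\<close> is concave, so on the interval from 1/10
          to 1001/1000 it lies above its chord; the product of the distances to the end points
          measures the gap.\<close>
        define bb where "bb = b * b"
        have "(b - (1/10)) * ((1001/1000) - b) \<ge> 0" using b False by simp
        also have "(b - (1/10)) * ((1001/1000) - b) = (1101/1000) * b - (1001/10000) - bb"
          by (simp add: bb_def field_simps)
        finally have 1: "(1101/1000) * b - (1001/10000) - bb \<ge> 0" .
        have 2: "b * ((288/1000) - (22/100) * b) = (288/1000) * b - (22/100) * bb"
          by (simp add: bb_def algebra_simps)
        show ?thesis unfolding 2 using False 1 by linarith
      qed
      then have "N * (b * ((288/1000) - (22/100) * b)) \<ge> 2800 * (263/10000)" using N by (intro mult_mono) auto
      moreover have "((7992/100) + t) * ((737/1000) - (22/100) * b)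
          = (7992/100) * ((737/1000) - (22/100) * b) + N * (b * ((288/1000) - (22/100) * b)) + (449/1000) * t"
        by (simp add: t_def field_simps)
      moreover have "r + (1041/10) < y" if "p \<le> y" "41 \<le> u" "2800 * (263/10000) \<le> z" "p = u + z + r"
        for p y u z r :: real
        using that by linarith
      ultimately show ?thesis by blast
    qed
    moreover have "Y * ((742/1000) - (99/100) * d) \<ge> Y * ((737/1000) - (22/100) * b)" using d Y by (intro mult_left_mono) auto
    moreover have "(45/10) * \<delta>\<^sub>2 \<le> t + (575/10)" using h by simp
    ultimately show ?thesis using h bN by linarith
  next
    assume h: "4 * \<delta>\<^sub>1 \<le> A - 40" "A \<ge> 120" "t \<ge> (45/10) * \<delta>\<^sub>2 - (715/10)"
    have bN: "t \<ge> 32" using h \<delta> by simp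
    have b0: "b > 0" using bN N unfolding t_def by (smt (verit) mult_nonpos_nonneg)
    have "d \<le> (10/45) * b + (715/45) / N" using h N by (simp add: d_def t_def field_simps)
    moreover have "(715/45) / N \<le> (57/10000)" using N by (simp add: field_simps)
    ultimately have d: "(742/1000) - (99/100) * d \<ge> (736/1000) - (22/100) * b" by linarith
    have Y: "Y \<ge> 0" using Z(1) bN by (simp add: Y_def)
    have "Z * ((736/1000) - (22/100) * b) + t * ((287/1000) - (22/100) * b) + (68/10) > (101/100) * A"
    proof (cases "b \<le> (3/10)")
      case True
      have "(2 - b) * ((736/1000) - (22/100) * b) \<ge> (17/10) * (67/100)" using True by (intro mult_mono) auto
      then have "Z * ((736/1000) - (22/100) * b) \<ge> A * ((17/10) * (67/100))"
        unfolding Z_def mult.assoc using A by (intro mult_left_mono) auto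
      moreover have "t * ((287/1000) - (22/100) * b) \<ge> 0" using True b0 N by (simp add: t_def)
      ultimately show ?thesis using A by linarith
    next
      case False
      have "A \<le> Z * ((4134/10000) + (588/1000) * b)"
      proof -
        \<comment> \<open>Again a concave quadratic against its chord, now from 3/10 to 1001/1000;
          \<open>s\<close> vanishes at both ends.\<close>
        define s where "s = (b - (3/10)) * ((1001/1000) - b)"
        have 1: "s \<ge> 0" using b False by (simp add: s_def)
        have 2: "(2 - b) * ((4134/10000) + (588/1000) * b)
            = (588/1000) * s + 2508441/2500000 - 597/250000 * b"
          by (simp add: s_def field_simps)
        have "(2 - b) * ((4134/10000) + (588/1000) * b) \<ge> 1" unfolding 2 using b 1 by linarith
        then have "A * ((2 - b) * ((4134/10000) + (588/1000) * b)) \<ge> A * 1" using A by (intro mult_left_mono) auto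
        then show ?thesis by (simp add: Z_def algebra_simps)
      qed
      moreover have "Z * ((4134/10000) + (588/1000) * b) * (101/100) \<le> Z * ((4176/10000) + (594/1000) * b)"
      proof -
        have "((4134/10000) + (588/1000) * b) * (101/100) \<le> (4176/10000) + (594/1000) * b"
          using b0 by (simp add: field_simps)
        then have "Z * (((4134/10000) + (588/1000) * b) * (101/100)) \<le> Z * ((4176/10000) + (594/1000) * b)"
          using Z(1) by (rule mult_left_mono)
        then show ?thesis by (simp only: mult.assoc)
      qed
      moreover have "(101/100) * a \<le> y" if "a \<le> p" "p * (101/100) \<le> y" for a p y :: real
        using that by linarith
      ultimately have A1: "(101/100) * A \<le> Z * ((4176/10000) + (594/1000) * b)" by blast
      \<comment> \<open>The excess of the coefficient of \<open>Z\<close> in \<open>A1\<close> over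
        the available one. Where it is positive, the upper bound on \<open>Z\<close> from
        \<open>Ab\<close> caps the loss.\<close>
      define w where "w = (814/1000) * b - (3184/10000)"
      have eq: "Z * ((736/1000) - (22/100) * b) = Z * ((4176/10000) + (594/1000) * b) - Z * w"
        by (simp add: w_def field_simps)
      have tpos: "t * ((287/1000) - (22/100) * b) \<ge> 0" using b b0 N by (simp add: t_def)
      have "t * ((287/1000) - (22/100) * b) + (68/10) > Z * w"
      proof (cases "w \<le> 0")
        case True
        then have "Z * w \<le> 0" using Z(1) by (simp add: mult_nonneg_nonpos)
        then show ?thesis using tpos by linarith
      next
        case False
        then have "Z * w \<le> (N * (1 - b) + 1) * w" using Z(2) by (intro mult_right_mono) auto
        moreover have "b * ((287/1000) - (22/100) * b) - (1 - b) * w \<ge> 0"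
        proof -
          \<comment> \<open>Completing the square: the quadratic is convex with its minimum close to
            71/100.\<close>
          define s where "s = (b - 71/100)\<^sup>2"
          have 1: "s \<ge> 0" by (simp add: s_def)
          have 2: "b * ((287/1000) - (22/100) * b) - (1 - b) * w
             = (594/1000) * s + 189646/10000000 - 192/100000 * b"
            by (simp add: s_def w_def power2_eq_square field_simps)
          show ?thesis unfolding 2 using b b0 1 by linarith
        qed
        then have "N * (b * ((287/1000) - (22/100) * b) - (1 - b) * w) \<ge> 0" using N by simp
        moreover have "N * (b * ((287/1000) - (22/100) * b) - (1 - b) * w)
            = t * ((287/1000) - (22/100) * b) + w - (N * (1 - b) + 1) * w"
          by (simp add: t_def algebra_simps)
        moreover have "w \<le> 1" using b by (simp add: w_def)
        ultimately show ?thesis by linarith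
      qed
      then show ?thesis using A1 eq by linarith
    qed
    moreover have "Y * ((742/1000) - (99/100) * d) \<ge> Y * ((736/1000) - (22/100) * b)" using d Y by (intro mult_left_mono) auto
    moreover have "(45/10) * \<delta>\<^sub>2 \<le> t + (715/10)" using h by simp
    moreover have "Y * ((736/1000) - (22/100) * b) = Z * ((736/1000) - (22/100) * b)
        + t * ((287/1000) - (22/100) * b) + (449/1000) * t"
      by (simp add: Y_def field_simps)
    ultimately show ?thesis using h bN by linarith
  qed
  then have "N * (Y * ((742/1000) - (99/100) * d)) > N * ((404/100) * \<delta>\<^sub>1 + (202/100) * \<delta>\<^sub>2 + (1484/1000))"
    using N by simp
  then show ?thesis by (simp add: Y_def Z_def t_def dN algebra_simps)
qed

text \<open>Here \<open>k\<^sub>1\<close>, \<open>k\<^sub>2\<close> are the numbers of preplaced high-degree vertices of the two digraphs,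
  \<open>h\<close>, \<open>e\<close> the numbers of arcs destroyed by preplacing, \<open>\<sigma>\<close> the number of preplaced vertices, and
  \<open>P\<close> is the expected number of conflicts multiplied by \<open>N * (N - 1)\<close>.\<close>

lemma preplacement_balance:
  fixes n \<mu> N \<sigma> k\<^sub>1 k\<^sub>2 h e \<delta>\<^sub>1 \<delta>\<^sub>2 \<phi> M a b P :: real
  assumes \<mu>: "\<mu> \<ge> 92" "n \<ge> 31 * \<mu>" and N: "N = n - \<sigma>" "0 \<le> \<sigma>" "\<sigma> \<le> 7 * k\<^sub>1 + 2 * k\<^sub>2"
    and k: "0 \<le> k\<^sub>1" "0 \<le> k\<^sub>2"
    and h: "h \<ge> 17 * k\<^sub>1" and e: "e \<ge> 19 * k\<^sub>2"
    and \<delta>\<^sub>1: "k\<^sub>1 \<le> 3 \<and> \<delta>\<^sub>1 = 19 \<or> k\<^sub>1 = 4 \<and> h \<ge> 4 * \<delta>\<^sub>1 - 12 \<and> \<delta>\<^sub>1 \<ge> 19"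
    and \<delta>\<^sub>2: "k\<^sub>2 \<le> 5 \<and> \<delta>\<^sub>2 = 23 \<or> k\<^sub>2 = 6 \<and> e \<ge> 6 * \<delta>\<^sub>2 - 30 \<and> \<delta>\<^sub>2 \<ge> 23"
    and a: "0 \<le> a" "a \<le> n - \<mu> - h" and b: "0 \<le> b" "b \<le> 2 * n - n / \<mu> - e"
    and P: "0 \<le> P" "P \<le> (2 * n - n / \<mu> - e) * (n - \<mu> - h + (6/100) * e)"
    and M: "M = N - 1 - 2 * \<delta>\<^sub>1 - 2 * \<delta>\<^sub>2 - \<phi>" and \<phi>: "\<phi> \<le> 18 * n / 71"
  shows "P < N * (N - 1) \<or> M > 0 \<and> P * (M * (N - 2) + \<delta>\<^sub>1 * b + \<delta>\<^sub>2 * a) < 2 * M * N * (N - 1) * (N - 2)"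
proof -
  define a0 where "a0 = n - \<mu> - h"
  define b0 where "b0 = 2 * n - n / \<mu> - e"
  have q: "n / \<mu> \<ge> 31" using \<mu> by (simp add: field_simps)
  have k1: "k\<^sub>1 \<le> 4" and k2: "k\<^sub>2 \<le> 6" using \<delta>\<^sub>1 \<delta>\<^sub>2 by auto
  have N28: "N \<ge> 2812" using \<mu> N k1 k2 by linarith
  have nN: "n \<le> N + 40" using N k1 k2 by linarith
  have e0: "e \<ge> 0" and h0: "h \<ge> 0" using e h k by auto
  have b0: "b0 \<le> 2 * N + 25 - (1/4) * e" "0 \<le> b0"
    using N q e k1 k b unfolding b0_def by linarith+
  have P': "P \<le> b0 * (a0 + (6/100) * e)" using P by (simp add: a0_def b0_def)
  show ?thesis
  \<comment> \<open>With fewer than about \<open>N / 2\<close> arcs against about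
    \<open>2 * N\<close>, the expected number of conflicts is below one. The gain of
    \<open>6/100 * e\<close> in one factor is outweighed by the loss of \<open>1/4 * e\<close> in
    the other.\<close>
  proof (cases "a0 < (497/1000) * N")
    case True
    define x y where "x = (2009/1000) * N - (1/4) * e" and "y = (497/1000) * N + (6/100) * e"
    have bx: "b0 \<le> x" using b0 N28 unfolding x_def by linarith
    have "b0 * (a0 + (6/100) * e) \<le> b0 * y"
      using True b0(2) unfolding y_def by (intro mult_left_mono) linarith+
    also have "\<dots> \<le> x * y"
      using bx N28 e0 unfolding y_def by (intro mult_right_mono) linarith+
    also have "\<dots> = (998473/1000000) * (N * N) - (371/100000) * (N * e) - (15/1000) * (e * e)"
      by (simp add: x_def y_def field_simps)
    also have "\<dots> \<le> (998473/1000000) * (N * N)"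
    proof -
      have "0 \<le> N * e" "0 \<le> e * e" using N28 e0 by auto
      then show ?thesis by linarith
    qed
    also have "\<dots> < N * N - N"
    proof -
      have "2812 * N \<le> N * N" using N28 by (intro mult_right_mono) auto
      then show ?thesis using N28 by linarith
    qed
    finally have "P < N * (N - 1)" using P' by (simp add: algebra_simps)
    then show ?thesis ..
  next
    case False
    \<comment> \<open>\<open>A\<close> and \<open>B\<close> are the deficits of the arc bounds
      against \<open>N\<close> and \<open>2 * N\<close>. A quarter of \<open>e\<close> is sacrificed
      in \<open>B\<close> to absorb the term \<open>6/100 * e\<close> of the other factor.\<close>
    define A where "A = N - a0"
    define B where "B = 2 * N - (b0 + (1/4) * e)"
    define Q where "Q = (N - A) * (2 * N - B)"
    have A_eq: "A = \<mu> + h - \<sigma>" unfolding A_def a0_def N(1) by simp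
    define \<nu> where "\<nu> = n / \<mu>"
    have \<nu>: "\<nu> \<ge> 31" using q by (simp add: \<nu>_def)
    have B_eq: "B = \<nu> + (3/4) * e - 2 * \<sigma>" unfolding B_def b0_def N(1) \<nu>_def by simp
    have PQ: "P \<le> Q"
    proof -
      have "(6/100) * b0 \<le> (1/4) * a0" using False b0 N28 e0 by linarith
      then have "e * ((6/100) * b0) \<le> e * ((1/4) * a0)" using e0 by (rule mult_left_mono)
      then have "b0 * (a0 + (6/100) * e) \<le> a0 * (b0 + (1/4) * e)" by (simp add: algebra_simps)
      then show ?thesis using P' by (simp add: Q_def A_def B_def)
    qed
    show ?thesis
    proof (cases "Q < N * (N - 1)")
      case True
      then show ?thesis using PQ by linarith
    next
      case large: False
      define \<beta> where "\<beta> = B / N"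
      have BN: "B = \<beta> * N" using N28 by (simp add: \<beta>_def)
      define Y where "Y = A * (2 - \<beta>) + \<beta> * N"
      have QY: "Q = N * (2 * N - Y)" by (simp add: Q_def Y_def BN algebra_simps)
      \<comment> \<open>Since \<open>Q\<close> is not below \<open>N * (N - 1)\<close>, the slack
        \<open>Y\<close> is at most \<open>N + 1\<close>; this keeps \<open>\<beta>\<close> from
        exceeding one noticeably.\<close>
      have "N - 1 \<le> 2 * N - Y"
        using large N28 unfolding QY by (simp add: not_less)
      then have Ab: "A * (2 - \<beta>) \<le> N * (1 - \<beta>) + 1"
        unfolding Y_def by (simp add: algebra_simps)
      have A0: "A \<ge> 80" unfolding A_eq using \<mu> h N(3) k k1 k2 by linarith
      have AN: "A \<le> (503/1000) * N" using False unfolding A_def by linarith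
      have B2: "B \<le> 2 * N" using b0 e0 unfolding B_def by linarith
      then have \<beta>2: "\<beta> \<le> 2" using N28 unfolding BN by simp
      have \<beta>1: "\<beta> \<le> 1001/1000"
      proof -
        have "0 \<le> A * (2 - \<beta>)" using A0 \<beta>2 by simp
        then have "N * (\<beta> - 1) \<le> 1" using Ab by (simp add: algebra_simps)
        show ?thesis
        proof (rule ccontr)
          assume "\<not> ?thesis"
          then have "2812 * (1/1000) \<le> N * (\<beta> - 1)" using N28 by (intro mult_mono) auto
          then show False using \<open>N * (\<beta> - 1) \<le> 1\<close> by simp
        qed
      qed
      have \<delta>23: "\<delta>\<^sub>2 \<ge> 23" using \<delta>\<^sub>2 by auto
      have cs: "\<delta>\<^sub>1 = 19 \<and> \<delta>\<^sub>2 = 23 \<and> A \<ge> 80 \<and> 2 * A + \<beta> * N \<ge> 215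
        \<or> 4 * \<delta>\<^sub>1 \<le> A - 40 \<and> \<delta>\<^sub>2 = 23 \<and> A \<ge> 120 \<and> \<beta> * N \<ge> -25
        \<or> \<delta>\<^sub>1 = 19 \<and> A \<ge> 80 \<and> \<beta> * N \<ge> (45/10) * \<delta>\<^sub>2 - (575/10)
        \<or> 4 * \<delta>\<^sub>1 \<le> A - 40 \<and> A \<ge> 120 \<and> \<beta> * N \<ge> (45/10) * \<delta>\<^sub>2 - (715/10)"
        using \<delta>\<^sub>1 \<delta>\<^sub>2
      proof (elim disjE)
        assume "k\<^sub>1 \<le> 3 \<and> \<delta>\<^sub>1 = 19" "k\<^sub>2 \<le> 5 \<and> \<delta>\<^sub>2 = 23"
        moreover have "2 * A + B \<ge> 215" unfolding A_eq B_eq using \<mu>(1) \<nu> h e N(3) k by argo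
        ultimately show ?thesis using A0 unfolding BN by blast
      next
        assume *: "k\<^sub>1 = 4 \<and> h \<ge> 4 * \<delta>\<^sub>1 - 12 \<and> \<delta>\<^sub>1 \<ge> 19" "k\<^sub>2 \<le> 5 \<and> \<delta>\<^sub>2 = 23"
        have "A \<ge> 120" "4 * \<delta>\<^sub>1 \<le> A - 40" unfolding A_eq using * \<mu> h N k by argo+
        moreover have "B \<ge> -25" unfolding B_eq using * \<nu> e N(3) k by argo
        ultimately show ?thesis using * unfolding BN by blast
      next
        assume *: "k\<^sub>1 \<le> 3 \<and> \<delta>\<^sub>1 = 19" "k\<^sub>2 = 6 \<and> e \<ge> 6 * \<delta>\<^sub>2 - 30 \<and> \<delta>\<^sub>2 \<ge> 23"
        have "B \<ge> (45/10) * \<delta>\<^sub>2 - (575/10)" unfolding B_eq using * \<nu> N(3) k by argo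
        then show ?thesis using * A0 unfolding BN by blast
      next
        assume *: "k\<^sub>1 = 4 \<and> h \<ge> 4 * \<delta>\<^sub>1 - 12 \<and> \<delta>\<^sub>1 \<ge> 19" "k\<^sub>2 = 6 \<and> e \<ge> 6 * \<delta>\<^sub>2 - 30 \<and> \<delta>\<^sub>2 \<ge> 23"
        have "A \<ge> 120" "4 * \<delta>\<^sub>1 \<le> A - 40" unfolding A_eq using * \<mu> h N k by argo+
        moreover have "B \<ge> (45/10) * \<delta>\<^sub>2 - (715/10)" unfolding B_eq using * \<nu> N(3) k by argo
        ultimately show ?thesis unfolding BN by blast
      qed
      have bal: "Y * ((742/1000) * N - (99/100) * \<delta>\<^sub>2) > N * ((404/100) * \<delta>\<^sub>1 + (202/100) * \<delta>\<^sub>2 + (1484/1000))"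
        unfolding Y_def using N28 A0 by (intro swap_balance[OF _ _ AN \<beta>1 Ab \<delta>23 cs]) auto
      have \<delta>10: "\<delta>\<^sub>1 \<ge> 19" using \<delta>\<^sub>1 by auto
      \<comment> \<open>\<open>M0\<close> is a lower bound for \<open>M\<close>: the forbidden pairs
        take up to \<open>18/71\<close> of \<open>n\<close>, and 742/1000 lies just below
        \<open>1 - 18/71\<close> to absorb the additive constants. \<open>r\<close> bounds the
        degree terms, as the arc numbers are at most about \<open>2 * N\<close> and
        \<open>N\<close>.\<close>
      define M0 where "M0 = (742/1000) * N - 2 * \<delta>\<^sub>1 - 2 * \<delta>\<^sub>2"
      define r where "r = (101/100) * (2 * \<delta>\<^sub>1 + \<delta>\<^sub>2)"
      have M0: "M0 > 0"
      proof -
        have "\<beta> * N \<le> (1001/1000) * N" using \<beta>1 N28 by (intro mult_right_mono) auto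
        then show ?thesis using cs AN N28 unfolding M0_def by (elim disjE conjE) argo+
      qed
      have MM0: "M0 \<le> M" unfolding M M0_def using \<phi> nN N28 by argo
      have r0: "r > 0" using \<delta>10 \<delta>23 unfolding r_def by argo
      have fac: "(742/1000) * N - (99/100) * \<delta>\<^sub>2 \<le> M0 + r" "(742/1000) * N - (99/100) * \<delta>\<^sub>2 > 0"
        using M0 \<delta>10 \<delta>23 unfolding M0_def r_def by argo+
      have "0 < N * ((404/100) * \<delta>\<^sub>1 + (202/100) * \<delta>\<^sub>2 + (1484/1000))"
        using N28 \<delta>10 \<delta>23 by (intro mult_pos_pos) argo+
      then have "0 < Y * ((742/1000) * N - (99/100) * \<delta>\<^sub>2)" using bal by argo
      then have Y0: "Y > 0" using fac(2) by (simp add: zero_less_mult_iff)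
      have "Y * ((742/1000) * N - (99/100) * \<delta>\<^sub>2) \<le> Y * (M0 + r)"
        using fac(1) Y0 by (intro mult_left_mono) auto
      moreover have "N * ((404/100) * \<delta>\<^sub>1 + (202/100) * \<delta>\<^sub>2 + (1484/1000)) = 2 * (N * r) + (1484/1000) * N"
        by (simp add: r_def field_simps)
      moreover have "2 * M0 \<le> (1484/1000) * N" using \<delta>10 \<delta>23 unfolding M0_def by argo
      ultimately have Y1: "Y * (M0 + r) > 2 * (N * r) + 2 * M0"
        using bal by (smt (verit))
      have *: "(2 * N - Y) * (M0 + r) < 2 * (N - 1) * M0"
      proof -
        have "(2 * N - Y) * (M0 + r) = 2 * (N * M0) + 2 * (N * r) - Y * (M0 + r)"
          by (simp add: algebra_simps)
        also have "\<dots> < 2 * (N * M0) - 2 * M0" using Y1 by (smt (verit))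
        also have "\<dots> = 2 * (N - 1) * M0" by (simp add: algebra_simps)
        finally show ?thesis .
      qed
      \<comment> \<open>This passes from \<open>M0\<close> to the true \<open>M\<close>: the
        inequality forces \<open>2 * N - Y < 2 * (N - 1)\<close>, so enlarging \<open>M\<close>
        helps the right-hand side more.\<close>
      have "2 * (N - 1) * M0 \<le> 2 * (N - 1) * (M0 + r)"
        using r0 N28 by (intro mult_left_mono) auto
      with * have "(2 * N - Y) * (M0 + r) < 2 * (N - 1) * (M0 + r)" by argo
      then have "2 * N - Y < 2 * (N - 1)" using M0 r0 by simp
      then have "(2 * N - Y) * (M - M0) \<le> 2 * (N - 1) * (M - M0)"
        using MM0 by (intro mult_right_mono) auto
      moreover have "(2 * N - Y) * (M + r) = (2 * N - Y) * (M0 + r) + (2 * N - Y) * (M - M0)"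
        by (simp add: algebra_simps)
      moreover have "2 * (N - 1) * M = 2 * (N - 1) * M0 + 2 * (N - 1) * (M - M0)"
        by (simp add: algebra_simps)
      ultimately have **: "(2 * N - Y) * (M + r) < 2 * (N - 1) * M" using * by (smt (verit))
      have M1: "M > 0" using M0 MM0 by argo
      have ab: "\<delta>\<^sub>1 * b + \<delta>\<^sub>2 * a \<le> r * (N - 2)"
      proof -
        have "b \<le> (202/100) * (N - 2)" using b b0 e0 N28 unfolding b0_def by argo
        then have "\<delta>\<^sub>1 * b \<le> \<delta>\<^sub>1 * ((202/100) * (N - 2))" using \<delta>10 by (intro mult_left_mono) auto
        moreover have "a \<le> (101/100) * (N - 2)" using a A0 N28 unfolding A_def a0_def by argo
        then have "\<delta>\<^sub>2 * a \<le> \<delta>\<^sub>2 * ((101/100) * (N - 2))" using \<delta>23 by (intro mult_left_mono) auto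
        moreover have "r * (N - 2) = \<delta>\<^sub>1 * ((202/100) * (N - 2)) + \<delta>\<^sub>2 * ((101/100) * (N - 2))"
          by (simp add: r_def field_simps)
        ultimately show ?thesis by (smt (verit))
      qed
      have "P * (M * (N - 2) + \<delta>\<^sub>1 * b + \<delta>\<^sub>2 * a) \<le> P * ((M + r) * (N - 2))"
        using ab P(1) by (intro mult_left_mono) (auto simp: algebra_simps)
      also have "\<dots> \<le> Q * ((M + r) * (N - 2))"
        using PQ M1 r0 N28 by (intro mult_right_mono) auto
      also have "\<dots> = ((2 * N - Y) * (M + r)) * (N * (N - 2))"
        by (simp add: QY algebra_simps)
      also have "\<dots> < (2 * (N - 1) * M) * (N * (N - 2))"
        using ** N28 by (intro mult_strict_right_mono) auto
      also have "\<dots> = 2 * M * N * (N - 1) * (N - 2)" by (simp add: algebra_simps)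
      finally show ?thesis using M1 by blast
    qed
  qed
qed

section \<open>Preplacing the vertices of high degree\<close>

text \<open>The vertices are taken in order of decreasing degree, at most \<open>K\<close> of them
  and only above \<open>\<theta>\<close>. If the budget runs out, a large bound
  \<open>\<delta>\<close> on the rest is paid for by \<open>K\<close> chosen vertices of degree at
  least \<open>\<delta>\<close>.\<close>

lemma top_vertices:
  fixes f :: "'a \<Rightarrow> nat"
  assumes "finite V"
  shows "\<exists>U \<delta>. U \<subseteq> V \<and> card U \<le> K \<and> (\<forall>v\<in>V - U. f v \<le> \<delta>) \<and>
    (\<forall>u\<in>U. \<delta> \<le> f u \<and> \<theta> < f u) \<and> \<theta> \<le> \<delta> \<and> (card U = K \<or> \<delta> = \<theta>)"
proof (induction K)
  case 0
  have "f v \<le> max \<theta> (Max (f ` V))" if "v \<in> V" for v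
    using assms that by (simp add: le_max_iff_disj)
  then show ?case by (intro exI[of _ "{}"] exI[of _ "max \<theta> (Max (f ` V))"]) auto
next
  case (Suc K)
  then obtain U \<delta> where U: "U \<subseteq> V" "card U \<le> K" "\<forall>v\<in>V - U. f v \<le> \<delta>"
    "\<forall>u\<in>U. \<delta> \<le> f u \<and> \<theta> < f u" "\<theta> \<le> \<delta>" "card U = K \<or> \<delta> = \<theta>" by blast
  show ?case
  proof (cases "\<forall>v\<in>V - U. f v \<le> \<theta>")
    case True
    have "\<forall>u\<in>U. \<theta> \<le> f u \<and> \<theta> < f u" using U(4) by auto
    then show ?thesis using U(1,2) True by (intro exI[of _ U] exI[of _ \<theta>]) auto
  next
    case False
    then have ne: "V - U \<noteq> {}" and K: "card U = K" using U(3,6) by auto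
    have fin: "finite (V - U)" "finite U" using assms U(1) finite_subset by auto
    have "Max (f ` (V - U)) \<in> f ` (V - U)" using fin ne by (intro Max_in) auto
    then obtain v where v: "v \<in> V - U" and fv: "f v = Max (f ` (V - U))" by auto
    have vmax: "f w \<le> f v" if "w \<in> V - U" for w unfolding fv using fin that by (intro Max_ge) auto
    from False obtain w where "w \<in> V - U" "\<not> f w \<le> \<theta>" by blast
    then have "\<theta> < f v" using vmax[of w] by simp
    moreover have "f v \<le> f u" if "u \<in> U" for u
      using U(3,4) v that by (meson le_trans)
    moreover have "\<theta> < f u" if "u \<in> U" for u using U(4) that by blast
    moreover have "card (insert v U) = Suc K" using v(1) fin K by simp
    ultimately show ?thesis
      using U(1) v vmax by (intro exI[of _ "insert v U"] exI[of _ "f v"]) auto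
  qed
qed

definition touch :: "('a \<times> 'a) set \<Rightarrow> 'a set \<Rightarrow> ('a \<times> 'a) set" where
  "touch A U = {a\<in>A. fst a \<in> U \<or> snd a \<in> U}"

text \<open>The degree sum counts exactly the arcs inside \<open>U\<close> twice, and there are at
  most as many of these as ordered pairs of distinct vertices of \<open>U\<close>.\<close>

lemma sum_deg_touch:
  assumes A: "digr V A" and U: "finite U"
  shows "(\<Sum>u\<in>U. deg A u) \<le> card (touch A U) + card U * (card U - 1)"
    and "(\<Sum>u\<in>U. deg A u) \<le> 2 * card (touch A U)"
proof -
  note finA = digr_finite(2)[OF A]
  let ?O = "{a\<in>A. fst a \<in> U}" and ?I = "{a\<in>A. snd a \<in> U}"
  have key: "(\<Sum>u\<in>U. card {a\<in>A. g a = u}) = card {a\<in>A. g a \<in> U}" for g :: "'a \<times> 'a \<Rightarrow> 'a"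
  proof -
    have "card (\<Union>u\<in>U. {a\<in>A. g a = u}) = (\<Sum>u\<in>U. card {a\<in>A. g a = u})"
      using U finA by (intro card_UN_disjoint) auto
    moreover have "(\<Union>u\<in>U. {a\<in>A. g a = u}) = {a\<in>A. g a \<in> U}" by auto
    ultimately show ?thesis by simp
  qed
  have s: "(\<Sum>u\<in>U. deg A u) = card ?O + card ?I"
    unfolding deg_eq_out_in[OF A] sum.distrib key ..
  have u: "?O \<union> ?I = touch A U" by (auto simp: touch_def)
  have "card ?O + card ?I = card (?O \<union> ?I) + card (?O \<inter> ?I)"
    using finA by (intro card_Un_Int) auto
  moreover have "card (?O \<inter> ?I) \<le> card U * (card U - 1)"
  proof -
    have "?O \<inter> ?I \<subseteq> (SIGMA u:U. U - {u})" using A by (auto simp: digr_def)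
    then have "card (?O \<inter> ?I) \<le> card (SIGMA u:U. U - {u})" using U by (intro card_mono) auto
    also have "\<dots> = (\<Sum>u\<in>U. card (U - {u}))" using U by simp
    also have "\<dots> = card U * (card U - 1)" using U by simp
    finally show ?thesis .
  qed
  ultimately show "(\<Sum>u\<in>U. deg A u) \<le> card (touch A U) + card U * (card U - 1)" using s unfolding u by linarith
  have "card ?O \<le> card (touch A U)" "card ?I \<le> card (touch A U)"
    using finA by (auto simp: touch_def intro!: card_mono)
  then show "(\<Sum>u\<in>U. deg A u) \<le> 2 * card (touch A U)" using s by linarith
qed

text \<open>Greedy choice: each chosen vertex excludes at most itself and three neighbours.\<close>

lemma independent_low_degree:
  assumes B: "digr W B" and big: "card {y\<in>W. deg B y \<le> 3} \<ge> 4 * k"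
  shows "\<exists>P\<subseteq>W. card P = k \<and> (\<forall>p\<in>P. deg B p \<le> 3) \<and> (\<forall>p\<in>P. nbr B p \<inter> P = {})"
  using big
proof (induction k)
  case 0
  then show ?case by (intro exI[of _ "{}"]) auto
next
  case (Suc k)
  then obtain P where P: "P \<subseteq> W" "card P = k" "\<forall>p\<in>P. deg B p \<le> 3" "\<forall>p\<in>P. nbr B p \<inter> P = {}" by auto
  note finB = digr_finite(2)[OF B]
  have finP: "finite P" using P(1) digr_finite(1)[OF B] finite_subset by auto
  let ?F = "P \<union> (\<Union>p\<in>P. nbr B p)"
  have "card (\<Union>p\<in>P. nbr B p) \<le> (\<Sum>p\<in>P. card (nbr B p))" using finP by (rule card_UN_le)
  also have "\<dots> \<le> (\<Sum>p\<in>P. 3)"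
    using P(3) card_nbr_le_deg[OF finB] by (intro sum_mono) (meson le_trans)
  finally have "card ?F \<le> 4 * k" using card_Un_le[of P "\<Union>p\<in>P. nbr B p"] P(2) by simp
  also have "\<dots> < card {y\<in>W. deg B y \<le> 3}" using Suc.prems by simp
  finally have lt: "card ?F < card {y\<in>W. deg B y \<le> 3}" .
  have "finite ?F" using finP finite_nbr[OF finB] by auto
  then obtain p where p: "p \<in> {y\<in>W. deg B y \<le> 3}" "p \<notin> ?F" using lt by (rule obtain_outside)
  have sym: "r \<in> nbr B s \<longleftrightarrow> s \<in> nbr B r" for r s by (auto simp: nbr_def)
  have "p \<notin> nbr B p" using B by (auto simp: nbr_def digr_def)
  then have "\<forall>r\<in>insert p P. nbr B r \<inter> insert p P = {}"
    using P(4) p(2) sym by blast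
  moreover have "card (insert p P) = Suc k" using finP P(2) p(2) by simp
  ultimately show ?case using P p by (intro exI[of _ "insert p P"]) auto
qed

lemma many_low_degree:
  assumes B: "digr W B" and b: "2 * card B + 4 * k \<le> 4 * card W"
  shows "card {y\<in>W. deg B y \<le> 3} \<ge> k"
proof -
  note fin = digr_finite(1)[OF B]
  let ?L = "{y\<in>W. deg B y \<le> 3}" and ?H = "{y\<in>W. \<not> deg B y \<le> 3}"
  have "card (?L \<union> ?H) = card ?L + card ?H" using fin by (intro card_Un_disjoint) auto
  moreover have "?L \<union> ?H = W" by auto
  moreover have "(\<Sum>y\<in>?H. 4) \<le> (\<Sum>y\<in>?H. deg B y)" by (intro sum_mono) auto
  moreover have "(\<Sum>y\<in>?H. deg B y) \<le> (\<Sum>y\<in>W. deg B y)" using fin by (intro sum_mono2) auto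
  ultimately show ?thesis using b sum_deg[OF B] by simp
qed

text \<open>Of at least 92 disjoint classes at most 4 meet \<open>U\<close>, and at most 70 have
  more than \<open>card V / 71\<close> vertices, as 71 such classes would not fit into
  \<open>V\<close>.\<close>

lemma small_treelike_classes:
  assumes A: "digr V A" and \<mu>: "card A + 92 \<le> card V" and U: "finite U" "card U \<le> 4"
  obtains \<D> where "finite \<D>" "card \<D> \<ge> 18" "pairwise disjnt \<D>"
    "\<And>C. C \<in> \<D> \<Longrightarrow> treelike V A C \<and> card C = card (arcs_at A C) + 1 \<and> C \<inter> U = {} \<and> 71 * card C \<le> card V"
proof -
  note finV = digr_finite(1)[OF A]
  have AV: "A \<subseteq> V \<times> V" using A by (simp add: digr_def)
  obtain \<C> where \<C>: "finite \<C>" "\<And>C. C \<in> \<C> \<Longrightarrow> treelike V A C \<and> card C = card (arcs_at A C) + 1"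
    "pairwise disjnt \<C>" "card V \<le> card A + card \<C>"
    using many_treelike[OF finV AV] by blast
  have sub: "C \<subseteq> V" if "C \<in> \<C>" for C using \<C>(2)[OF that] by (simp add: treelike_def)
  let ?M = "{C\<in>\<C>. C \<inter> U \<noteq> {}}" and ?L = "{C\<in>\<C>. \<not> 71 * card C \<le> card V}"
  define \<D> where "\<D> = {C\<in>\<C>. C \<inter> U = {} \<and> 71 * card C \<le> card V}"
  have "card ?M \<le> card U"
  proof -
    define s where "s C = (SOME u. u \<in> C \<inter> U)" for C
    have s: "s C \<in> C \<inter> U" if "C \<in> ?M" for C
      using that some_in_eq[of "C \<inter> U"] unfolding s_def by blast
    have "inj_on s ?M"
    proof (rule inj_onI)
      fix C D assume CD: "C \<in> ?M" "D \<in> ?M" "s C = s D"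
      then have "\<not> disjnt C D" using s[of C] s[of D] by (auto simp: disjnt_def)
      then show "C = D" using CD \<C>(3) by (auto simp: pairwise_def)
    qed
    moreover have "s ` ?M \<subseteq> U" using s by auto
    ultimately show ?thesis using U(1) by (rule card_inj_on_le)
  qed
  moreover have "card ?L \<le> 70"
  proof (rule ccontr)
    assume "\<not> ?thesis"
    then have "71 * (card V + 1) \<le> card ?L * (card V + 1)" by (intro mult_right_mono) auto
    also have "\<dots> = (\<Sum>C\<in>?L. card V + 1)" by simp
    also have "\<dots> \<le> (\<Sum>C\<in>?L. 71 * card C)" by (intro sum_mono) auto
    also have "\<dots> = 71 * (\<Sum>C\<in>?L. card C)" by (rule sum_distrib_left[symmetric])
    also have "(\<Sum>C\<in>?L. card C) = card (\<Union>?L)"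
    proof (rule card_Union_disjoint[symmetric])
      show "pairwise disjnt ?L" using \<C>(3) by (rule pairwise_subset) auto
      show "finite C" if "C \<in> ?L" for C using finite_subset[OF sub finV] that by blast
    qed
    also have "\<dots> \<le> card V" using sub by (intro card_mono finV) blast
    finally show False by simp
  qed
  moreover have "card \<C> \<le> card ?M + card ?L + card \<D>"
  proof -
    have eq: "?M \<union> ?L \<union> \<D> = \<C>" unfolding \<D>_def by blast
    have "card \<C> \<le> card (?M \<union> ?L) + card \<D>" using card_Un_le[of "?M \<union> ?L" \<D>] unfolding eq .
    then show ?thesis using card_Un_le[of ?M ?L] by linarith
  qed
  ultimately have c18: "card \<D> \<ge> 18" using \<C>(4) \<mu> U(2) by linarith
  have "pairwise disjnt \<D>" using \<C>(3) by (rule pairwise_subset) (auto simp: \<D>_def)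
  moreover have "finite \<D>" using \<C>(1) by (simp add: \<D>_def)
  moreover have "treelike V A C \<and> card C = card (arcs_at A C) + 1 \<and> C \<inter> U = {} \<and> 71 * card C \<le> card V"
    if "C \<in> \<D>" for C
    using \<C>(2)[of C] that unfolding \<D>_def by blast
  ultimately show thesis using c18 by (intro that)
qed

text \<open>The number of forbidden pairs that arise from placing \<open>w\<close> on \<open>y\<close>.\<close>

definition cost :: "('a \<times> 'a) set \<Rightarrow> ('b \<times> 'b) set \<Rightarrow> 'a \<Rightarrow> 'b \<Rightarrow> nat" where
  "cost A B w y = card {a\<in>A. fst a = w} * card {b\<in>B. fst b = y} + card {a\<in>A. snd a = w} * card {b\<in>B. snd b = y}"

text \<open>Summed over all hosts, every arc of \<open>B\<close> is counted once by its tail, with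
  the out-degree of \<open>w\<close>, and once by its head, with the in-degree. The total is at most
  \<open>deg A w * card B\<close>, and some host is not above average.\<close>

lemma exists_cheap_host:
  assumes A: "digr V A" and B: "digr W B" and Y: "Y \<subseteq> W" "Y \<noteq> {}"
  shows "\<exists>y\<in>Y. cost A B w y * card Y \<le> deg A w * card B"
proof (rule ccontr)
  assume "\<not> ?thesis"
  then have lt: "deg A w * card B < cost A B w y * card Y" if "y \<in> Y" for y using that by (simp add: not_le)
  note finW = digr_finite(1)[OF B] and finB = digr_finite(2)[OF B]
  have finY: "finite Y" using Y finW finite_subset by auto
  have le: "(\<Sum>y\<in>Y. card {b\<in>B. g b = y}) \<le> card B" for g :: "'b \<times> 'b \<Rightarrow> 'b"
  proof -
    have "(\<Sum>y\<in>Y. card {b\<in>B. g b = y}) = card (\<Union>y\<in>Y. {b\<in>B. g b = y})"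
      using finY finB by (intro card_UN_disjoint[symmetric]) auto
    also have "\<dots> \<le> card B" using finB by (intro card_mono) auto
    finally show ?thesis .
  qed
  have "(\<Sum>y\<in>Y. cost A B w y) = card {a\<in>A. fst a = w} * (\<Sum>y\<in>Y. card {b\<in>B. fst b = y})
     + card {a\<in>A. snd a = w} * (\<Sum>y\<in>Y. card {b\<in>B. snd b = y})"
    by (simp add: cost_def sum.distrib sum_distrib_left)
  also have "\<dots> \<le> card {a\<in>A. fst a = w} * card B + card {a\<in>A. snd a = w} * card B"
    by (intro add_mono mult_left_mono le) auto
  also have "\<dots> = deg A w * card B" by (simp add: deg_eq_out_in[OF A] algebra_simps)
  finally have s: "(\<Sum>y\<in>Y. cost A B w y) \<le> deg A w * card B" .
  have "(\<Sum>y\<in>Y. deg A w * card B) < (\<Sum>y\<in>Y. cost A B w y * card Y)"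
    using finY Y(2) lt by (intro sum_strict_mono) auto
  also have "\<dots> = (\<Sum>y\<in>Y. cost A B w y) * card Y" by (simp add: sum_distrib_right)
  also have "\<dots> \<le> deg A w * card B * card Y" using s by (rule mult_right_mono) simp
  finally show False by (simp add: mult.commute)
qed

text \<open>Averaging over the admissible hosts makes placing \<open>w x\<close> almost free: the forbidden pairs cost about
  as much as the arcs at \<open>w x\<close> would have contributed to the expected number of conflicts.\<close>

lemma choose_hosts:
  assumes A: "digr V A" and B: "digr W B" and B0: "digr (W - R) B\<^sub>0" and X: "finite X" "card X \<le> k"
    and pos: "\<And>x. x \<in> X \<Longrightarrow> deg B x + k \<le> card (W - R)"
  shows "\<exists>y. inj_on y X \<and> (\<forall>x\<in>X. y x \<in> W - R \<and> y x \<notin> nbr B x \<and>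
    cost A B\<^sub>0 (w x) (y x) * (card (W - R) + 1 - k - deg B x) \<le> deg A (w x) * card B\<^sub>0)"
  using X pos
proof (induction X rule: finite_induct)
  case empty
  then show ?case by simp
next
  case (insert x X)
  then obtain y where y: "inj_on y X" and y': "\<forall>x\<in>X. y x \<in> W - R \<and> y x \<notin> nbr B x \<and>
    cost A B\<^sub>0 (w x) (y x) * (card (W - R) + 1 - k - deg B x) \<le> deg A (w x) * card B\<^sub>0" by auto
  note finW = digr_finite(1)[OF B] and finB = digr_finite(2)[OF B]
  let ?Y = "W - R - nbr B x - y ` X"
  have finN: "finite (nbr B x)" using finB by (rule finite_nbr)
  have "card (W - R) - card (nbr B x) \<le> card (W - R - nbr B x)" using finN by (rule diff_card_le_card_Diff)
  moreover have "card (W - R - nbr B x) - card (y ` X) \<le> card ?Y"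
    using insert.hyps by (intro diff_card_le_card_Diff) simp
  moreover have "card (y ` X) \<le> card X" using insert.hyps by (intro card_image_le)
  moreover have "card X + 1 \<le> k" using insert by simp
  moreover have "card (nbr B x) \<le> deg B x" by (rule card_nbr_le_deg[OF finB])
  moreover have "deg B x + k \<le> card (W - R)" using insert.prems by simp
  ultimately have cY: "card (W - R) + 1 - k - deg B x \<le> card ?Y" and Y0: "card ?Y > 0" by linarith+
  have "?Y \<noteq> {}" using Y0 by (metis card.empty less_numeral_extra(3))
  then obtain z where z: "z \<in> ?Y" "cost A B\<^sub>0 (w x) z * card ?Y \<le> deg A (w x) * card B\<^sub>0"
    using exists_cheap_host[OF A B0, of ?Y "w x"] by blast
  have c: "cost A B\<^sub>0 (w x) z * (card (W - R) + 1 - k - deg B x) \<le> deg A (w x) * card B\<^sub>0"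
    using z(2) mult_le_mono2[OF cY, of "cost A B\<^sub>0 (w x) z"] by linarith
  have "\<exists>y1. y1 x = z \<and> (\<forall>r\<in>X. y1 r = y r)"
    using insert.hyps by (intro exI[of _ "y(x := z)"]) auto
  then obtain y1 where y1: "y1 x = z" "\<And>r. r \<in> X \<Longrightarrow> y1 r = y r" by auto
  have "inj_on y1 (insert x X)"
    using y z(1) insert.hyps by (auto simp: inj_on_def y1)
  then show ?case
    using y' z(1) c y1 by (intro exI[of _ y1] conjI ballI) auto
qed

text \<open>\<open>U\<close> goes to \<open>P\<close> by \<open>\<pi>\<close>. Each
  \<open>x \<in> X\<close> hosts a vertex \<open>v x\<close> of its own component
  \<open>C x\<close>, and the neighbour \<open>w x\<close> of \<open>v x\<close>, if any, goes to
  \<open>y x\<close>. Thus the neighbourhoods of \<open>P\<close> and of the vertices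
  \<open>v x\<close> are used up, and only the \<open>w x\<close> forbid anything.\<close>

lemma lpack_moderate_degree:
  fixes V :: "'a set" and W :: "'b set"
  assumes A: "digr V A" and B: "digr W B" and n: "card V = n" "card W = n"
    and \<mu>: "\<mu> \<ge> 92" "n \<ge> 31 * \<mu>" "card A + \<mu> \<le> n" and b: "card B + n div \<mu> + 1 \<le> 2 * n"
    and max: "\<And>x. x \<in> W \<Longrightarrow> 100 * deg B x \<le> 51 * n"
  shows "lpack V A W B {}"
proof -
  note finV = digr_finite(1)[OF A] and finA = digr_finite(2)[OF A]
  note finW = digr_finite(1)[OF B] and finB = digr_finite(2)[OF B]
  have q31: "n div \<mu> \<ge> 31" using \<mu> div_le_mono[of "31 * \<mu>" n \<mu>] by simp
  obtain U \<delta>\<^sub>1 where U: "U \<subseteq> V" "card U \<le> 4" "\<forall>v\<in>V - U. deg A v \<le> \<delta>\<^sub>1"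
    "\<forall>u\<in>U. \<delta>\<^sub>1 \<le> deg A u \<and> 19 < deg A u" "19 \<le> \<delta>\<^sub>1" "card U = 4 \<or> \<delta>\<^sub>1 = 19"
    using top_vertices[OF finV, of 4 "deg A" 19] by blast
  obtain T \<delta>\<^sub>2 where T: "T \<subseteq> W" "card T \<le> 6" "\<forall>v\<in>W - T. deg B v \<le> \<delta>\<^sub>2"
    "\<forall>u\<in>T. \<delta>\<^sub>2 \<le> deg B u \<and> 23 < deg B u" "23 \<le> \<delta>\<^sub>2" "card T = 6 \<or> \<delta>\<^sub>2 = 23"
    using top_vertices[OF finW, of 6 "deg B" 23] by blast
  have finU: "finite U" and finT: "finite T" using U(1) T(1) finV finW finite_subset by auto
  \<comment> \<open>From \<open>n div \<mu> >= 31\<close> there are at most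
    \<open>2 * n - 32\<close> arcs, which gives 16 vertices of degree at most 3, four for each of
    the up to 4 independent hosts.\<close>
  have low: "card {y\<in>W. deg B y \<le> 3} \<ge> 16"
    using b q31 n by (intro many_low_degree[OF B]) linarith
  have "card {y\<in>W. deg B y \<le> 3} \<ge> 4 * card U" using low U(2) by linarith
  from independent_low_degree[OF B this]
  obtain P where P: "P \<subseteq> W" "card P = card U" "\<forall>p\<in>P. deg B p \<le> 3" "\<forall>p\<in>P. nbr B p \<inter> P = {}" by blast
  have finP: "finite P" using P(1) finW finite_subset by auto
  obtain \<pi> where \<pi>: "bij_betw \<pi> U P" using finite_same_card_bij[OF finU finP] P(2) by auto
  have TP: "T \<inter> P = {}" using T(4) P(3) by force
  \<comment> \<open>The neighbours of \<open>P\<close> are occupied along with \<open>T\<close>, so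
    that the arcs at \<open>U\<close>, possibly very many, create no forbidden pairs.\<close>
  define X where "X = T \<union> (\<Union>p\<in>P. nbr B p)"
  have nbrW: "nbr B p \<subseteq> W" for p using B by (auto simp: nbr_def digr_def)
  have XW: "X \<subseteq> W" using T(1) nbrW by (auto simp: X_def)
  have finX: "finite X" using XW finW finite_subset by auto
  have XP: "X \<inter> P = {}" using TP P(4) by (auto simp: X_def)
  have cX: "card X \<le> card T + 3 * card U"
  proof -
    have "card (\<Union>p\<in>P. nbr B p) \<le> (\<Sum>p\<in>P. card (nbr B p))" using finP by (rule card_UN_le)
    also have "\<dots> \<le> (\<Sum>p\<in>P. 3)"
      using P(3) card_nbr_le_deg[OF finB] by (intro sum_mono) (meson le_trans)
    finally show ?thesis unfolding X_def
      using card_Un_le[of T "\<Union>p\<in>P. nbr B p"] P(2) by simp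
  qed
  have A92: "card A + 92 \<le> card V" using \<mu> n by linarith
  obtain \<D> where \<D>: "finite \<D>" "card \<D> \<ge> 18" "pairwise disjnt \<D>"
    and \<D>': "\<And>C. C \<in> \<D> \<Longrightarrow> treelike V A C \<and> card C = card (arcs_at A C) + 1 \<and> C \<inter> U = {} \<and> 71 * card C \<le> card V"
    using small_treelike_classes[OF A A92 finU U(2)] by blast
  have "card X \<le> card \<D>" using cX \<D>(2) T(2) U(2) by linarith
  then obtain C where C: "inj_on C X" "C ` X \<subseteq> \<D>" using obtain_injection[OF finX \<D>(1)] by metis
  have CD: "treelike V A (C x)" "card (C x) = card (arcs_at A (C x)) + 1" "C x \<inter> U = {}" "71 * card (C x) \<le> n"
    if "x \<in> X" for x using \<D>'[of "C x"] C(2) that n by auto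
  have Cdisj: "x = x'" if "x \<in> X" "x' \<in> X" "s \<in> C x" "s \<in> C x'" for x x' s
  proof (rule ccontr)
    assume "x \<noteq> x'"
    then have "C x \<noteq> C x'" using C(1) that(1,2) by (auto simp: inj_on_def)
    then have "disjnt (C x) (C x')" using \<D>(3) C(2) that(1,2) by (auto simp: pairwise_def)
    then show False using that(3,4) by (auto simp: disjnt_def)
  qed
  have Ccl: "closed_in A (C x)" and CV: "C x \<subseteq> V" if "x \<in> X" for x
    using CD(1)[OF that] by (auto simp: treelike_def)
  have Cnbr: "s \<in> C x" if "x \<in> X" "r \<in> C x" "s \<in> nbr A r" for x r s
    using Ccl[OF that(1)] that(2,3) by (force simp: nbr_def closed_in_def)
  have "\<forall>x\<in>X. \<exists>v\<in>C x. deg A v \<le> 1" using treelike_leaf[OF A] CD(1) by blast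
  then obtain v where v: "\<And>x. x \<in> X \<Longrightarrow> v x \<in> C x" "\<And>x. x \<in> X \<Longrightarrow> deg A (v x) \<le> 1" by metis
  \<comment> \<open>An isolated \<open>v x\<close> restricts nothing; only for
    \<open>x \<in> X1\<close> is there a neighbour to place.\<close>
  define X1 where "X1 = {x\<in>X. nbr A (v x) \<noteq> {}}"
  have X1X: "X1 \<subseteq> X" by (auto simp: X1_def)
  have finX1: "finite X1" using finX by (simp add: X1_def)
  have cX1: "card X1 \<le> card X" using finX X1X by (rule card_mono)
  have "\<exists>w. nbr A (v x) = {w}" if "x \<in> X1" for x
  proof -
    have "card (nbr A (v x)) \<le> 1"
      using card_nbr_le_deg[OF finA, of "v x"] v(2)[of x] that X1X by force
    moreover have "nbr A (v x) \<noteq> {}" using that by (simp add: X1_def)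
    ultimately show ?thesis using finite_nbr[OF finA, of "v x"]
      by (metis card_1_singletonE card_0_eq le_less less_one)
  qed
  then obtain w where w: "\<And>x. x \<in> X1 \<Longrightarrow> nbr A (v x) = {w x}" by metis
  have wC: "w x \<in> C x" if "x \<in> X1" for x
    using Cnbr[of x "v x" "w x"] w[OF that] v(1)[of x] that X1X by auto
  have wv: "w x \<noteq> v x" if "x \<in> X1" for x
  proof -
    have "v x \<notin> nbr A (v x)" using A by (auto simp: nbr_def digr_def)
    then show ?thesis using w[OF that] by auto
  qed
  define R where "R = P \<union> X"
  have RW: "R \<subseteq> W" and finR: "finite R" using P(1) XW finP finX by (auto simp: R_def)
  have cR: "card R = card U + card X" using finP finX XP P(2) unfolding R_def
    by (subst card_Un_disjoint) auto
  have cWR: "card (W - R) = n - card U - card X"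
    using RW finR n cR by (simp add: card_Diff_subset)
  define B\<^sub>0 where "B\<^sub>0 = B \<inter> (W - R) \<times> (W - R)"
  have B0: "digr (W - R) B\<^sub>0" using B by (auto simp: digr_def B\<^sub>0_def)
  have n2852: "n \<ge> 2852" using \<mu> by linarith
  have size: "card X \<le> 18" "card U \<le> 4" "card X1 \<le> 18" using cX cX1 T(2) U(2) by linarith+
  have "deg B x + card X1 \<le> card (W - R)" if "x \<in> X1" for x
  proof -
    have "x \<in> W" using that X1X XW by auto
    from max[OF this] show ?thesis using size n2852 unfolding cWR by linarith
  qed
  from choose_hosts[OF A B B0 finX1 order_refl this, of w]
  obtain y where y: "inj_on y X1" and y': "\<forall>x\<in>X1. y x \<in> W - R \<and> y x \<notin> nbr B x \<and>
    cost A B\<^sub>0 (w x) (y x) * (card (W - R) + 1 - card X1 - deg B x) \<le> deg A (w x) * card B\<^sub>0" by blast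
  define S where "S = U \<union> v ` X \<union> w ` X1"
  define cls where "cls s = (SOME x. x \<in> X \<and> s \<in> C x)" for s
  have cls: "cls s = x" if "x \<in> X" "s \<in> C x" for s x
    unfolding cls_def using that Cdisj by (intro some_equality) auto
  define g where "g s = (if s \<in> U then \<pi> s else if s = v (cls s) then cls s else y (cls s))" for s
  have gU: "g u = \<pi> u" if "u \<in> U" for u using that by (simp add: g_def)
  have gv: "g (v x) = x" if "x \<in> X" for x
    using cls[OF that v(1)[OF that]] v(1)[OF that] CD(3)[OF that] by (auto simp: g_def)
  have gw: "g (w x) = y x" if "x \<in> X1" for x
    using cls[of x "w x"] wC[OF that] wv[OF that] CD(3)[of x] that X1X by (auto simp: g_def)
  have SC: "s \<in> U \<or> (\<exists>x\<in>X. s = v x) \<or> (\<exists>x\<in>X1. s = w x)" if "s \<in> S" for s using that by (auto simp: S_def)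
  have SC': "\<exists>x\<in>X. s \<in> C x \<and> (s = v x \<or> x \<in> X1 \<and> s = w x)" if s: "s \<in> S" "s \<notin> U" for s
  proof -
    from SC[OF s(1)] s(2) consider x where "x \<in> X" "s = v x" | x where "x \<in> X1" "s = w x" by blast
    then show ?thesis
    proof cases
      case 1
      then show ?thesis using v(1) by (intro bexI[of _ x]) auto
    next
      case 2
      then show ?thesis using wC X1X by (intro bexI[of _ x]) auto
    qed
  qed
  have SV: "S \<subseteq> V"
  proof
    fix s assume s: "s \<in> S"
    show "s \<in> V"
    proof (cases "s \<in> U")
      case False
      then obtain x where "x \<in> X" "s \<in> C x" using SC'[OF s] by blast
      then show ?thesis using CV by auto
    qed (use U(1) in auto)
  qed
  have gi: "g ` U = P" "g ` v ` X = X" "g ` w ` X1 = y ` X1"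
  proof -
    have "g ` U = \<pi> ` U" using gU by (intro image_cong) auto
    then show "g ` U = P" using \<pi> by (simp add: bij_betw_def)
    have "(\<lambda>x. g (v x)) ` X = (\<lambda>x. x) ` X" using gv by (intro image_cong) auto
    then show "g ` v ` X = X" by (simp add: image_image)
    show "g ` w ` X1 = y ` X1" unfolding image_image using gw by (intro image_cong) auto
  qed
  have gS: "g ` S = P \<union> X \<union> y ` X1"
    unfolding S_def image_Un gi ..
  have yR: "y x \<notin> P" "y x \<notin> X" "y x \<in> W" if "x \<in> X1" for x using y' that by (auto simp: R_def)
  have yy: "(P \<union> X) \<inter> y ` X1 = {}" using yR by auto
  have injg: "inj_on g S"
  proof -
    have 1: "inj_on g U" using \<pi> gU by (simp add: bij_betw_def inj_on_def)
    have 2: "inj_on g (v ` X)"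
    proof (rule inj_onI)
      fix r s assume "r \<in> v ` X" "s \<in> v ` X" "g r = g s"
      then show "r = s" using gv by auto
    qed
    have 3: "inj_on g (w ` X1)"
    proof (rule inj_onI)
      fix r s assume "r \<in> w ` X1" "s \<in> w ` X1" "g r = g s"
      then obtain x x' where x: "x \<in> X1" "x' \<in> X1" "r = w x" "s = w x'" "y x = y x'" using gw by auto
      then show "r = s" using inj_onD[OF y, of x x'] by simp
    qed
    have un: "inj_on g (K \<union> K')" if "inj_on g K" "inj_on g K'" "g ` K \<inter> g ` K' = {}" for K K'
      unfolding inj_on_Un using that by blast
    have "inj_on g (U \<union> v ` X)"
      by (rule un[OF 1 2]) (use gi XP in auto)
    then show ?thesis
      unfolding S_def by (rule un[OF _ 3]) (simp only: image_Un gi yy)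
  qed
  have gSW: "g ` S \<subseteq> W" unfolding gS using P(1) XW yR(3) by (intro Un_least image_subsetI)
  have okS: "(g p, g q) \<notin> B" if pq: "p \<in> S" "q \<in> S" "(p, q) \<in> A" for p q
  proof (cases "p \<in> U \<or> q \<in> U")
    case True
    \<comment> \<open>Placed vertices outside \<open>U\<close> lie in components that miss
      \<open>U\<close>, so no arc joins the two kinds.\<close>
    have "p \<in> U \<longleftrightarrow> q \<in> U"
    proof -
      have nU: "s \<in> U" if rs: "r \<in> U" "s \<in> S" "s \<in> nbr A r" for r s
      proof (rule ccontr)
        assume "s \<notin> U"
        then obtain x where x: "x \<in> X" "s \<in> C x" using SC'[OF rs(2)] by blast
        have "r \<in> C x" using Cnbr[OF x, of r] rs(3) by (auto simp: nbr_def)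
        then show False using CD(3)[OF x(1)] rs(1) by auto
      qed
      have "q \<in> nbr A p" "p \<in> nbr A q" using pq(3) by (auto simp: nbr_def)
      then show ?thesis using nU[OF _ pq(2)] nU[OF _ pq(1)] by blast
    qed
    then have "p \<in> U" "q \<in> U" using True by auto
    then have "\<pi> p \<in> P" "\<pi> q \<in> P" using \<pi> by (auto simp: bij_betw_def)
    then have "\<pi> q \<notin> nbr B (\<pi> p)" using P(4) by blast
    then show ?thesis using gU \<open>p \<in> U\<close> \<open>q \<in> U\<close> by (simp add: nbr_def)
  next
    case False
    then obtain x where x: "x \<in> X" "p \<in> C x" using SC'[OF pq(1)] by blast
    have qC: "q \<in> C x" using Cnbr[OF x, of q] pq(3) by (auto simp: nbr_def)
    have *: "s = v x \<or> x \<in> X1 \<and> s = w x" if s: "s \<in> S" "s \<notin> U" "s \<in> C x" for s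
    proof -
      obtain x' where x': "x' \<in> X" "s \<in> C x'" "s = v x' \<or> x' \<in> X1 \<and> s = w x'" using SC'[OF s(1,2)] by blast
      have "x' = x" using Cdisj[OF x'(1) x(1) x'(2) s(3)] .
      then show ?thesis using x'(3) by simp
    qed
    have "p \<noteq> q" using A pq(3) by (auto simp: digr_def)
    then have x1: "x \<in> X1" and or: "p = v x \<and> q = w x \<or> p = w x \<and> q = v x"
      using *[OF pq(1) _ x(2)] *[OF pq(2) _ qC] False by auto
    have "y x \<notin> nbr B x" using y' x1 by blast
    then show ?thesis using or gv[OF x(1)] gw[OF x1] by (auto simp: nbr_def)
  qed
  define F where "F = blocked V A W B S g"
  have Fw: "\<exists>x\<in>X1. (w x, s) \<in> A \<and> (y x, t) \<in> B \<or> (s, w x) \<in> A \<and> (t, y x) \<in> B" if st: "(s, t) \<in> F" for s t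
  proof -
    obtain p where p: "p \<in> S" "(p, s) \<in> A \<and> (g p, t) \<in> B \<or> (s, p) \<in> A \<and> (t, g p) \<in> B"
      and s: "s \<notin> S" and t: "t \<notin> g ` S" using st by (auto simp: F_def blocked_def)
    have tn: "t \<in> nbr B (g p)" and sn: "s \<in> nbr A p" using p(2) by (auto simp: nbr_def)
    have "p \<notin> U"
    proof
      assume "p \<in> U"
      then have "g p \<in> P" using \<pi> gU by (auto simp: bij_betw_def)
      then have "t \<in> X" using tn by (auto simp: X_def)
      then show False using t gS by auto
    qed
    moreover have "p \<noteq> v x" if "x \<in> X" for x
    proof
      assume "p = v x"
      then have "x \<in> X1" using sn that by (auto simp: X1_def)
      then have "s = w x" using w[OF \<open>x \<in> X1\<close>] sn \<open>p = v x\<close> by simp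
      then show False using s \<open>x \<in> X1\<close> by (simp add: S_def)
    qed
    ultimately obtain x where x: "x \<in> X1" "p = w x" using SC[OF p(1)] by blast
    show ?thesis using p(2) unfolding x(2) gw[OF x(1)] by (intro bexI[OF _ x(1)])
  qed
  have FVW: "F \<subseteq> (V - S) \<times> (W - g ` S)" by (auto simp: F_def blocked_def)
  have incC: "fst a \<in> C x" "snd a \<in> C x" if "x \<in> X1" "a \<in> inc A (w x)" for x a
  proof -
    have a: "a \<in> A" "fst a = w x \<or> snd a = w x" using that(2) by (auto simp: inc_def)
    have "closed_in A (C x)" using that(1) X1X by (intro Ccl) auto
    then have "fst a \<in> C x \<longleftrightarrow> snd a \<in> C x" using a(1) unfolding closed_in_def by blast
    then show "fst a \<in> C x" "snd a \<in> C x" using a(2) wC[OF that(1)] by auto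
  qed
  have dw: "deg A (w x) + 1 \<le> card (C x)" if "x \<in> X1" for x
  proof -
    have "x \<in> X" using that X1X by auto
    have "inc A (w x) \<subseteq> arcs_at A (C x)"
      using incC(1)[OF that] by (auto simp: arcs_at_def inc_def)
    then have "deg A (w x) \<le> card (arcs_at A (C x))"
      unfolding deg_def using finA by (intro card_mono) (auto simp: arcs_at_def)
    then show ?thesis using CD(2)[OF \<open>x \<in> X\<close>] by simp
  qed
  have dw71: "71 * deg A (w x) \<le> n" if "x \<in> X1" for x
  proof -
    have "x \<in> X" using that X1X by auto
    then show ?thesis using dw[OF that] CD(4)[of x] by linarith
  qed
  have cF: "card F \<le> (\<Sum>x\<in>X1. cost A B\<^sub>0 (w x) (y x))"
  proof -
    define G where "G x = snd ` {a\<in>A. fst a = w x} \<times> snd ` {b\<in>B\<^sub>0. fst b = y x}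
       \<union> fst ` {a\<in>A. snd a = w x} \<times> fst ` {b\<in>B\<^sub>0. snd b = y x}" for x
    have finG: "finite (G x)" for x using finA digr_finite(2)[OF B0] by (simp add: G_def)
    have "F \<subseteq> (\<Union>x\<in>X1. G x)"
    proof
      fix j assume j: "j \<in> F"
      obtain s t where st: "j = (s, t)" by (cases j)
      obtain x where x: "x \<in> X1" "(w x, s) \<in> A \<and> (y x, t) \<in> B \<or> (s, w x) \<in> A \<and> (t, y x) \<in> B"
        using Fw[of s t] j st by blast
      have "t \<in> W - g ` S" using j FVW st by auto
      then have tR: "t \<in> W - R" using gS by (auto simp: R_def)
      have yW: "y x \<in> W - R" using y' x(1) by auto
      have "j \<in> G x"
        using x(2)
      proof
        assume h: "(w x, s) \<in> A \<and> (y x, t) \<in> B"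
        then have "(y x, t) \<in> {b\<in>B\<^sub>0. fst b = y x}" "(w x, s) \<in> {a\<in>A. fst a = w x}"
          using tR yW by (auto simp: B\<^sub>0_def)
        from imageI[OF this(1), of snd] imageI[OF this(2), of snd]
        have "t \<in> snd ` {b\<in>B\<^sub>0. fst b = y x}" "s \<in> snd ` {a\<in>A. fst a = w x}" by simp_all
        then show ?thesis by (simp add: st G_def)
      next
        assume h: "(s, w x) \<in> A \<and> (t, y x) \<in> B"
        then have "(t, y x) \<in> {b\<in>B\<^sub>0. snd b = y x}" "(s, w x) \<in> {a\<in>A. snd a = w x}"
          using tR yW by (auto simp: B\<^sub>0_def)
        from imageI[OF this(1), of fst] imageI[OF this(2), of fst]
        have "t \<in> fst ` {b\<in>B\<^sub>0. snd b = y x}" "s \<in> fst ` {a\<in>A. snd a = w x}" by simp_all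
        then show ?thesis by (simp add: st G_def)
      qed
      then show "j \<in> (\<Union>x\<in>X1. G x)" using x(1) by blast
    qed
    then have "card F \<le> card (\<Union>x\<in>X1. G x)" using finX1 finG by (intro card_mono) auto
    also have "\<dots> \<le> (\<Sum>x\<in>X1. card (G x))" using finX1 by (rule card_UN_le)
    also have "\<dots> \<le> (\<Sum>x\<in>X1. cost A B\<^sub>0 (w x) (y x))"
    proof (rule sum_mono)
      fix x
      have fB: "finite B\<^sub>0" using digr_finite(2)[OF B0] .
      show "card (G x) \<le> cost A B\<^sub>0 (w x) (y x)"
        unfolding G_def cost_def
        by (rule order_trans[OF card_Un_le], unfold card_cartesian_product) (intro add_mono mult_mono card_image_le, use finA fB in auto)
    qed
    finally show ?thesis .
  qed
  \<comment> \<open>A vertex lies in at most one \<open>C x\<close>, so a single host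
    \<open>y x\<close> is responsible. It is outside \<open>T\<close>, hence of degree at most
    \<open>\<delta>\<^sub>2\<close>.\<close>
  have F1: "card (F `` {s}) \<le> \<delta>\<^sub>2" for s
  proof (cases "\<exists>x\<in>X1. s \<in> nbr A (w x)")
    case True
    then obtain x where x: "x \<in> X1" "s \<in> nbr A (w x)" by blast
    have sC: "s \<in> C x" using Cnbr[OF _ wC[OF x(1)] x(2)] x(1) X1X by auto
    have "F `` {s} \<subseteq> nbr B (y x)"
    proof
      fix t assume "t \<in> F `` {s}"
      then have "(s, t) \<in> F" by simp
      from Fw[OF this] obtain x' where x': "x' \<in> X1" "(w x', s) \<in> A \<and> (y x', t) \<in> B \<or> (s, w x') \<in> A \<and> (t, y x') \<in> B"
        by blast
      have X: "x \<in> X" "x' \<in> X" using x(1) x'(1) X1X by auto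
      have "s \<in> nbr A (w x')" using x'(2) by (auto simp: nbr_def)
      then have "s \<in> C x'" by (rule Cnbr[OF X(2) wC[OF x'(1)]])
      then have "x' = x" using Cdisj[OF X(2) X(1)] sC by blast
      then show "t \<in> nbr B (y x)" using x'(2) by (auto simp: nbr_def)
    qed
    then have "card (F `` {s}) \<le> card (nbr B (y x))" using finite_nbr[OF finB] by (intro card_mono)
    also have "\<dots> \<le> deg B (y x)" by (rule card_nbr_le_deg[OF finB])
    also have "\<dots> \<le> \<delta>\<^sub>2" using T(3) yR[OF x(1)] by (auto simp: X_def)
    finally show ?thesis .
  next
    case False
    have "F `` {s} = {}"
    proof (rule ccontr)
      assume "F `` {s} \<noteq> {}"
      then obtain t where "(s, t) \<in> F" by auto
      from Fw[OF this] show False using False by (auto simp: nbr_def)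
    qed
    then show ?thesis by simp
  qed
  \<comment> \<open>In this direction all of the at most 18 vertices \<open>w x\<close> may
    contribute, which is why their components had to have at most \<open>n / 71\<close>
    vertices.\<close>
  have F2: "card {s. (s, t) \<in> F} \<le> card X1 * (n div 71)" for t
  proof -
    have "{s. (s, t) \<in> F} \<subseteq> (\<Union>x\<in>X1. nbr A (w x))"
    proof
      fix s assume "s \<in> {s. (s, t) \<in> F}"
      then have "(s, t) \<in> F" by simp
      from Fw[OF this] show "s \<in> (\<Union>x\<in>X1. nbr A (w x))" by (auto simp: nbr_def)
    qed
    then have "card {s. (s, t) \<in> F} \<le> card (\<Union>x\<in>X1. nbr A (w x))"
      using finX1 finite_nbr[OF finA] by (intro card_mono) auto
    also have "\<dots> \<le> (\<Sum>x\<in>X1. card (nbr A (w x)))" using finX1 by (rule card_UN_le)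
    also have "\<dots> \<le> (\<Sum>x\<in>X1. n div 71)"
    proof (rule sum_mono)
      fix x assume "x \<in> X1"
      then have "deg A (w x) \<le> n div 71" using dw71[of x] by (simp add: less_eq_div_iff_mult_less_eq mult.commute)
      then show "card (nbr A (w x)) \<le> n div 71" using card_nbr_le_deg[OF finA, of "w x"] by linarith
    qed
    finally show ?thesis by simp
  qed
  define A' where "A' = A \<inter> (V - S) \<times> (V - S)"
  define B' where "B' = B \<inter> (W - g ` S) \<times> (W - g ` S)"
  have dA': "digr (V - S) A'" and dB': "digr (W - g ` S) B'"
    using A B by (auto simp: digr_def A'_def B'_def)
  have degA': "deg A' s \<le> \<delta>\<^sub>1" if "s \<in> V - S" for s
  proof -
    have "deg A' s \<le> deg A s" unfolding deg_def using finite_inc[OF finA]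
      by (intro card_mono) (auto simp: inc_def A'_def)
    also have "\<dots> \<le> \<delta>\<^sub>1" using U(3) that by (auto simp: S_def)
    finally show ?thesis .
  qed
  have degB': "deg B' t \<le> \<delta>\<^sub>2" if "t \<in> W - g ` S" for t
  proof -
    have "deg B' t \<le> deg B t" unfolding deg_def using finite_inc[OF finB]
      by (intro card_mono) (auto simp: inc_def B'_def)
    also have "\<dots> \<le> \<delta>\<^sub>2" using T(3) that by (auto simp: gS X_def)
    finally show ?thesis .
  qed
  define N where "N = n - (card U + card X + card X1)"
  have cS: "card S = card U + card X + card X1"
  proof -
    have "card S = card (g ` S)" using injg by (simp add: card_image)
    also have "g ` S = R \<union> y ` X1" using gS by (simp add: R_def)
    also have "card \<dots> = card R + card (y ` X1)"
      using finR finX1 yR by (intro card_Un_disjoint) (auto simp: R_def)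
    also have "\<dots> = card U + card X + card X1" using y cR by (simp add: card_image)
    finally show ?thesis .
  qed
  have finS: "finite S" using SV finV finite_subset by auto
  have cV': "card (V - S) = N" using SV finS n cS by (simp add: card_Diff_subset N_def)
  have cW': "card (W - g ` S) = N"
    using gSW finS n cS injg by (simp add: card_Diff_subset N_def card_image)
  have cA': "card A' + card (touch A U) + (\<Sum>x\<in>X1. deg A (w x)) \<le> card A"
  proof -
    have dj: "inc A (w x) \<inter> inc A (w x') = {}" if "x \<in> X1" "x' \<in> X1" "x \<noteq> x'" for x x'
    proof -
      have "a \<notin> inc A (w x')" if a: "a \<in> inc A (w x)" for a
      proof
        assume a': "a \<in> inc A (w x')"
        have "fst a \<in> C x" "fst a \<in> C x'" using incC(1) a a' \<open>x \<in> X1\<close> \<open>x' \<in> X1\<close> by blast+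
        then show False using Cdisj[of x x' "fst a"] \<open>x \<in> X1\<close> \<open>x' \<in> X1\<close> X1X \<open>x \<noteq> x'\<close> by auto
      qed
      then show ?thesis by blast
    qed
    have "card (\<Union>x\<in>X1. inc A (w x)) = (\<Sum>x\<in>X1. deg A (w x))"
      unfolding deg_def using finX1 finite_inc[OF finA] dj by (intro card_UN_disjoint) auto
    moreover have "card (A' \<union> touch A U) = card A' + card (touch A U)"
      using finA by (intro card_Un_disjoint) (auto simp: A'_def touch_def S_def)
    moreover have "card ((A' \<union> touch A U) \<union> (\<Union>x\<in>X1. inc A (w x)))
        = card (A' \<union> touch A U) + card (\<Union>x\<in>X1. inc A (w x))"
    proof (rule card_Un_disjoint)
      show "(A' \<union> touch A U) \<inter> (\<Union>x\<in>X1. inc A (w x)) = {}"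
      proof -
        have "a \<notin> A'" "a \<notin> touch A U" if "x \<in> X1" "a \<in> inc A (w x)" for x a
        proof -
          have "w x \<in> S" using that by (simp add: S_def)
          then show "a \<notin> A'" using that by (auto simp: A'_def inc_def)
          have "x \<in> X" using that(1) X1X by auto
          then show "a \<notin> touch A U" using incC[OF that] CD(3)[of x] by (auto simp: touch_def)
        qed
        then show ?thesis by blast
      qed
    qed (use finA finX1 finite_inc[OF finA] in \<open>auto simp: A'_def touch_def\<close>)
    moreover have "card ((A' \<union> touch A U) \<union> (\<Union>x\<in>X1. inc A (w x))) \<le> card A"
      using finA by (intro card_mono) (auto simp: A'_def touch_def inc_def)
    ultimately show ?thesis by linarith
  qed
  have cB0: "card B\<^sub>0 + card (touch B X) \<le> card B"
  proof -
    have "card (B\<^sub>0 \<union> touch B X) = card B\<^sub>0 + card (touch B X)"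
      using finB by (intro card_Un_disjoint) (auto simp: B\<^sub>0_def touch_def R_def)
    moreover have "card (B\<^sub>0 \<union> touch B X) \<le> card B"
      using finB by (intro card_mono) (auto simp: B\<^sub>0_def touch_def)
    ultimately show ?thesis by linarith
  qed
  have cB': "card B' \<le> card B\<^sub>0"
    using digr_finite(2)[OF B0] by (intro card_mono) (auto simp: B'_def B\<^sub>0_def gS R_def)
  define h where "h = card (touch A U)"
  define e where "e = card (touch B X)"
  \<comment> \<open>For \<open>U\<close>: degree at least 20, less 3 for arcs to the other chosen
    vertices counted twice, and a loss of \<open>4 * 3 = 12\<close> if the budget is exhausted. For
    \<open>T\<close> likewise \<open>24 - 5 = 19\<close> and \<open>6 * 5 = 30\<close>.\<close>
  have h17: "17 * card U \<le> h" and h4: "card U = 4 \<Longrightarrow> 4 * \<delta>\<^sub>1 \<le> h + 12"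
  proof -
    have 1: "card U * (card U - 1) \<le> card U * 3" using U(2) by (intro mult_left_mono) auto
    have "(\<Sum>u\<in>U. 20) \<le> (\<Sum>u\<in>U. deg A u)" using U(4) by (intro sum_mono) auto
    then have 2: "card U * 20 \<le> (\<Sum>u\<in>U. deg A u)" by simp
    have "(\<Sum>u\<in>U. \<delta>\<^sub>1) \<le> (\<Sum>u\<in>U. deg A u)" using U(4) by (intro sum_mono) auto
    then have 3: "card U * \<delta>\<^sub>1 \<le> (\<Sum>u\<in>U. deg A u)" by simp
    show "17 * card U \<le> h" using 1 2 sum_deg_touch(1)[OF A finU] unfolding h_def by linarith
    show "4 * \<delta>\<^sub>1 \<le> h + 12" if "card U = 4"
      using 3 sum_deg_touch(1)[OF A finU] unfolding h_def that by simp
  qed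
  have e19: "19 * card T \<le> e" and e6: "card T = 6 \<Longrightarrow> 6 * \<delta>\<^sub>2 \<le> e + 30"
  proof -
    have 1: "card T * (card T - 1) \<le> card T * 5" using T(2) by (intro mult_left_mono) auto
    have "(\<Sum>u\<in>T. 24) \<le> (\<Sum>u\<in>T. deg B u)" using T(4) by (intro sum_mono) auto
    then have 2: "card T * 24 \<le> (\<Sum>u\<in>T. deg B u)" by simp
    have "(\<Sum>u\<in>T. \<delta>\<^sub>2) \<le> (\<Sum>u\<in>T. deg B u)" using T(4) by (intro sum_mono) auto
    then have 3: "card T * \<delta>\<^sub>2 \<le> (\<Sum>u\<in>T. deg B u)" by simp
    have 4: "card (touch B T) \<le> e"
      unfolding e_def using finB by (intro card_mono) (auto simp: touch_def X_def)
    show "19 * card T \<le> e" using 1 2 4 sum_deg_touch(1)[OF B finT] by linarith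
    show "6 * \<delta>\<^sub>2 \<le> e + 30" if "card T = 6"
      using 3 4 sum_deg_touch(1)[OF B finT] unfolding that by simp
  qed
  have sX: "(\<Sum>x\<in>X1. deg B x) \<le> 2 * e"
  proof -
    have "(\<Sum>x\<in>X1. deg B x) \<le> (\<Sum>x\<in>X. deg B x)" using finX X1X by (intro sum_mono2) auto
    then show ?thesis using sum_deg_touch(2)[OF B finX] unfolding e_def by linarith
  qed
  have N2: "N + 40 \<ge> n" "N \<ge> 2812" using size n2852 unfolding N_def by linarith+
  define dw where "dw = (\<Sum>x\<in>X1. deg A (w x))"
  define bb where "bb = card B\<^sub>0"
  define PP where "PP = (N - 1) * card F + card A' * card B'"
  \<comment> \<open>Averaging divides by \<open>N + 1 - deg B x\<close>, a lower bound on the number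
    of free hosts, instead of \<open>N - 1\<close>. The difference costs at most
    \<open>deg B x\<close> times the cost itself, which is at most \<open>3/100 * bb\<close>:
    \<open>71 * deg A (w x) <= n\<close>, and at least \<open>n / 2.13\<close> hosts are
    free.\<close>
  have per: "(real N - 1) * real (cost A B\<^sub>0 (w x) (y x)) \<le> (real (deg A (w x)) + 3/100 * real (deg B x)) * real bb"
    if x: "x \<in> X1" for x
  proof -
    define c where "c = real (cost A B\<^sub>0 (w x) (y x))"
    define d where "d = real (deg A (w x))"
    define D where "D = real (deg B x)"
    define Q where "Q = real N + 1 - D"
    have xW: "x \<in> W" using x X1X XW by auto
    have D51: "100 * D \<le> 51 * real n" using max[OF xW] unfolding D_def by linarith
    have eq: "card (W - R) + 1 - card X1 - deg B x = N + 1 - deg B x"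
      unfolding cWR N_def using size n2852 by linarith
    have "cost A B\<^sub>0 (w x) (y x) * (card (W - R) + 1 - card X1 - deg B x) \<le> deg A (w x) * card B\<^sub>0"
      using y' x by blast
    then have "cost A B\<^sub>0 (w x) (y x) * (N + 1 - deg B x) \<le> deg A (w x) * bb"
      unfolding eq bb_def .
    then have "real (cost A B\<^sub>0 (w x) (y x) * (N + 1 - deg B x)) \<le> real (deg A (w x) * bb)"
      by (simp only: of_nat_le_iff)
    moreover have "real (N + 1 - deg B x) = Q"
      unfolding Q_def D_def using max[OF xW] N2 n2852 by (subst of_nat_diff) linarith+
    ultimately have cQ: "c * Q \<le> d * real bb" unfolding c_def d_def of_nat_mult by simp
    have rn: "real n \<le> real N + 40" "real n \<ge> 2852" using N2 n2852 by linarith+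
    have Q: "real n \<le> 213/100 * Q" unfolding Q_def using D51 rn by argo
    have Q0: "Q > 0" using Q rn by argo
    have c0: "c \<ge> 0" and D0: "D \<ge> 0" by (simp_all add: c_def D_def)
    have "71 * d \<le> 213/100 * Q" using dw71[OF x] Q unfolding d_def by linarith
    then have "71 * d * real bb \<le> 213/100 * Q * real bb" by (intro mult_right_mono) auto
    then have "71 * (c * Q) \<le> 213/100 * Q * real bb" using cQ by argo
    then have "(71 * c) * Q \<le> (213/100 * real bb) * Q" by (simp add: mult_ac)
    then have "c \<le> 3/100 * real bb" using Q0 by simp
    then have "D * c \<le> D * (3/100 * real bb)" using D0 by (rule mult_left_mono)
    moreover have "(real N - 1) * c \<le> c * Q + D * c"
      using c0 unfolding Q_def by (simp add: algebra_simps)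
    moreover have "(d + 3/100 * D) * real bb = d * real bb + D * (3/100 * real bb)"
      by (simp add: algebra_simps)
    ultimately show ?thesis using cQ unfolding c_def[symmetric] d_def[symmetric] D_def[symmetric] by linarith
  qed
  \<comment> \<open>The arcs at the \<open>w x\<close> leave \<open>A'\<close> but return as
    forbidden pairs, so the net saving on this side is \<open>h\<close>. The error has the factor
    6/100 because the degrees over \<open>X\<close> sum to at most \<open>2 * e\<close>.\<close>
  have PP: "real PP \<le> real bb * (real (card A) - real h + 6/100 * real e)"
  proof -
    have "real PP = (real N - 1) * real (card F) + real (card A') * real (card B')"
      unfolding PP_def using N2 by (simp add: of_nat_diff)
    also have "(real N - 1) * real (card F) \<le> (real N - 1) * (\<Sum>x\<in>X1. real (cost A B\<^sub>0 (w x) (y x)))"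
      using cF N2 by (intro mult_left_mono) (simp_all flip: of_nat_sum)
    also have "\<dots> = (\<Sum>x\<in>X1. (real N - 1) * real (cost A B\<^sub>0 (w x) (y x)))" by (rule sum_distrib_left)
    also have "\<dots> \<le> (\<Sum>x\<in>X1. (real (deg A (w x)) + 3/100 * real (deg B x)) * real bb)"
      by (intro sum_mono per)
    also have "\<dots> = (real dw + 3/100 * real (\<Sum>x\<in>X1. deg B x)) * real bb"
      by (simp add: dw_def sum_distrib_right sum_distrib_left sum.distrib algebra_simps)
    also have "\<dots> \<le> (real dw + 6/100 * real e) * real bb"
    proof (rule mult_right_mono)
      have "real (\<Sum>x\<in>X1. deg B x) \<le> 2 * real e" using sX by linarith
      then show "real dw + 3/100 * real (\<Sum>x\<in>X1. deg B x) \<le> real dw + 6/100 * real e" by argo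
    qed simp
    finally have "real PP \<le> (real dw + 6/100 * real e) * real bb + real (card A') * real (card B')" by simp
    also have "real (card A') * real (card B') \<le> (real (card A) - real h - real dw) * real bb"
      using cA' cB' unfolding h_def dw_def bb_def by (intro mult_mono) linarith+
    finally show ?thesis by (simp add: algebra_simps)
  qed
  define \<phi> where "\<phi> = card X1 * (n div 71)"
  have \<phi>: "real \<phi> \<le> 18 * real n / 71"
  proof -
    have "\<phi> \<le> 18 * (n div 71)" unfolding \<phi>_def using size by (intro mult_right_mono) auto
    moreover have "71 * (n div 71) \<le> n" by simp
    ultimately have "71 * \<phi> \<le> 18 * n" by linarith
    then show ?thesis by (simp add: field_simps flip: of_nat_mult)
  qed
  have nmu: "real n / real \<mu> \<le> real (n div \<mu>) + 1"
  proof -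
    have "n \<le> (n div \<mu> + 1) * \<mu>"
      using \<mu>(1) dividend_less_times_div[of \<mu> n] by (simp add: algebra_simps)
    then have "real n \<le> (real (n div \<mu>) + 1) * real \<mu>"
      by (metis of_nat_1 of_nat_add of_nat_le_iff of_nat_mult)
    then show ?thesis using \<mu>(1) by (simp add: field_simps)
  qed
  have bB: "real bb \<le> 2 * real n - real n / real \<mu> - real e"
    using cB0 b nmu unfolding bb_def e_def by linarith
  have aA: "real (card A) - real h \<le> real n - real \<mu> - real h" using \<mu>(3) by linarith
  have PP': "real PP \<le> (2 * real n - real n / real \<mu> - real e) * (real n - real \<mu> - real h + 6/100 * real e)"
  proof -
    have "real bb * (real (card A) - real h + 6/100 * real e)
        \<le> (2 * real n - real n / real \<mu> - real e) * (real n - real \<mu> - real h + 6/100 * real e)"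
      using bB aA cA' unfolding h_def by (intro mult_mono) linarith+
    then show ?thesis using PP by linarith
  qed
  have main: "real PP < real N * (real N - 1) \<or> real N - 1 - 2 * real \<delta>\<^sub>1 - 2 * real \<delta>\<^sub>2 - real \<phi> > 0 \<and>
    real PP * ((real N - 1 - 2 * real \<delta>\<^sub>1 - 2 * real \<delta>\<^sub>2 - real \<phi>) * (real N - 2) + real \<delta>\<^sub>1 * real (card B') + real \<delta>\<^sub>2 * real (card A'))
    < 2 * (real N - 1 - 2 * real \<delta>\<^sub>1 - 2 * real \<delta>\<^sub>2 - real \<phi>) * real N * (real N - 1) * (real N - 2)"
  proof (rule preplacement_balance[where \<mu> = \<mu> and n = n and \<sigma> = "real (card U + card X + card X1)"
        and k\<^sub>1 = "card U" and k\<^sub>2 = "card T" and h = h and e = e])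
    show "real N = real n - real (card U + card X + card X1)"
      unfolding N_def using size n2852 by (subst of_nat_diff) linarith+
    \<comment> \<open>\<open>card X1 <= card X <= card T + 3 * card U\<close>, so each vertex of
      \<open>U\<close> counts \<open>1 + 2 * 3\<close> times and each of \<open>T\<close>
      twice.\<close>
    show "real (card U + card X + card X1) \<le> 7 * real (card U) + 2 * real (card T)"
      using cX cX1 by linarith
    show "real (card U) \<le> 3 \<and> real \<delta>\<^sub>1 = 19 \<or> real (card U) = 4 \<and> 4 * real \<delta>\<^sub>1 - 12 \<le> real h \<and> 19 \<le> real \<delta>\<^sub>1"
    proof (cases "card U = 4")
      case True
      then show ?thesis using h4 U(5) by simp
    next
      case False
      then show ?thesis using U(2,6) by simp
    qed
    show "real (card T) \<le> 5 \<and> real \<delta>\<^sub>2 = 23 \<or> real (card T) = 6 \<and> 6 * real \<delta>\<^sub>2 - 30 \<le> real e \<and> 23 \<le> real \<delta>\<^sub>2"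
    proof (cases "card T = 6")
      case True
      then show ?thesis using e6 T(5) by simp
    next
      case False
      then show ?thesis using T(2,6) by simp
    qed
    show "real (card A') \<le> real n - real \<mu> - real h"
      using cA' \<mu>(3) unfolding h_def by linarith
    show "real (card B') \<le> 2 * real n - real n / real \<mu> - real e"
      using cB' bB unfolding bb_def by linarith
    show "real PP \<le> (2 * real n - real n / real \<mu> - real e) * (real n - real \<mu> - real h + 6/100 * real e)"
      by (rule PP')
    show "real \<phi> \<le> 18 * real n / 71" by (rule \<phi>)
  qed (use \<mu> h17 e19 in simp_all)
  have "lpack (V - S) A' (W - g ` S) B' F"
    using main
  proof
    assume "real PP < real N * (real N - 1)"
    also have "real N * (real N - 1) = real (N * (N - 1))" using N2 by (simp add: of_nat_diff)
    finally have "PP < N * (N - 1)" by (simp only: of_nat_less_iff)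
    then show ?thesis unfolding PP_def using N2 by (intro lpack_few[OF dA' dB' FVW cV' cW']) auto
  next
    \<comment> \<open>Positivity of the corresponding real expression rules out truncation in these
      subtractions. One of the two \<open>\<delta>\<^sub>2\<close> is the degree bound, the other
      bounds the forbidden images of a single vertex.\<close>
    define M where "M = N - 1 - 2 * \<delta>\<^sub>1 - 2 * \<delta>\<^sub>2 - \<phi>"
    assume *: "real N - 1 - 2 * real \<delta>\<^sub>1 - 2 * real \<delta>\<^sub>2 - real \<phi> > 0 \<and>
      real PP * ((real N - 1 - 2 * real \<delta>\<^sub>1 - 2 * real \<delta>\<^sub>2 - real \<phi>) * (real N - 2) + real \<delta>\<^sub>1 * real (card B') + real \<delta>\<^sub>2 * real (card A'))
      < 2 * (real N - 1 - 2 * real \<delta>\<^sub>1 - 2 * real \<delta>\<^sub>2 - real \<phi>) * real N * (real N - 1) * (real N - 2)"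
    then have Mle: "M + 2 * \<delta>\<^sub>1 + \<delta>\<^sub>2 + \<delta>\<^sub>2 + \<phi> + 1 = N" unfolding M_def by linarith
    then have Mr: "real N - 1 - 2 * real \<delta>\<^sub>1 - 2 * real \<delta>\<^sub>2 - real \<phi> = real M" by linarith
    have "real (PP * (M * (N - 2) + \<delta>\<^sub>1 * card B' + \<delta>\<^sub>2 * card A')) < real (2 * M * N * (N - 1) * (N - 2))"
      using *[THEN conjunct2] N2 unfolding Mr by (simp add: of_nat_diff)
    then have "PP * (M * (N - 2) + \<delta>\<^sub>1 * card B' + \<delta>\<^sub>2 * card A') < 2 * M * N * (N - 1) * (N - 2)"
      by (simp only: of_nat_less_iff)
    then show ?thesis
      unfolding PP_def using N2 Mle F1 F2
      by (intro lpack_swap[OF dA' dB' FVW cV' cW' _ degA' degB', where \<phi>\<^sub>1 = \<delta>\<^sub>2 and \<phi>\<^sub>2 = \<phi> and M = M])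
        (auto simp: \<phi>_def)
  qed
  then show ?thesis
    unfolding A'_def B'_def F_def by (intro lpack_extend[OF A SV injg gSW okS])
qed

section \<open>The packing theorem and the extremal example\<close>

text \<open>At most two vertices of very high degree need to be removed: each takes more than half
  of the current number of vertices in arcs, so after the second the first moment bound
  suffices.\<close>

theorem lpack_sparse:
  fixes V :: "'a set" and W :: "'b set"
  assumes A: "digr V A" and B: "digr W B" and n: "card V = n" "card W = n"
    and m: "m \<ge> 93" "n \<ge> 31 * m" "card A + m \<le> n" and b: "card B + n div m + 1 \<le> 2 * n"
  shows "lpack V A W B {}"
proof (cases "\<forall>x\<in>W. 100 * deg B x \<le> 51 * n")
  case True
  then show ?thesis using m by (intro lpack_moderate_degree[OF A B n _ m(2,3) b]) auto
next
  case False
  then obtain x where x: "x \<in> W" "51 * n \<le> 100 * deg B x" by force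
  have m91: "m \<ge> 91" using m(1) by simp
  obtain V' :: "'a set" and A' and W' :: "'b set" and B' c where
    A': "digr V' A'" and B': "digr W' B'" and n': "card V' = n - c" "card W' = n - c"
    and c: "c \<ge> 1" "c \<le> n div m" and cA': "card A' + (m - 1) \<le> n - c"
    and cB': "card B' + deg B x \<le> card B" and imp: "lpack V' A' W' B' {} \<Longrightarrow> lpack V A W B {}"
    using peel_high_degree[OF A B n m91 m(2,3) b x] by metis
  define q where "q = n div m"
  have qm: "q * m \<le> n" by (simp add: q_def)
  have q93: "q * 93 \<le> n" using mult_le_mono2[OF m(1), of q] qm by linarith
  have cq: "c \<le> q" using c by (simp add: q_def)
  have n0: "n \<ge> 2883" using m by linarith
  define N where "N = n - c"
  have Nc: "N + c = n" unfolding N_def using cq q93 by linarith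
  \<comment> \<open>At most \<open>n / m\<close> vertices are lost, and
    \<open>n - n / m = (n / m) * (m - 1)\<close>, so the ratio 31 survives the drop from
    \<open>m\<close> to \<open>m - 1\<close>.\<close>
  have N31: "N \<ge> 31 * (m - 1)"
  proof -
    have "31 * (m - 1) * m \<le> n * (m - 1)" using mult_le_mono1[OF m(2), of "m - 1"] by (simp add: mult_ac)
    also have "\<dots> = n * m - n" by (simp add: right_diff_distrib')
    also have "\<dots> \<le> n * m - c * m" using mult_le_mono1[OF cq, of m] qm by linarith
    also have "\<dots> = N * m" by (simp add: N_def left_diff_distrib')
    finally show ?thesis using m(1) by simp
  qed
  have "lpack V' A' W' B' {}"
  \<comment> \<open>If \<open>x\<close> has at least \<open>n - 1\<close> arcs, then at most
    \<open>n - q <= N\<close> arcs remain, against at most \<open>N - 92\<close> in the first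
    digraph.\<close>
  proof (cases "deg B x \<ge> n - 1")
    case True
    have "card B' \<le> N" using True cB' b cq unfolding N_def q_def[symmetric] by linarith
    moreover have "card A' + 92 \<le> N" using cA' m(1) unfolding N_def by linarith
    ultimately have "card A' * card B' \<le> (N - 92) * N" by (intro mult_mono) linarith+
    also have "\<dots> < (N - 1) * N" using N31 m(1) by (intro mult_strict_right_mono) linarith+
    finally show ?thesis
      using N31 m(1) by (intro lpack_few[OF A' B' _ n']) (simp_all add: N_def[symmetric] mult.commute)
  next
    case False
    have m92: "m - 1 \<ge> 92" using m(1) by simp
    define r where "r = N div (m - 1)"
    have "r * (m - 1) \<le> N" by (simp add: r_def)
    then have r92: "r * 92 \<le> N" using mult_le_mono2[OF m92, of r] by linarith
    have b': "card B' + N div (m - 1) + 1 \<le> 2 * N"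
      using cB' b x(2) cq q93 r92 n0 Nc unfolding q_def[symmetric] r_def[symmetric] by linarith
    note n'' = n'[folded N_def]
    show ?thesis
    proof (cases "\<forall>x\<in>W'. 100 * deg B' x \<le> 51 * N")
      case True
      then show ?thesis
        using cA' by (intro lpack_moderate_degree[OF A' B' n'' m92 N31 _ b']) (auto simp: N_def)
    next
      case False
      then obtain z where z: "z \<in> W'" "51 * N \<le> 100 * deg B' z" by force
      have m91: "m - 1 \<ge> 91" using m(1) by simp
      have a': "card A' + (m - 1) \<le> N" using cA' by (simp add: N_def)
      obtain V2 :: "'a set" and A2 and W2 :: "'b set" and B2 c2 where
        A2: "digr V2 A2" and B2: "digr W2 B2" and n2: "card V2 = N - c2" "card W2 = N - c2"
        and c2: "c2 \<le> N div (m - 1)" and cA2: "card A2 + (m - 1 - 1) \<le> N - c2"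
        and cB2: "card B2 + deg B' z \<le> card B'" and imp2: "lpack V2 A2 W2 B2 {} \<Longrightarrow> lpack V' A' W' B' {}"
        using peel_high_degree[OF A' B' n'' m91 N31 a' b' z] by metis
      define M where "M = N - c2"
      have "c2 \<le> r" using c2 by (simp add: r_def)
      \<comment> \<open>The two removed vertices account for at least 51/100 of \<open>n\<close> and
        of \<open>N\<close> in arcs, leaving at most about \<open>0.98 * n\<close>; the vertices
        lost are too few to spoil this.\<close>
      then have "card B2 \<le> M"
        using cB2 cB' b x(2) z(2) cq q93 r92 n0 Nc unfolding q_def[symmetric] M_def by linarith
      moreover have "card A2 + 91 \<le> M" using cA2 m(1) unfolding M_def by linarith
      ultimately have "card A2 * card B2 \<le> (M - 91) * M" by (intro mult_mono) linarith+
      also have "\<dots> < (M - 1) * M"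
        using cA2 m(1) unfolding M_def by (intro mult_strict_right_mono) linarith+
      finally have "lpack V2 A2 W2 B2 {}"
        using cA2 m(1) by (intro lpack_few[OF A2 B2 _ n2]) (simp_all add: M_def[symmetric] mult.commute)
      then show ?thesis by (rule imp2)
    qed
  qed
  then show ?thesis by (rule imp)
qed

section \<open>The extremal pair and the value of \<open>mu\<close>\<close>

lemma pair_digraph_iff_digr: "pair_digraph D \<longleftrightarrow> digr (pverts D) (parcs D)"
proof
  assume "pair_digraph D"
  then interpret pair_digraph D .
  show "digr (pverts D) (parcs D)"
    using pair_finite_verts arc_fst_in_verts arc_snd_in_verts pair_no_loops
    unfolding digr_def by (force simp: subset_iff)
next
  assume D: "digr (pverts D) (parcs D)"
  show "pair_digraph D" using D digr_finite[OF D] by unfold_locales (auto simp: digr_def)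
qed

text \<open>The first digraph consists of \<open>m\<close> in-stars with centres \<open>0, ..., m - 1\<close>, each with at least
  \<open>q - 1\<close> leaves; in the second one the vertex \<open>0\<close> sends arcs to all others and receives arcs from
  all but \<open>q - 2\<close> of them.\<close>

lemma unpackable_digraphs:
  fixes m n :: nat
  assumes m: "m \<ge> 1" "n \<ge> 2 * m"
  shows "\<exists>(D :: nat pair_pre_digraph) (D' :: nat pair_pre_digraph).
    pair_digraph D \<and> pair_digraph D' \<and> card (pverts D) = n \<and> card (pverts D') = n \<and>
    card (parcs D) = n - m \<and> card (parcs D') = 2 * n - n div m \<and> \<not> pack D D'"
proof -
  define q where "q = n div m"
  have qm: "q * m \<le> n" by (simp add: q_def)
  have q2: "q \<ge> 2" using m div_le_mono[of "2 * m" n m] by (simp add: q_def)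
  have qn: "q \<le> n" by (simp add: q_def)
  have n2: "n \<ge> 2" using q2 qn by linarith
  define A where "A = (\<lambda>i. (i, i mod m)) ` {m..<n}"
  define B where "B = Pair 0 ` {1..<n} \<union> (\<lambda>i. (i, 0)) ` {1..<n + 2 - q}"
  define D where "D = \<lparr>pverts = {..<n}, parcs = A\<rparr>"
  define D' where "D' = \<lparr>pverts = {..<n}, parcs = B\<rparr>"
  have mod: "i mod m < m" for i using m(1) by simp
  have "i mod m < n \<and> i mod m \<noteq> i" if "m \<le> i" for i using mod[of i] m that by linarith
  then have "digr {..<n} A"
    unfolding digr_def A_def by (auto dest: sym)
  moreover have "digr {..<n} B"
    unfolding digr_def B_def using n2 q2 by auto
  moreover have "card A = n - m"
    unfolding A_def by (subst card_image) (auto simp: inj_on_def)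
  moreover have "card B = 2 * n - q"
  proof -
    have "card (Pair (0::nat) ` {1..<n}) = n - 1" by (subst card_image) (auto simp: inj_on_def)
    moreover have "card ((\<lambda>i. (i, 0::nat)) ` {1..<n + 2 - q}) = n + 1 - q"
      by (subst card_image) (auto simp: inj_on_def)
    moreover have "Pair (0::nat) ` {1..<n} \<inter> (\<lambda>i. (i, 0)) ` {1..<n + 2 - q} = {}" by auto
    ultimately have "card B = (n - 1) + (n + 1 - q)"
      unfolding B_def by (subst card_Un_disjoint) auto
    then show ?thesis using qn n2 by linarith
  qed
  moreover have "\<not> pack D D'"
  proof
    assume "pack D D'"
    then obtain f where f: "inj_on f {..<n}" "f ` {..<n} \<subseteq> {..<n}"
      and ok: "\<And>u v. (u, v) \<in> A \<Longrightarrow> (f u, f v) \<notin> B"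
      unfolding pack_def is_packing_def D_def D'_def by auto
    have "f ` {..<n} = {..<n}" using f by (simp add: endo_inj_surj)
    then have "0 \<in> f ` {..<n}" using n2 by auto
    then obtain s where s: "s < n" "f s = 0" by auto
    have inj: "i = j" if "i < n" "j < n" "f i = f j" for i j using inj_onD[OF f(1)] that by auto
    have rng: "f i < n" if "i < n" for i using f(2) that by auto
    show False
    proof (cases "s < m")
      \<comment> \<open>A leaf \<open>s\<close> on vertex 0 fails because its arc to the centre
        meets an arc from 0 to every other vertex.\<close>
      case False
      then have "(s, s mod m) \<in> A" using s by (auto simp: A_def)
      then have "(f s, f (s mod m)) \<notin> B" by (rule ok)
      moreover have lt: "s mod m < n" using mod[of s] m by linarith
      then have "f (s mod m) \<noteq> 0" using inj[of "s mod m" s] s False mod[of s] by auto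
      ultimately show False using s(2) rng[OF lt] by (auto simp: B_def)
    next
      case True
      \<comment> \<open>These are \<open>q - 1\<close> leaves of the star centred at
        \<open>s\<close>, present since \<open>s + t * m < q * m\<close> for \<open>t < q\<close>.
        Their arcs into \<open>s\<close> force them onto the \<open>q - 2\<close> vertices without
        an arc to 0, one too few.\<close>
      define I where "I = (\<lambda>t. s + t * m) ` {1..<q}"
      have In: "i < n \<and> m \<le> i \<and> i mod m = s" if i: "i \<in> I" for i
      proof -
        obtain t where it: "i = s + t * m" and "t \<in> {1..<q}" using i unfolding I_def by (rule imageE)
        then have t: "1 \<le> t" "t < q" by auto
        have "t * m + m \<le> q * m" using mult_le_mono1[of "t + 1" q m] t(2) by simp
        moreover have "m \<le> t * m" using mult_le_mono1[OF t(1), of m] by simp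
        ultimately have "s + t * m < n" "m \<le> s + t * m" using True qm by linarith+
        then show ?thesis unfolding it using True by simp
      qed
      have "card I = q - 1"
        unfolding I_def using m(1) by (subst card_image) (auto simp: inj_on_def)
      moreover have "f ` I \<subseteq> {n + 2 - q..<n}"
      proof clarify
        fix i assume i: "i \<in> I"
        note iI = In[OF i]
        have "(i, i mod m) \<in> A" using iI by (auto simp: A_def)
        then have "(i, s) \<in> A" using iI by simp
        then have "(f i, 0) \<notin> B" using ok[of i s] s(2) by simp
        moreover have "f i \<noteq> 0" using inj[of i s] s iI True by auto
        ultimately have "f i \<ge> n + 2 - q" by (auto simp: B_def)
        then show "f i \<in> {n + 2 - q..<n}" using rng iI by auto
      qed
      then have "card (f ` I) \<le> q - 2" using card_mono[of "{n + 2 - q..<n}" "f ` I"] qn by auto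
      moreover have "card (f ` I) = card I"
        using f(1) In by (intro card_image) (auto intro: inj_on_subset)
      ultimately show False using q2 by simp
    qed
  qed
  ultimately show ?thesis
    by (intro exI[of _ D] exI[of _ D']) (auto simp: pair_digraph_iff_digr D_def D'_def q_def)
qed

theorem theorem2:
  fixes m n :: nat
  assumes "m \<ge> 93" and "n \<ge> 31 * m"
  shows "int (mu n (n - m)) = 2 * int n - \<lfloor>real n / real m\<rfloor>"
proof -
  have "mu n (n - m) = 2 * n - n div m"
    unfolding mu_def
  proof (rule Least_equality)
    show "\<exists>(D :: nat pair_pre_digraph) (D' :: nat pair_pre_digraph).
      pair_digraph D \<and> pair_digraph D' \<and> card (pverts D) = n \<and> card (pverts D') = n \<and>
      card (parcs D) = n - m \<and> card (parcs D') = 2 * n - n div m \<and> \<not> pack D D'"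
      using assms by (intro unpackable_digraphs) auto
  next
    fix l assume "\<exists>(D :: nat pair_pre_digraph) (D' :: nat pair_pre_digraph).
      pair_digraph D \<and> pair_digraph D' \<and> card (pverts D) = n \<and> card (pverts D') = n \<and>
      card (parcs D) = n - m \<and> card (parcs D') = l \<and> \<not> pack D D'"
    then obtain D D' :: "nat pair_pre_digraph" where D: "digr (pverts D) (parcs D)" "digr (pverts D') (parcs D')"
      "card (pverts D) = n" "card (pverts D') = n" "card (parcs D) = n - m" "card (parcs D') = l"
      and no: "\<not> pack D D'" unfolding pair_digraph_iff_digr by blast
    show "2 * n - n div m \<le> l"
    proof (rule ccontr)
      assume "\<not> ?thesis"
      then have "lpack (pverts D) (parcs D) (pverts D') (parcs D') {}"
        using assms D(5,6) by (intro lpack_sparse[OF D(1-4) assms]) auto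
      then have "pack D D'"
        unfolding lpack_def pack_def is_packing_def bij_betw_def by blast
      then show False using no by contradiction
    qed
  qed
  moreover have "\<lfloor>real n / real m\<rfloor> = int (n div m)"
    by (simp add: floor_divide_of_nat_eq)
  moreover have "n div m \<le> 2 * n" using div_le_dividend[of n m] by linarith
  ultimately show ?thesis by (simp add: of_nat_diff)
qed

end
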